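(* Let $\epsilon>0$ be fixed. Consider a sequence of graphs $G=G_n$, where $G$ is an $(n,d,\lambda)$-graph with $d=d(n)$ and $\lambda=\lambda(n)$, and suppose that for all sufficiently large $n$ $$\frac{d}{\lambda}\ge (\log n)^{1+\epsilon},$$ and moreover $$\log d\cdot \log\frac{d}{\lambda}\gg \log n \quad\text{(i.e. } \tfrac{\log d\cdot\log(d/\lambda)}{\log n}\to\infty \text{ as } n\to\infty).$$ Then the number $h(G)$ of Hamilton cycles in $G$ satisfies $$h(G)=n!\left(\frac{d}{n}\right)^n(1+o(1))^n,$$ where $o(1)$ denotes a quantity tending to $0$ as $n\to\infty$.
   Context: An $(n,d,\lambda)$-graph is a graph on $n$ vertices which is $d$-regular and such that every eigenvalue of its adjacency matrix other than the largest one (which equals $d$) has absolute value at most $\lambda$. All logarithms are natural. $h(G)$ denotes the number of Hamilton cycles in $G$. *)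

theory Defs
  imports Complex_Main "HOL-Computational_Algebra.Polynomial" "Jordan_Normal_Form.Char_Poly"
begin

definition simple_graph_on :: "'a set \<Rightarrow> 'a set set \<Rightarrow> bool" where
  "simple_graph_on V E \<longleftrightarrow> finite V \<and> (\<forall>e\<in>E. e \<subseteq> V \<and> card e = 2)"

definition vertex_degree :: "'a set set \<Rightarrow> 'a \<Rightarrow> nat" where
  "vertex_degree E v = card {e \<in> E. v \<in> e}"

definition adjacency_mat :: "nat \<Rightarrow> nat set set \<Rightarrow> real mat" where
  "adjacency_mat n E = mat n n (\<lambda>(i, j). if {i, j} \<in> E then 1 else 0)"

(* Eigenvalues with multiplicity. An adjacency matrix is real symmetric, so its
   characteristic polynomial splits over the reals and there are n of them. *)
definition adjacency_eigenvalues :: "nat \<Rightarrow> nat set set \<Rightarrow> real multiset" where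
  "adjacency_eigenvalues n E = proots (char_poly (adjacency_mat n E))"

(* The largest eigenvalue of a d-regular graph is d. Only one copy of it is exempt
   from the bound: if d has multiplicity at least 2, then d <= lam is required. *)
definition ndl_graph :: "nat \<Rightarrow> nat \<Rightarrow> real \<Rightarrow> nat set set \<Rightarrow> bool" where
  "ndl_graph n d lam E \<longleftrightarrow>
     simple_graph_on {..<n} E \<and>
     (\<forall>v<n. vertex_degree E v = d) \<and>
     (\<forall>\<mu> \<in># adjacency_eigenvalues n E - {#real d#}. \<bar>\<mu>\<bar> \<le> lam)"

definition closed_walk_edges :: "'a list \<Rightarrow> 'a set set" where
  "closed_walk_edges vs = {{vs ! i, vs ! (Suc i mod length vs)} | i. i < length vs}"

(* A Hamilton cycle is identified with its edge set, so the choices of starting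
   vertex and direction are not counted separately. *)
definition hamilton_cycles :: "'a set \<Rightarrow> 'a set set \<Rightarrow> 'a set set set" where
  "hamilton_cycles V E =
     {C. C \<subseteq> E \<and> (\<exists>vs. distinct vs \<and> set vs = V \<and> length vs \<ge> 3 \<and> C = closed_walk_edges vs)}"

definition num_hamilton_cycles :: "'a set \<Rightarrow> 'a set set \<Rightarrow> nat" where
  "num_hamilton_cycles V E = card (hamilton_cycles V E)"

end

theory Submission
  imports Defs "HOL-Analysis.Convex" "HOL-Real_Asymp.Real_Asymp" "Jordan_Normal_Form.Schur_Decomposition"
begin

text \<open>
  Count directed linear forests in $G$ by adding arcs one at a time. By expander mixing, a forest with
  $r$ arcs has $(1+o(1))\,d(n-r)^2/n$ extensions as long as $n-r$ is much larger than $\lambda n/d$, so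
  there are $n!\,(d/n)^n e^{o(n)}$ forests with $s$ components for a suitable $s = o(n/\log n)$. The same
  count, for partial permutations instead of forests, bounds $h(G)$ from above.

  For the lower bound, join the paths of a forest arbitrarily into a Hamilton path of the complete
  graph and remove its non-edges by few exchanges, so that only $e^{o(n)}$ forests lead to the same
  Hamilton cycle. While more than order $(\lambda/d)^2 n$ non-edges remain, swapping two adjacent blocks
  of the path removes one of them at the cost of three edges. After that, each non-edge is cut out by
  closing the path with $O(\log n)$ Posa rotations. To close a path, cut it into $O(\log n)$ blocks,
  each with a core of vertices of large degree inside the block. Rotations move both ends to vertices
  that see the cores of almost all blocks and leave most blocks unbroken. Picking two such
  blocks, the left end is rotated with pivots in the first and the right end with pivots in the second.
  These rotations do not interfere, and mixing gives an edge between the two sets of ends so obtained.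
\<close>

subsection \<open>From eigenvalues to expander mixing\<close>

text \<open>The obstacle is the entropy of the repair. Each exchanged edge costs a factor polynomial
  in \<open>n\<close>, so only o(n/log n) exchanges are affordable. The cutoff \<open>s\<close> must
  exceed \<open>\<eta> * n\<close> by an unbounded factor for mixing to count extensions accurately;
  as lambda/d is at most \<open>\<eta>\<close> = (log n)^-(1+\<epsilon>), such an \<open>s\<close>
  can still be o(n/log n). Repairing all of about \<open>s\<close> non-edges by Posa rotations would
  take s log n exchanges, hence would need s = o(n/log^2 n). This is why the cheap block swaps come
  first: what they leave costs about \<eta>^2 n log n exchanges, and the resulting exponent \<eta>^2
  n log^2 n = n (log n)^(-2 \<epsilon>) is o(n). On the spectral side no orthonormal eigenbasis is
  built. Eigenvalues enter only through traces of even powers of the adjacency matrix A. These bound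
  the Frobenius norms of the powers of A - (d/n) J, with J the all-ones matrix, and high powers
  recover the operator norm.\<close>

lemma diag_pow_upper_triangular:
  fixes B :: "'a::comm_ring_1 mat"
  assumes B: "B \<in> carrier_mat n n" and ut: "upper_triangular B"
  shows "upper_triangular (B ^\<^sub>m k) \<and> (\<forall>i<n. (B ^\<^sub>m k) $$ (i,i) = (B $$ (i,i)) ^ k)"
proof (induction k)
  case 0
  then show ?case using B by auto
next
  case (Suc k)
  have c: "B ^\<^sub>m k \<in> carrier_mat n n" using B by simp
  have e: "(B ^\<^sub>m Suc k) $$ (i,j) = (\<Sum>l<n. (B ^\<^sub>m k) $$ (i,l) * B $$ (l,j))"
    if "i < n" "j < n" for i j
    using that B c by (simp add: scalar_prod_def lessThan_atLeast0)
  have z1: "(B ^\<^sub>m k) $$ (i,l) = 0" if "l < i" "i < n" for i l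
    using Suc c that by auto
  have z2: "B $$ (i,l) = 0" if "l < i" "i < n" for i l
    using ut B that by auto
  have "(B ^\<^sub>m Suc k) $$ (i,j) = 0" if "j < i" "i < n" for i j
  proof -
    have "(B ^\<^sub>m k) $$ (i,l) * B $$ (l,j) = 0" if "l < n" for l
      using z1[of l i] z2[of j l] \<open>j < i\<close> \<open>i < n\<close> that by (cases "l < i") auto
    then show ?thesis using e[of i j] that by simp
  qed
  moreover have "(B ^\<^sub>m Suc k) $$ (i,i) = (B $$ (i,i)) ^ Suc k" if "i < n" for i
  proof -
    have "(\<Sum>l<n. (B ^\<^sub>m k) $$ (i,l) * B $$ (l,i)) = (\<Sum>l\<in>{i}. (B ^\<^sub>m k) $$ (i,l) * B $$ (l,i))"
    proof (rule sum.mono_neutral_right)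
      show "\<forall>l\<in>{..<n} - {i}. (B ^\<^sub>m k) $$ (i,l) * B $$ (l,i) = 0"
      proof
        fix l assume "l \<in> {..<n} - {i}"
        then show "(B ^\<^sub>m k) $$ (i,l) * B $$ (l,i) = 0"
          using z1[of l i] z2[of i l] that by (cases "l < i") auto
      qed
    qed (use that in auto)
    then show ?thesis using e[of i i] Suc that by simp
  qed
  ultimately show ?case using B by (auto intro!: upper_triangularI)
qed

lemma trace_mult_commute:
  fixes X Y :: "'a::comm_ring_1 mat"
  assumes "X \<in> carrier_mat n n" "Y \<in> carrier_mat n n"
  shows "(\<Sum>i<n. (X * Y) $$ (i,i)) = (\<Sum>i<n. (Y * X) $$ (i,i))"
proof -
  have "(\<Sum>i<n. (X * Y) $$ (i,i)) = (\<Sum>i<n. \<Sum>j<n. X $$ (i,j) * Y $$ (j,i))"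
    using assms by (intro sum.cong) (auto simp: scalar_prod_def lessThan_atLeast0)
  also have "\<dots> = (\<Sum>j<n. \<Sum>i<n. X $$ (i,j) * Y $$ (j,i))" by (rule sum.swap)
  also have "\<dots> = (\<Sum>i<n. (Y * X) $$ (i,i))"
    using assms by (intro sum.cong) (auto simp: scalar_prod_def lessThan_atLeast0 mult.commute)
  finally show ?thesis .
qed

text \<open>Schur decomposition replaces \<open>A\<close> by a similar upper triangular matrix with
  diagonal \<open>es\<close>, and the trace is cyclic. Multiplicities come directly from the
  characteristic polynomial.\<close>

lemma trace_pow_eigenvalues:
  fixes A :: "real mat"
  assumes A: "A \<in> carrier_mat n n" and cp: "char_poly A = (\<Prod>e\<leftarrow>es. [:- e, 1:])"
  shows "(\<Sum>i<n. (A ^\<^sub>m k) $$ (i,i)) = sum_list (map (\<lambda>e. e ^ k) es)"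
proof -
  obtain B P Q where dec: "schur_decomposition A es = (B,P,Q)" by (metis prod_cases3)
  from schur_decomposition[OF A cp dec]
  have sim: "similar_mat_wit A B P Q" and ut: "upper_triangular B" and di: "diag_mat B = es" by auto
  note w = similar_mat_witD2[OF A sim]
  have c: "B ^\<^sub>m k \<in> carrier_mat n n" using w by simp
  have "(\<Sum>i<n. (A ^\<^sub>m k) $$ (i,i)) = (\<Sum>i<n. ((P * B ^\<^sub>m k) * Q) $$ (i,i))"
    using similar_mat_wit_pow_id[OF sim] by simp
  also have "\<dots> = (\<Sum>i<n. (Q * (P * B ^\<^sub>m k)) $$ (i,i))"
    by (rule trace_mult_commute) (use w c in auto)
  also have "Q * (P * B ^\<^sub>m k) = B ^\<^sub>m k"
    using assoc_mult_mat[OF w(7) w(6) c] w c by simp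
  also have "(\<Sum>i<n. (B ^\<^sub>m k) $$ (i,i)) = (\<Sum>i<n. (B $$ (i,i)) ^ k)"
    using diag_pow_upper_triangular[OF w(5) ut, of k] by simp
  also have "\<dots> = sum_list (map (\<lambda>e. e ^ k) es)"
    unfolding di[symmetric] diag_mat_def using w(5)
    by (simp add: sum_list_sum_nth lessThan_atLeast0 o_def)
  finally show ?thesis .
qed

text \<open>The characteristic polynomial factors over the complex numbers. For an eigenvector
  \<open>v\<close> of a root \<open>a\<close>, the Hermitian form of \<open>A\<close> at
  \<open>v\<close> equals \<open>a * N\<close> with \<open>N\<close> the squared norm of
  \<open>v\<close>; it is its own conjugate because \<open>A\<close> is real symmetric, so
  \<open>a\<close> is real.\<close>

lemma real_symmetric_char_poly_splits:
  fixes A :: "real mat"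
  assumes A: "A \<in> carrier_mat n n" and sym: "\<And>i j. i < n \<Longrightarrow> j < n \<Longrightarrow> A $$ (i,j) = A $$ (j,i)"
  obtains es where "char_poly A = (\<Prod>e\<leftarrow>es. [:- e, 1:])"
proof -
  let ?C = "map_mat complex_of_real A"
  have C: "?C \<in> carrier_mat n n" using A by simp
  obtain as where as: "char_poly ?C = (\<Prod>a\<leftarrow>as. [:- a, 1:])"
    using char_poly_factorized[OF C] by blast
  have real: "a \<in> \<real>" if "a \<in> set as" for a
  proof -
    have "poly (char_poly ?C) a = 0" unfolding as using that
      by (auto simp: poly_prod_list prod_list_zero_iff)
    then obtain v where v: "v \<in> carrier_vec n" "v \<noteq> 0\<^sub>v n" "?C *\<^sub>v v = a \<cdot>\<^sub>v v"
      using eigenvalue_root_char_poly[OF C, of a] A unfolding eigenvalue_def eigenvector_def by auto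
    have ent: "(\<Sum>j<n. A $$ (i,j) * v $ j) = a * v $ i" if "i < n" for i
    proof -
      have "(?C *\<^sub>v v) $ i = (\<Sum>j<n. A $$ (i,j) * v $ j)"
        using A v(1) that by (simp add: scalar_prod_def lessThan_atLeast0)
      then show ?thesis using v that by simp
    qed
    define N where "N = (\<Sum>i<n. cnj (v $ i) * v $ i)"
    have "a * N = (\<Sum>i<n. cnj (v $ i) * (a * v $ i))"
      by (simp add: N_def sum_distrib_left mult_ac)
    also have "\<dots> = (\<Sum>i<n. \<Sum>j<n. A $$ (i,j) * cnj (v $ i) * v $ j)"
      by (intro sum.cong refl) (simp add: ent[symmetric] sum_distrib_left mult_ac)
    finally have 1: "a * N = (\<Sum>i<n. \<Sum>j<n. A $$ (i,j) * cnj (v $ i) * v $ j)" .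
    have "cnj (a * N) = (\<Sum>i<n. \<Sum>j<n. A $$ (i,j) * v $ i * cnj (v $ j))"
      unfolding 1 by simp
    also have "\<dots> = (\<Sum>j<n. \<Sum>i<n. A $$ (i,j) * v $ i * cnj (v $ j))" by (rule sum.swap)
    also have "\<dots> = a * N" unfolding 1
      by (intro sum.cong refl) (auto simp: sym mult_ac)
    finally have 2: "cnj (a * N) = a * N" .
    have N: "N = of_real (\<Sum>i<n. (cmod (v $ i))\<^sup>2)"
      unfolding N_def of_real_sum
      by (intro sum.cong refl) (simp only: complex_norm_square mult.commute)
    obtain i where "i < n" "v $ i \<noteq> 0"
      using v(1,2) by (metis carrier_vecD eq_vecI index_zero_vec)
    then have "(\<Sum>i<n. (cmod (v $ i))\<^sup>2) > 0"
      by (intro sum_pos2[of _ i]) auto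
    then have "N \<noteq> 0" "cnj N = N" using N by (simp_all add: complex_eq_iff)
    then have "cnj a = a" using 2 by simp
    then show ?thesis by (simp add: Reals_cnj_iff)
  qed
  have "map complex_of_real (map Re as) = as"
    by (simp add: o_def) (rule map_idI, simp add: real)
  then have as': "as = map complex_of_real (map Re as)" by simp
  have "map_poly complex_of_real (char_poly A) = char_poly ?C" by (rule of_real_hom.char_poly_hom[OF A, symmetric])
  also have "\<dots> = (\<Prod>a\<leftarrow>map complex_of_real (map Re as). [:- a, 1:])" using as by (simp only: as'[symmetric])
  also have "\<dots> = map_poly complex_of_real (\<Prod>e\<leftarrow>map Re as. [:- e, 1:])"
  proof -
    interpret mp: map_poly_inj_comm_ring_hom complex_of_real ..
    show ?thesis by (simp add: mp.hom_prod_list o_def)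
  qed
  finally have "char_poly A = (\<Prod>e\<leftarrow>map Re as. [:- e, 1:])"
    by (metis of_real_hom.coeff_map_poly_hom of_real_eq_iff poly_eqI)
  then show thesis by (rule that)
qed

text \<open>Pairs are ordered, so an edge inside the intersection of \<open>S\<close> and
  \<open>T\<close> counts twice. This matches the bilinear form of the adjacency matrix at two
  indicator vectors.\<close>

definition edge_pairs :: "'a set set \<Rightarrow> 'a set \<Rightarrow> 'a set \<Rightarrow> ('a \<times> 'a) set" where
  "edge_pairs E S T = {(u,v) \<in> S \<times> T. {u,v} \<in> E}"

lemma ndl_row_sum:
  assumes G: "ndl_graph n d lam E" and i: "i < n"
  shows "(\<Sum>j<n. adjacency_mat n E $$ (i,j)) = real d"
proof -
  have "(\<Sum>j<n. adjacency_mat n E $$ (i,j)) = real (card {j\<in>{..<n}. {i,j} \<in> E})"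
    using i by (simp add: adjacency_mat_def sum.If_cases Int_def)
  also have "card {j\<in>{..<n}. {i,j} \<in> E} = card {e \<in> E. i \<in> e}"
  proof (rule bij_betw_same_card)
    show "bij_betw (\<lambda>j. {i,j}) {j\<in>{..<n}. {i,j} \<in> E} {e \<in> E. i \<in> e}"
    proof (rule bij_betw_imageI)
      show "inj_on (\<lambda>j. {i,j}) {j\<in>{..<n}. {i,j} \<in> E}"
        by (auto simp: inj_on_def doubleton_eq_iff)
      show "(\<lambda>j. {i,j}) ` {j\<in>{..<n}. {i,j} \<in> E} = {e \<in> E. i \<in> e}"
      proof safe
        fix e assume e: "e \<in> E" "i \<in> e"
        then have c: "card e = 2" "e \<subseteq> {..<n}" using G unfolding ndl_graph_def simple_graph_on_def by auto
        then obtain a b where "e = {a,b}" by (meson card_2_iff)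
        then show "e \<in> (\<lambda>j. {i,j}) ` {j\<in>{..<n}. {i,j} \<in> E}" using e c by (auto simp: insert_commute)
      qed
    qed
  qed
  also have "real (card {e \<in> E. i \<in> e}) = d" using G i unfolding ndl_graph_def vertex_degree_def by auto
  finally show ?thesis .
qed

text \<open>For k >= 1 the left side is the trace of the k-th power of A - (d/n) J, with J the
  all-ones matrix. The all-ones vector shows that \<open>d\<close> occurs in the spectrum; removing
  one copy leaves n - 1 eigenvalues, each contributing at most \<open>lam ^ k\<close> since
  \<open>k\<close> is even.\<close>

lemma ndl_deviation_trace_bound:
  assumes G: "ndl_graph n d lam E" and n: "n > 0" and k: "even k"
  shows "(\<Sum>i<n. (adjacency_mat n E ^\<^sub>m k) $$ (i,i)) - real d ^ k \<le> real n * lam ^ k"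
proof -
  let ?A = "adjacency_mat n E"
  have A: "?A \<in> carrier_mat n n" by (simp add: adjacency_mat_def)
  have sym: "?A $$ (i,j) = ?A $$ (j,i)" if "i < n" "j < n" for i j
    using that by (simp add: adjacency_mat_def insert_commute)
  obtain es where es: "char_poly ?A = (\<Prod>e\<leftarrow>es. [:- e, 1:])"
    using real_symmetric_char_poly_splits[OF A sym] by blast
  have pr: "adjacency_eigenvalues n E = mset es"
  proof -
    have "proots (\<Prod>e\<leftarrow>es. [:- e, 1:]) = mset es"
    proof (induction es)
      case (Cons a es)
      have nz: "(\<Prod>e\<leftarrow>es. [:- e, 1:]) \<noteq> (0 :: real poly)" by (auto simp: prod_list_zero_iff)
      show ?case unfolding list.map prod_list.Cons
        by (subst proots_mult) (use nz Cons in simp_all)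
    qed simp
    then show ?thesis by (simp add: adjacency_eigenvalues_def es)
  qed
  have len: "length es = n"
    using degree_monic_char_poly[OF A] unfolding es by (simp add: degree_linear_factors)
  have deg: "(\<Sum>j<n. ?A $$ (i,j)) = real d" if "i < n" for i
    by (rule ndl_row_sum[OF G that])
  have "eigenvector ?A (Matrix.vec n (\<lambda>_. 1)) (real d)"
  proof -
    have "?A *\<^sub>v Matrix.vec n (\<lambda>_. 1) = real d \<cdot>\<^sub>v Matrix.vec n (\<lambda>_. 1)"
      using A deg by (intro eq_vecI) (auto simp: scalar_prod_def lessThan_atLeast0)
    moreover have "Matrix.vec n (\<lambda>_. 1::real) \<noteq> 0\<^sub>v n" using n
      by (metis index_vec index_zero_vec(1) zero_neq_one)
    ultimately show ?thesis using A unfolding eigenvector_def by auto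
  qed
  then have "poly (char_poly ?A) (real d) = 0"
    using eigenvalue_root_char_poly[OF A, of "real d"] by (auto simp: eigenvalue_def)
  then have din: "real d \<in># mset es" unfolding es by (auto simp: poly_prod_list prod_list_zero_iff)
  have "(\<Sum>i<n. (?A ^\<^sub>m k) $$ (i,i)) = (\<Sum>e\<in>#mset es. e ^ k)"
    using trace_pow_eigenvalues[OF A es, of k] by (simp flip: sum_mset_sum_list)
  also have "\<dots> = real d ^ k + (\<Sum>e\<in>#mset es - {#real d#}. e ^ k)"
    using arg_cong[OF insert_DiffM[OF din], of "\<lambda>M. \<Sum>e\<in>#M. e ^ k"] by simp
  also have "(\<Sum>e\<in>#mset es - {#real d#}. e ^ k) \<le> (\<Sum>e\<in>#mset es - {#real d#}. lam ^ k)"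
  proof (rule sum_mset_mono)
    fix e assume "e \<in># mset es - {#real d#}"
    then have "\<bar>e\<bar> \<le> lam" using G pr unfolding ndl_graph_def by auto
    then have "\<bar>e\<bar> ^ k \<le> lam ^ k" by (intro power_mono) auto
    then show "e ^ k \<le> lam ^ k" using k by (simp add: power_even_abs)
  qed
  also have "\<dots> \<le> real n * lam ^ k"
    using din len k by (simp add: size_Diff_singleton mult_right_mono zero_le_even_power)
  finally show ?thesis by simp
qed

text \<open>Log-convexity makes the ratios of consecutive terms nondecreasing, so each is at least
  the first one. The hypothesis \<open>z\<close> covers vanishing terms. The sequence will be the
  squared norms of the iterates of a symmetric operator.\<close>

lemma log_convex_growth:
  fixes a :: "nat \<Rightarrow> real"
  assumes nn: "\<And>k. a k \<ge> 0" and lc: "\<And>k. (a (Suc k))\<^sup>2 \<le> a k * a (Suc (Suc k))"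
    and z: "\<And>k. a k = 0 \<Longrightarrow> a (Suc k) = 0"
  shows "a 0 * (a 1 / a 0) ^ m \<le> a m"
proof (cases "a 0 = 0")
  case True
  then show ?thesis using nn[of m] by simp
next
  case False
  have step: "a k * a 1 \<le> a (Suc k) * a 0" for k
  proof (induction k)
    case 0 then show ?case by simp
  next
    case (Suc k)
    show ?case
    proof (cases "a k = 0")
      case True then show ?thesis using z[of k] z[of "Suc k"] by simp
    next
      case False
      have "a k * (a (Suc k) * a 1) = a (Suc k) * (a k * a 1)" by simp
      also have "\<dots> \<le> a (Suc k) * (a (Suc k) * a 0)" using Suc nn by (intro mult_left_mono) auto
      also have "\<dots> = (a (Suc k))\<^sup>2 * a 0" by (simp add: power2_eq_square)
      also have "\<dots> \<le> (a k * a (Suc (Suc k))) * a 0" using lc nn by (intro mult_right_mono) auto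
      finally have "a k * (a (Suc k) * a 1) \<le> a k * (a (Suc (Suc k)) * a 0)" by (simp add: mult_ac)
      then show ?thesis using False nn[of k] by (metis less_le mult_le_cancel_left_pos)
    qed
  qed
  have a0: "a 0 > 0" using False nn[of 0] by simp
  show ?thesis
  proof (induction m)
    case (Suc m)
    have "a 0 * (a 1 / a 0) ^ Suc m = (a 0 * (a 1 / a 0) ^ m) * (a 1 / a 0)" by simp
    also have "\<dots> \<le> a m * (a 1 / a 0)" using Suc nn by (intro mult_right_mono) auto
    also have "\<dots> \<le> a (Suc m)" using step[of m] a0 by (simp add: divide_simps)
    finally show ?case .
  qed simp
qed

text \<open>Bounding a power of the operator norm by a trace loses a factor \<open>c\<close>; high powers absorb it.\<close>
lemma le_of_all_powers_le:
  fixes x y c :: real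
  assumes "y \<ge> 0" "x \<ge> 0" and le: "\<And>m. m \<ge> 1 \<Longrightarrow> x ^ m \<le> c * y ^ m"
  shows "x \<le> y"
proof (rule ccontr)
  assume "\<not> x \<le> y"
  then have xy: "x > y" by simp
  show False
  proof (cases "y = 0")
    case True
    then show False using le[of 1] xy by simp
  next
    case False
    then have y: "y > 0" using assms by simp
    then have "x / y > 1" using xy by simp
    then obtain m where m: "c < (x / y) ^ m" using real_arch_pow by blast
    have "(x / y) ^ m \<le> (x / y) ^ Suc m" using \<open>x / y > 1\<close> by (intro power_increasing) auto
    moreover have "(x / y) ^ Suc m \<le> c" using le[of "Suc m"] y by (simp add: power_divide divide_simps)
    ultimately show False using m by linarith
  qed
qed

text \<open>The power method: \<open>P k\<close> is the k-th power of \<open>B\<close>, supplied in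
  closed form. Symmetry and Cauchy-Schwarz make the squared norms \<open>a k\<close> of the iterates
  of \<open>x\<close> log-convex, so \<open>(a 1 / a 0) ^ m\<close> is at most
  \<open>a m / a 0\<close>, which the Frobenius norm of \<open>P m\<close> bounds by
  \<open>c * lam ^ (2 * m)\<close>. Letting \<open>m\<close> grow removes \<open>c\<close>.\<close>

lemma symmetric_operator_bound:
  fixes B :: "nat \<Rightarrow> nat \<Rightarrow> real" and P :: "nat \<Rightarrow> nat \<Rightarrow> nat \<Rightarrow> real"
  assumes sym: "\<And>i j. i < n \<Longrightarrow> j < n \<Longrightarrow> B i j = B j i"
    and P1: "\<And>i j. i < n \<Longrightarrow> j < n \<Longrightarrow> P 1 i j = B i j"
    and PS: "\<And>k i j. k \<ge> 1 \<Longrightarrow> i < n \<Longrightarrow> j < n \<Longrightarrow> P (Suc k) i j = (\<Sum>l<n. B i l * P k l j)"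
    and bd: "\<And>k. k \<ge> 1 \<Longrightarrow> (\<Sum>i<n. \<Sum>j<n. (P k i j)\<^sup>2) \<le> c * lam ^ (2 * k)"
    and lam: "lam \<ge> 0"
  shows "(\<Sum>i<n. (\<Sum>j<n. B i j * x j)\<^sup>2) \<le> lam\<^sup>2 * (\<Sum>i<n. (x i)\<^sup>2)"
proof -
  define y where "y = rec_nat x (\<lambda>_ z i. \<Sum>j<n. B i j * z j)"
  have y0: "y 0 = x" and yS: "y (Suc k) i = (\<Sum>j<n. B i j * y k j)" for k i by (simp_all add: y_def)
  define a where "a k = (\<Sum>i<n. (y k i)\<^sup>2)" for k
  have nn: "a k \<ge> 0" for k by (simp add: a_def sum_nonneg)
  have move: "(\<Sum>i<n. y (Suc k) i * z i) = (\<Sum>i<n. y k i * (\<Sum>j<n. B i j * z j))" for k z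
  proof -
    have "(\<Sum>i<n. y (Suc k) i * z i) = (\<Sum>i<n. \<Sum>j<n. B i j * y k j * z i)"
      by (simp add: yS sum_distrib_right)
    also have "\<dots> = (\<Sum>j<n. \<Sum>i<n. B i j * y k j * z i)" by (rule sum.swap)
    also have "\<dots> = (\<Sum>j<n. y k j * (\<Sum>i<n. B j i * z i))"
      unfolding sum_distrib_left by (intro sum.cong refl) (auto simp: sym mult_ac)
    finally show ?thesis .
  qed
  have lc: "(a (Suc k))\<^sup>2 \<le> a k * a (Suc (Suc k))" for k
  proof -
    have "a (Suc k) = (\<Sum>i<n. y (Suc k) i * y (Suc k) i)" by (simp add: a_def power2_eq_square)
    also have "\<dots> = (\<Sum>i<n. y k i * y (Suc (Suc k)) i)" unfolding move by (simp add: yS)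
    finally show ?thesis unfolding a_def by (metis Cauchy_Schwarz_ineq_sum)
  qed
  have z: "a (Suc k) = 0" if "a k = 0" for k
  proof -
    have "\<forall>i\<in>{..<n}. y k i = 0" using that unfolding a_def by (subst (asm) sum_nonneg_eq_0_iff) auto
    then show ?thesis by (simp add: a_def yS)
  qed
  have yP: "y k i = (\<Sum>j<n. P k i j * x j)" if "k \<ge> 1" "i < n" for k i
    using that
  proof (induction k arbitrary: i rule: dec_induct)
    case base
    then show ?case by (simp add: yS y0 P1[unfolded One_nat_def])
  next
    case (step k)
    have "y (Suc k) i = (\<Sum>l<n. \<Sum>j<n. B i l * P k l j * x j)"
      unfolding yS by (intro sum.cong refl) (auto simp: step sum_distrib_left mult_ac)
    also have "\<dots> = (\<Sum>j<n. \<Sum>l<n. B i l * P k l j * x j)" by (rule sum.swap)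
    also have "\<dots> = (\<Sum>j<n. P (Suc k) i j * x j)"
      by (intro sum.cong refl) (use step in \<open>auto simp: PS sum_distrib_right\<close>)
    finally show ?case .
  qed
  have up: "a k \<le> c * lam ^ (2 * k) * a 0" if "k \<ge> 1" for k
  proof -
    have "a k \<le> (\<Sum>i<n. (\<Sum>j<n. (P k i j)\<^sup>2) * (\<Sum>j<n. (x j)\<^sup>2))"
      unfolding a_def by (intro sum_mono) (use yP that Cauchy_Schwarz_ineq_sum in auto)
    also have "\<dots> = (\<Sum>i<n. \<Sum>j<n. (P k i j)\<^sup>2) * a 0"
      by (simp add: a_def y0 sum_distrib_right)
    also have "\<dots> \<le> c * lam ^ (2 * k) * a 0" using bd[OF that] nn by (intro mult_right_mono) auto
    finally show ?thesis .
  qed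
  have "a 1 \<le> lam\<^sup>2 * a 0"
  proof (cases "a 0 = 0")
    case True then show ?thesis using z[of 0] by simp
  next
    case False
    then have a0: "a 0 > 0" using nn[of 0] by simp
    have "a 1 / a 0 \<le> lam\<^sup>2"
    proof (rule le_of_all_powers_le)
      fix m :: nat assume "m \<ge> 1"
      have "a 0 * (a 1 / a 0) ^ m \<le> a m" using log_convex_growth[of a m] nn lc z by blast
      also have "\<dots> \<le> c * lam ^ (2 * m) * a 0" using up[OF \<open>m \<ge> 1\<close>] .
      finally show "(a 1 / a 0) ^ m \<le> c * (lam\<^sup>2) ^ m" 
        using a0 unfolding power_mult[of lam 2 m] by (simp add: mult_ac)
    qed (use nn in auto)
    then show ?thesis using a0 by (simp add: divide_simps)
  qed
  then show ?thesis by (simp add: a_def y0 yS)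
qed

lemma pow_mat_add:
  assumes A: "A \<in> carrier_mat n n"
  shows "A ^\<^sub>m (j + k) = A ^\<^sub>m j * A ^\<^sub>m k"
proof (induction k)
  case (Suc k)
  have c: "A ^\<^sub>m i \<in> carrier_mat n n" for i using A by simp
  show ?case using assoc_mult_mat[OF c c A, of j k] Suc by simp
qed (use A in auto)

text \<open>The discrepancy is the bilinear form of \<open>B\<close> = A - (d/n) J at the indicator
  vectors of \<open>S\<close> and \<open>T\<close>, so Cauchy-Schwarz reduces it to the operator
  norm of \<open>B\<close>. The Frobenius norm of a power of \<open>B\<close> is a trace of an even
  power of A minus the contribution of \<open>d\<close>.\<close>

lemma ndl_mixing:
  assumes G: "ndl_graph n d lam E" and n: "n > 0" and lam: "lam \<ge> 0"
    and S: "S \<subseteq> {..<n}" and T: "T \<subseteq> {..<n}"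
  shows "\<bar>real (card (edge_pairs E S T)) - d * card S * card T / n\<bar> \<le> lam * sqrt (card S * card T)"
proof -
  let ?A = "adjacency_mat n E"
  have A: "?A \<in> carrier_mat n n" by (simp add: adjacency_mat_def)
  have Ak: "?A ^\<^sub>m k \<in> carrier_mat n n" for k using A by simp
  have ent: "?A $$ (i,j) = (if {i,j} \<in> E then 1 else 0)" if "i < n" "j < n" for i j
    using that by (simp add: adjacency_mat_def)
  have symA: "?A $$ (i,j) = ?A $$ (j,i)" if "i < n" "j < n" for i j
    using that by (simp add: ent insert_commute)
  have deg: "(\<Sum>j<n. ?A $$ (i,j)) = real d" if "i < n" for i
    by (rule ndl_row_sum[OF G that])
  have symk: "(?A ^\<^sub>m k) $$ (i,j) = (?A ^\<^sub>m k) $$ (j,i)"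
    and powS: "(?A ^\<^sub>m Suc k) $$ (i,j) = (\<Sum>l<n. ?A $$ (i,l) * (?A ^\<^sub>m k) $$ (l,j))" 
    if "i < n" "j < n" for k i j
  proof -
    have e: "(?A ^\<^sub>m Suc k) $$ (i,j) = (\<Sum>l<n. (?A ^\<^sub>m k) $$ (i,l) * ?A $$ (l,j))"
      if "i < n" "j < n" for i j k
      using that A Ak[of k] by (simp add: scalar_prod_def lessThan_atLeast0)
    have comm: "?A ^\<^sub>m k * ?A = ?A * ?A ^\<^sub>m k" for k
      by (induction k) (use A assoc_mult_mat[OF A Ak A] in simp_all)
    have e': "(?A ^\<^sub>m Suc k) $$ (i,j) = (\<Sum>l<n. ?A $$ (i,l) * (?A ^\<^sub>m k) $$ (l,j))"
      if "i < n" "j < n" for i j k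
      using that A Ak[of k] by (simp add: comm scalar_prod_def lessThan_atLeast0)
    show "(?A ^\<^sub>m Suc k) $$ (i,j) = (\<Sum>l<n. ?A $$ (i,l) * (?A ^\<^sub>m k) $$ (l,j))"
      using e' that by blast
    show "(?A ^\<^sub>m k) $$ (i,j) = (?A ^\<^sub>m k) $$ (j,i)"
      using that
    proof (induction k arbitrary: i j)
      case 0 then show ?case using A by auto
    next
      case (Suc k)
      show ?case unfolding e[OF Suc.prems] e'[OF Suc.prems(2,1)]
        by (intro sum.cong refl) (use Suc in \<open>auto simp: symA mult.commute\<close>)
    qed
  qed
  have row: "(\<Sum>j<n. (?A ^\<^sub>m k) $$ (i,j)) = real d ^ k" if "i < n" for i k
    using that
  proof (induction k arbitrary: i)
    case 0 then show ?case using A by simp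
  next
    case (Suc k)
    have "(\<Sum>j<n. (?A ^\<^sub>m Suc k) $$ (i,j)) = (\<Sum>j<n. \<Sum>l<n. ?A $$ (i,l) * (?A ^\<^sub>m k) $$ (l,j))"
      by (intro sum.cong refl) (use Suc powS in auto)
    also have "\<dots> = (\<Sum>l<n. \<Sum>j<n. ?A $$ (i,l) * (?A ^\<^sub>m k) $$ (l,j))" by (rule sum.swap)
    also have "\<dots> = real d ^ Suc k"
      using Suc deg by (simp flip: sum_distrib_left sum_distrib_right)
    finally show ?case .
  qed
  define B where "B i j = ?A $$ (i,j) - d / n" for i j
  \<comment> \<open>By regularity A J = J A = d J, so this is the k-th power of \<open>B\<close> for
    k >= 1. At k = 0 the formula gives I - J/n instead of the identity, which is why only k >= 1 is
    considered.\<close>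
  define P where "P k i j = (?A ^\<^sub>m k) $$ (i,j) - real d ^ k / n" for k i j
  have op: "(\<Sum>i<n. (\<Sum>j<n. B i j * x j)\<^sup>2) \<le> lam\<^sup>2 * (\<Sum>i<n. (x i)\<^sup>2)" for x
  proof (rule symmetric_operator_bound[where P = P and c = n])
    show "B i j = B j i" if "i < n" "j < n" for i j using that by (simp add: B_def symA)
    show "P 1 i j = B i j" if "i < n" "j < n" for i j using that A by (simp add: B_def P_def)
    show "P (Suc k) i j = (\<Sum>l<n. B i l * P k l j)" if "i < n" "j < n" for k i j
    proof -
      have col: "(\<Sum>l<n. (?A ^\<^sub>m k) $$ (l,j)) = real d ^ k"
        using row[OF that(2), of k] symk that by (metis (mono_tags, lifting) lessThan_iff sum.cong)
      have "(\<Sum>l<n. B i l * P k l j) = (\<Sum>l<n. ?A $$ (i,l) * (?A ^\<^sub>m k) $$ (l,j))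
          - (\<Sum>l<n. ?A $$ (i,l)) * (real d ^ k / n) - (d / n) * (\<Sum>l<n. (?A ^\<^sub>m k) $$ (l,j))
          + (\<Sum>l<n. d / n * (real d ^ k / n))"
        by (simp add: B_def P_def algebra_simps sum.distrib sum_subtractf
            flip: sum_distrib_left sum_distrib_right sum_divide_distrib)
      also have "\<dots> = P (Suc k) i j"
        unfolding powS[OF that, symmetric] deg[OF that(1)] col using n
        by (simp add: P_def field_simps)
      finally show ?thesis by simp
    qed
    show "(\<Sum>i<n. \<Sum>j<n. (P k i j)\<^sup>2) \<le> n * lam ^ (2 * k)" if "k \<ge> 1" for k
    proof -
      have sq: "(\<Sum>i<n. \<Sum>j<n. ((?A ^\<^sub>m k) $$ (i,j))\<^sup>2) = (\<Sum>i<n. (?A ^\<^sub>m (2 * k)) $$ (i,i))"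
      proof (rule sum.cong[OF refl])
        fix i assume i: "i \<in> {..<n}"
        have "?A ^\<^sub>m (2 * k) = ?A ^\<^sub>m k * ?A ^\<^sub>m k"
          unfolding mult_2 by (rule pow_mat_add[OF A])
        then have "(?A ^\<^sub>m (2 * k)) $$ (i,i) = (\<Sum>l<n. (?A ^\<^sub>m k) $$ (i,l) * (?A ^\<^sub>m k) $$ (l,i))"
          using i A Ak[of k] by (simp add: scalar_prod_def lessThan_atLeast0)
        also have "\<dots> = (\<Sum>l<n. ((?A ^\<^sub>m k) $$ (i,l))\<^sup>2)"
          by (intro sum.cong refl) (use i symk in \<open>auto simp: power2_eq_square\<close>)
        finally show "(\<Sum>j<n. ((?A ^\<^sub>m k) $$ (i,j))\<^sup>2) = (?A ^\<^sub>m (2 * k)) $$ (i,i)" by simp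
      qed
      have alg: "X - 2 * (D / n) * (n * D) + n * (n * (D / n)\<^sup>2) = X - D\<^sup>2" for X D :: real
        using n by (simp add: power2_eq_square)
      have pw: "real d ^ (2 * k) = (real d ^ k)\<^sup>2" by (simp add: mult.commute flip: power_mult)
      have "(\<Sum>i<n. \<Sum>j<n. (P k i j)\<^sup>2) = (\<Sum>i<n. \<Sum>j<n. ((?A ^\<^sub>m k) $$ (i,j))\<^sup>2)
          - 2 * (real d ^ k / n) * (\<Sum>i<n. \<Sum>j<n. (?A ^\<^sub>m k) $$ (i,j)) + n * (n * (real d ^ k / n)\<^sup>2)"
        by (simp add: P_def power2_diff sum.distrib sum_subtractf algebra_simps
            flip: sum_distrib_left sum_distrib_right sum_divide_distrib)
      also have "(\<Sum>i<n. \<Sum>j<n. (?A ^\<^sub>m k) $$ (i,j)) = n * real d ^ k" using row by simp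
      finally have "(\<Sum>i<n. \<Sum>j<n. (P k i j)\<^sup>2) = (\<Sum>i<n. (?A ^\<^sub>m (2 * k)) $$ (i,i)) - real d ^ (2 * k)"
        unfolding sq pw using alg by simp
      then show ?thesis using ndl_deviation_trace_bound[OF G n, of "2 * k"] by simp
    qed
  qed (use lam in auto)
  define s :: "nat \<Rightarrow> real" where "s i = (if i \<in> S then 1 else 0)" for i
  define t :: "nat \<Rightarrow> real" where "t i = (if i \<in> T then 1 else 0)" for i
  have bnd: "i < n" if "i \<in> S \<or> i \<in> T" for i using that S T by auto
  have fin: "finite S" "finite T" using S T finite_subset by blast+
  have ss: "(\<Sum>i<n. s i) = card S" "(\<Sum>i<n. (s i)\<^sup>2) = card S"
    using S fin by (simp_all add: s_def sum.If_cases Int_absorb1 if_distrib[of "\<lambda>x. x\<^sup>2"] Int_def[symmetric] cong: if_cong)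
  have tt: "(\<Sum>i<n. t i) = card T" "(\<Sum>i<n. (t i)\<^sup>2) = card T"
    using T fin by (simp_all add: t_def sum.If_cases Int_absorb1 if_distrib[of "\<lambda>x. x\<^sup>2"] Int_def[symmetric] cong: if_cong)
  have "real (card (edge_pairs E S T)) = (\<Sum>p\<in>S\<times>T. if {fst p, snd p} \<in> E then 1 else 0)"
  proof -
    have "edge_pairs E S T = (S \<times> T) \<inter> {p. {fst p, snd p} \<in> E}" by (auto simp: edge_pairs_def)
    then show ?thesis using fin by (simp add: sum.If_cases)
  qed
  also have "\<dots> = (\<Sum>i\<in>S. \<Sum>j\<in>T. ?A $$ (i,j))"
    unfolding sum.cartesian_product by (intro sum.cong refl) (auto simp: ent bnd)
  also have "\<dots> = (\<Sum>i<n. s i * (\<Sum>j<n. ?A $$ (i,j) * t j))"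
  proof -
    have "(\<Sum>j<n. ?A $$ (i,j) * t j) = (\<Sum>j\<in>T. ?A $$ (i,j))" for i
      using T by (simp add: t_def if_distrib sum.If_cases Int_absorb1 cong: if_cong)
    then show ?thesis using S by (simp add: s_def if_distrib if_distribR sum.If_cases Int_absorb1 cong: if_cong)
  qed
  finally have e1: "real (card (edge_pairs E S T)) = (\<Sum>i<n. s i * (\<Sum>j<n. ?A $$ (i,j) * t j))" .
  have "(\<Sum>i<n. s i * (\<Sum>j<n. B i j * t j))
      = (\<Sum>i<n. s i * (\<Sum>j<n. ?A $$ (i,j) * t j)) - (\<Sum>i<n. s i) * (d / n * (\<Sum>j<n. t j))"
    by (simp add: B_def algebra_simps sum_subtractf flip: sum_distrib_left sum_distrib_right sum_divide_distrib)
  then have dev: "real (card (edge_pairs E S T)) - d * card S * card T / n = (\<Sum>i<n. s i * (\<Sum>j<n. B i j * t j))"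
    unfolding e1 ss tt by simp
  have "(\<Sum>i<n. s i * (\<Sum>j<n. B i j * t j))\<^sup>2 \<le> (\<Sum>i<n. (s i)\<^sup>2) * (\<Sum>i<n. (\<Sum>j<n. B i j * t j)\<^sup>2)"
    by (rule Cauchy_Schwarz_ineq_sum)
  also have "\<dots> \<le> card S * (lam\<^sup>2 * card T)"
    unfolding ss using op[of t] tt by (intro mult_left_mono) auto
  also have "\<dots> = (lam * sqrt (card S * card T))\<^sup>2" by (simp add: power_mult_distrib)
  finally have "\<bar>\<Sum>i<n. s i * (\<Sum>j<n. B i j * t j)\<bar> \<le> \<bar>lam * sqrt (card S * card T)\<bar>"
    by (simp only: abs_le_square_iff)
  moreover have "lam * sqrt (card S * card T) \<ge> 0" using lam by simp
  ultimately show ?thesis unfolding dev by linarith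
qed

subsection \<open>Graphs with the expander mixing property\<close>

definition nbr :: "'a set set \<Rightarrow> 'a \<Rightarrow> 'a set" where
  "nbr E v = {u. {v,u} \<in> E}"

text \<open>\<open>\<eta>\<close> bounds lambda/d; everything combinatorial uses only this form of
  mixing. The condition \<open>eta_d\<close> lets the mixing error absorb one forbidden extension
  per vertex when forests are counted.\<close>

locale mixing_graph =
  fixes V :: "'a set" and E :: "'a set set" and d :: nat and \<eta> :: real
  assumes simple: "simple_graph_on V E"
    and regular: "v \<in> V \<Longrightarrow> card (nbr E v) = d"
    and mixing: "S \<subseteq> V \<Longrightarrow> T \<subseteq> V \<Longrightarrow>
      \<bar>real (card (edge_pairs E S T)) - d * card S * card T / card V\<bar> \<le> \<eta> * d * sqrt (card S * card T)"
    and eta_d: "1 \<le> \<eta> * d" and eta_pos: "\<eta> > 0"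
begin

abbreviation "n \<equiv> card V"

lemma finV: "finite V" using simple by (simp add: simple_graph_on_def)

lemma edge_in_V: "{u,v} \<in> E \<Longrightarrow> u \<in> V \<and> v \<in> V"
  using simple by (auto simp: simple_graph_on_def)

lemma no_loop: "{u,u} \<notin> E"
  using simple by (auto simp: simple_graph_on_def)

lemma no_loop': "{u} \<notin> E"
  using no_loop[of u] by simp

lemma nbr_subset: "nbr E v \<subseteq> V" using edge_in_V by (auto simp: nbr_def)

lemma finite_nbr: "finite (nbr E v)" using nbr_subset finV finite_subset by blast

lemma d_pos: "d > 0" using eta_d by (cases d) auto

lemma d_less_n: "V \<noteq> {} \<Longrightarrow> d < n"
proof -
  assume "V \<noteq> {}"
  then obtain v where v: "v \<in> V" by blast
  have "nbr E v \<subseteq> V - {v}" using nbr_subset no_loop' by (auto simp: nbr_def)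
  then have "card (nbr E v) \<le> card (V - {v})" using finV by (intro card_mono) auto
  then show "d < n" using regular[OF v] v finV card_Diff_singleton[of v V] card_gt_0_iff[of V] by auto
qed

lemma finite_edge_pairs: "finite S \<Longrightarrow> finite T \<Longrightarrow> finite (edge_pairs E S T)"
  unfolding edge_pairs_def by (rule finite_subset[of _ "S \<times> T"]) auto

lemma card_edge_pairs:
  assumes "finite S"
  shows "card (edge_pairs E S T) = (\<Sum>x\<in>S. card (nbr E x \<inter> T))"
proof -
  have "edge_pairs E S T = Sigma S (\<lambda>x. nbr E x \<inter> T)" by (auto simp: edge_pairs_def nbr_def)
  then show ?thesis using assms finite_nbr by simp
qed

text \<open>Without such an edge, the main term of mixing would be at most its error term, which
  bounds the product of the two sizes by \<open>(\<eta> * n)\<^sup>2\<close>.\<close>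

lemma edge_between:
  assumes X: "X \<subseteq> V" and Y: "Y \<subseteq> V" and big: "(\<eta> * n)\<^sup>2 < real (card X) * real (card Y)"
  obtains x y where "x \<in> X" "y \<in> Y" "{x,y} \<in> E"
proof (rule ccontr)
  assume "\<not> thesis"
  then have "edge_pairs E X Y = {}" using that by (auto simp: edge_pairs_def)
  then have m: "d * real (card X) * card Y / n \<le> \<eta> * d * sqrt (card X * card Y)"
    using mixing[OF X Y] by simp
  let ?p = "real (card X) * card Y"
  have p: "?p > 0" using big by (smt (verit) zero_le_power2)
  have n: "n > 0" using p X finV by (cases "n = 0") auto
  have "real d * (?p / n) \<le> real d * (\<eta> * sqrt ?p)" using m by (simp add: mult_ac)
  then have "?p / n \<le> \<eta> * sqrt ?p" by (rule mult_left_le_imp_le) (use d_pos in simp)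
  then have "sqrt ?p * sqrt ?p \<le> (\<eta> * n) * sqrt ?p" using n p by (simp add: field_simps)
  then have "sqrt ?p \<le> \<eta> * n" by (rule mult_right_le_imp_le) (use p in simp)
  then have "?p \<le> (\<eta> * n)\<^sup>2" using p by (metis real_sqrt_le_iff real_sqrt_abs abs_of_pos eta_pos of_nat_0_less_iff n mult_pos_pos)
  then show False using big by simp
qed

lemma missed_neighbours:
  assumes X: "X \<subseteq> V" and ne: "X \<noteq> {}"
  shows "real (card X) * card {v \<in> V. \<forall>x\<in>X. {x,v} \<notin> E} \<le> (\<eta> * n)\<^sup>2"
proof (rule ccontr)
  assume "\<not> ?thesis"
  then obtain x y where "x \<in> X" "y \<in> {v \<in> V. \<forall>x\<in>X. {x,v} \<notin> E}" "{x,y} \<in> E"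
    using edge_between[OF X, of "{v \<in> V. \<forall>x\<in>X. {x,v} \<notin> E}"] by auto
  then show False by auto
qed

text \<open>Applied with \<open>W\<close> a joint neighbourhood of \<open>S\<close>: if all vertices
  of \<open>S\<close> have large degree into \<open>W\<close>, then \<open>W\<close> cannot be of
  the order of a small \<open>S\<close>.\<close>

lemma expansion:
  fixes D :: real
  assumes S: "S \<subseteq> V" and W: "W \<subseteq> V" and D: "\<And>x. x \<in> S \<Longrightarrow> D \<le> real (card (nbr E x \<inter> W))"
  shows "D * card S \<le> d * card S * card W / n + \<eta> * d * sqrt (card S * card W)"
proof -
  have fin: "finite S" using S finV finite_subset by blast
  have "D * card S = (\<Sum>x\<in>S. D)" by (simp add: mult.commute)
  also have "(\<Sum>x\<in>S. D) \<le> (\<Sum>x\<in>S. real (card (nbr E x \<inter> W)))" by (rule sum_mono) (use D in auto)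
  also have "\<dots> = card (edge_pairs E S W)" by (simp add: card_edge_pairs[OF fin])
  finally show ?thesis using mixing[OF S W] by linarith
qed

text \<open>Vertices have on average \<open>d * card U / n\<close> neighbours in \<open>U\<close>,
  at least 3/2 times the threshold. The gap is a third of the main term, so mixing gives
  \<open>card Y * card U\<close> at most \<open>9 * (\<eta> * n)\<^sup>2\<close>; passing from
  \<open>card U\<close> to \<open>m\<close> costs 4/3, whence 12.\<close>

lemma few_deficient:
  assumes Y: "Y \<subseteq> V" and U: "U \<subseteq> V" and m: "3 * real m \<le> 4 * card U"
    and low: "\<And>x. x \<in> Y \<Longrightarrow> real (card (nbr E x \<inter> U)) < d * real m / (2 * n)"
  shows "real (card Y) * m \<le> 12 * (\<eta> * n)\<^sup>2"
proof (cases "Y = {} \<or> U = {}")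
  case True
  then show ?thesis using m by auto
next
  case False
  have fin: "finite Y" "finite U" using Y U finV finite_subset by blast+
  have n: "n > 0" using False Y finV by (auto simp: card_gt_0_iff)
  let ?p = "real (card Y) * card U"
  have p: "?p > 0" using False fin by (simp add: card_gt_0_iff)
  have "real (card (edge_pairs E Y U)) = (\<Sum>x\<in>Y. real (card (nbr E x \<inter> U)))" by (simp add: card_edge_pairs[OF fin(1)])
  also have "\<dots> \<le> (\<Sum>x\<in>Y. d * real m / (2 * n))" by (rule sum_mono) (use low less_imp_le in blast)
  finally have e: "real (card (edge_pairs E Y U)) \<le> card Y * (d * real m / (2 * n))" by simp
  have "d * real (card Y) * card U / n - \<eta> * d * sqrt ?p \<le> card Y * (d * real m / (2 * n))"
    using mixing[OF Y U] e by (simp add: abs_le_iff)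
  then have "real d * (?p / n - \<eta> * sqrt ?p) \<le> real d * (card Y * real m / (2 * n))"
    by (simp add: algebra_simps)
  then have "?p / n - \<eta> * sqrt ?p \<le> card Y * real m / (2 * n)"
    by (rule mult_left_le_imp_le) (use d_pos in simp)
  then have "n * (?p / n - \<eta> * sqrt ?p) \<le> n * (card Y * real m / (2 * n))"
    by (intro mult_left_mono) auto
  then have "?p - \<eta> * n * sqrt ?p \<le> card Y * real m / 2"
    using n by (simp add: algebra_simps)
  moreover have "card Y * real m \<le> card Y * (4 * card U / 3)" using m by (intro mult_left_mono) auto
  ultimately have "?p / 3 \<le> \<eta> * n * sqrt ?p" by simp
  then have "sqrt ?p * sqrt ?p \<le> 3 * \<eta> * n * sqrt ?p" using p by (simp del: real_sqrt_mult)
  then have "sqrt ?p \<le> 3 * \<eta> * n" by (rule mult_right_le_imp_le) (use p in simp)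
  then have "(sqrt ?p)\<^sup>2 \<le> (3 * \<eta> * n)\<^sup>2" by (intro power_mono) auto
  then have "?p \<le> 9 * (\<eta> * n)\<^sup>2" using p by (simp add: power_mult_distrib del: real_sqrt_mult)
  moreover have "card Y * (3 * real m) \<le> card Y * (4 * real (card U))" using m by (intro mult_left_mono) auto
  ultimately show ?thesis by simp
qed

end

subsection \<open>Edges of a list and rotations\<close>

fun path_edges :: "'a list \<Rightarrow> 'a set set" where
  "path_edges (x # y # xs) = insert {x,y} (path_edges (y # xs))"
| "path_edges _ = {}"

lemma path_edges_Cons: "ys \<noteq> [] \<Longrightarrow> path_edges (x # ys) = insert {x, hd ys} (path_edges ys)"
  by (cases ys) auto

lemma path_edges_append:
  "xs \<noteq> [] \<Longrightarrow> ys \<noteq> [] \<Longrightarrow> path_edges (xs @ ys) = insert {last xs, hd ys} (path_edges xs \<union> path_edges ys)"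
  by (induction xs rule: path_edges.induct) (auto simp: path_edges_Cons)

lemma path_edges_append_subset: "path_edges xs \<subseteq> path_edges (xs @ ys)" "path_edges ys \<subseteq> path_edges (xs @ ys)"
  by (cases "xs = []"; cases "ys = []"; auto simp: path_edges_append)+

lemma path_edges_rev [simp]: "path_edges (rev xs) = path_edges xs"
proof (induction xs)
  case (Cons x xs)
  then show ?case
    by (cases "xs = []") (auto simp: path_edges_append path_edges_Cons last_rev insert_commute)
qed simp

lemma path_edges_subset_set: "e \<in> path_edges xs \<Longrightarrow> e \<subseteq> set xs"
  by (induction xs rule: path_edges.induct) auto

lemma finite_path_edges [simp]: "finite (path_edges xs)"
  by (induction xs rule: path_edges.induct) auto

lemma path_edges_iff_split:
  "e \<in> path_edges xs \<longleftrightarrow> (\<exists>A B. xs = A @ B \<and> A \<noteq> [] \<and> B \<noteq> [] \<and> e = {last A, hd B})"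
proof
  assume "e \<in> path_edges xs"
  then show "\<exists>A B. xs = A @ B \<and> A \<noteq> [] \<and> B \<noteq> [] \<and> e = {last A, hd B}"
  proof (induction xs rule: path_edges.induct)
    case (1 x y xs)
    show ?case
    proof (cases "e = {x,y}")
      case True
      then show ?thesis by (intro exI[of _ "[x]"] exI[of _ "y # xs"]) auto
    next
      case False
      then obtain A B where "y # xs = A @ B" "A \<noteq> []" "B \<noteq> []" "e = {last A, hd B}" using 1 by auto
      then show ?thesis by (intro exI[of _ "x # A"] exI[of _ B]) auto
    qed
  qed auto
qed (auto simp: path_edges_append)

lemma path_edges_conv_nth: "path_edges xs = {{xs ! i, xs ! Suc i} | i. Suc i < length xs}"
proof (induction xs rule: path_edges.induct)
  case (1 x y xs)
  show ?case unfolding path_edges.simps 1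
  proof (intro equalityI subsetI)
    fix e assume "e \<in> insert {x,y} {{(y # xs) ! i, (y # xs) ! Suc i} | i. Suc i < length (y # xs)}"
    then consider "e = {x,y}" | i where "e = {(y # xs) ! i, (y # xs) ! Suc i}" "Suc i < length (y # xs)" by auto
    then show "e \<in> {{(x # y # xs) ! i, (x # y # xs) ! Suc i} | i. Suc i < length (x # y # xs)}"
    proof cases
      case 1
      then show ?thesis by (intro CollectI exI[of _ 0]) auto
    next
      case 2
      then show ?thesis by (intro CollectI exI[of _ "Suc i"]) auto
    qed
  next
    fix e assume "e \<in> {{(x # y # xs) ! i, (x # y # xs) ! Suc i} | i. Suc i < length (x # y # xs)}"
    then obtain i where "e = {(x # y # xs) ! i, (x # y # xs) ! Suc i}" "Suc i < length (x # y # xs)" by auto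
    then show "e \<in> insert {x,y} {{(y # xs) ! i, (y # xs) ! Suc i} | i. Suc i < length (y # xs)}"
      by (cases i) auto
  qed
qed auto

lemma card_path_edges:
  assumes "distinct xs"
  shows "card (path_edges xs) = length xs - 1"
  using assms
proof (induction xs rule: path_edges.induct)
  case (1 x y xs)
  then have "{x,y} \<notin> path_edges (y # xs)" using path_edges_subset_set[of "{x,y}" "y # xs"] by auto
  then show ?case using 1 by simp
qed auto

definition list_nbrs :: "'a list \<Rightarrow> 'a set \<Rightarrow> 'a set" where
  "list_nbrs xs X = {v. \<exists>x\<in>X. {x,v} \<in> path_edges xs}"

lemma list_nbrs_subset: "list_nbrs xs X \<subseteq> set xs"
  using path_edges_subset_set by (fastforce simp: list_nbrs_def)

lemma finite_list_nbrs [simp]: "finite (list_nbrs xs X)"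
  by (rule finite_subset[OF list_nbrs_subset]) simp

lemma list_nbrs_single:
  assumes "distinct (A @ x # B)"
  shows "list_nbrs (A @ x # B) {x} \<subseteq> {last A, hd B}"
proof
  fix v assume "v \<in> list_nbrs (A @ x # B) {x}"
  then have "{x,v} \<in> path_edges (A @ x # B)" by (simp add: list_nbrs_def)
  then have "{x,v} \<in> path_edges A \<or> {x,v} \<in> path_edges B \<or> {x,v} = {last A, x} \<or> {x,v} = {x, hd B}"
    by (cases "A = []"; cases "B = []") (auto simp: path_edges_append path_edges_Cons)
  then show "v \<in> {last A, hd B}"
    using assms path_edges_subset_set[of "{x,v}" A] path_edges_subset_set[of "{x,v}" B]
    by (auto simp: doubleton_eq_iff)
qed

lemma card_list_nbrs:
  assumes d: "distinct xs" and f: "finite X"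
  shows "card (list_nbrs xs X) \<le> 2 * card X"
proof -
  have one: "card (list_nbrs xs {x}) \<le> 2" for x
  proof (cases "x \<in> set xs")
    case True
    then obtain A B where "xs = A @ x # B" by (meson split_list)
    then have "list_nbrs xs {x} \<subseteq> {last A, hd B}" using list_nbrs_single d by metis
    then have "card (list_nbrs xs {x}) \<le> card {last A, hd B}" by (intro card_mono) auto
    also have "\<dots> \<le> 2" by (simp add: card_insert_if)
    finally show ?thesis .
  next
    case False
    then have "list_nbrs xs {x} = {}" using path_edges_subset_set by (fastforce simp: list_nbrs_def)
    then show ?thesis by simp
  qed
  have "list_nbrs xs X = (\<Union>x\<in>X. list_nbrs xs {x})" by (auto simp: list_nbrs_def)
  then have "card (list_nbrs xs X) \<le> (\<Sum>x\<in>X. card (list_nbrs xs {x}))" using card_UN_le[OF f] by metis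
  also have "\<dots> \<le> (\<Sum>x\<in>X. 2)" by (rule sum_mono) (use one in auto)
  finally show ?thesis by simp
qed

text \<open>Lists obtained from \<open>L\<close> by at most \<open>t\<close> Posa rotations of the left end, with pivots in \<open>U\<close>.
  Only original edges of \<open>L\<close> are ever deleted.\<close>

inductive rotations :: "'a set set \<Rightarrow> 'a list \<Rightarrow> 'a set \<Rightarrow> nat \<Rightarrow> 'a list \<Rightarrow> bool" for E L U where
  start: "rotations E L U t L"
| step: "rotations E L U t (A @ w # B) \<Longrightarrow> A \<noteq> [] \<Longrightarrow> w \<in> U \<Longrightarrow> {hd A, w} \<in> E \<Longrightarrow>
    {last A, w} \<in> path_edges L \<Longrightarrow> rotations E L U (Suc t) (rev A @ w # B)"

definition rot_ends :: "'a set set \<Rightarrow> 'a list \<Rightarrow> 'a set \<Rightarrow> nat \<Rightarrow> 'a set" where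
  "rot_ends E L U t = {hd Q | Q. rotations E L U t Q}"

lemma rot_endsI: "rotations E L U t Q \<Longrightarrow> hd Q \<in> rot_ends E L U t"
  by (auto simp: rot_ends_def)

lemma rotations_Suc: "rotations E L U t Q \<Longrightarrow> rotations E L U (Suc t) Q"
  by (induction rule: rotations.induct) (auto intro: rotations.intros)

lemma rotations_props:
  assumes "rotations E L U t Q" and "distinct L"
  shows "distinct Q \<and> set Q = set L \<and> (L \<noteq> [] \<longrightarrow> last Q = last L) \<and> path_edges Q - path_edges L \<subseteq> E
    \<and> card (path_edges L - path_edges Q) \<le> t"
  using assms
proof (induction rule: rotations.induct)
  case (step t A w B)
  note IH = step.IH[OF step.prems]
  have e1: "path_edges (A @ w # B) = insert {last A, w} (path_edges A \<union> path_edges (w # B))"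
    using step by (simp add: path_edges_append)
  have e2: "path_edges (rev A @ w # B) = insert {hd A, w} (path_edges A \<union> path_edges (w # B))"
    using step by (simp add: path_edges_append last_rev)
  have "path_edges L - path_edges (rev A @ w # B) \<subseteq> insert {last A, w} (path_edges L - path_edges (A @ w # B))"
    unfolding e1 e2 by auto
  then have "card (path_edges L - path_edges (rev A @ w # B)) \<le> card (insert {last A, w} (path_edges L - path_edges (A @ w # B)))"
    by (intro card_mono) auto
  also have "\<dots> \<le> Suc t" using IH by (simp add: card_insert_if)
  finally show ?case using IH step e1 e2 by (auto simp: insert_commute)
qed auto

lemma rot_ends_mono: "rot_ends E L U t \<subseteq> rot_ends E L U (Suc t)"
  using rotations_Suc by (fastforce simp: rot_ends_def)

lemma rot_ends_subset:
  assumes "distinct L" "L \<noteq> []"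
  shows "rot_ends E L U t \<subseteq> set L"
proof
  fix x assume "x \<in> rot_ends E L U t"
  then obtain Q where Q: "rotations E L U t Q" "x = hd Q" by (auto simp: rot_ends_def)
  then have "set Q = set L" using rotations_props[OF Q(1) assms(1)] by simp
  then show "x \<in> set L" using assms(2) Q(2) by (metis hd_in_set set_empty)
qed

text \<open>A new end is \<open>last A\<close>, and since the deleted edge is an original one, it is
  a neighbour in \<open>L\<close> of the pivot. Hence degree conditions are needed only at
  \<open>hd L\<close> and at list neighbours of \<open>U\<close>.\<close>

lemma rot_ends_in_nbrs:
  assumes "rotations E L U t Q"
  shows "hd Q \<in> insert (hd L) (list_nbrs L U)"
  using assms
proof (cases rule: rotations.cases)
  case (step t A w B)
  then have "hd Q = last A" by (simp add: hd_rev)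
  then show ?thesis using step by (auto simp: list_nbrs_def insert_commute)
qed auto

text \<open>A rotation adds the edge from the old end \<open>hd A\<close> to the pivot
  \<open>w\<close>, and \<open>w\<close> is a neighbour in \<open>L\<close> of the new end
  \<open>last A\<close>. So an edge of \<open>Q\<close> reaching outside the ends and their
  neighbours in \<open>L\<close> is still original.\<close>

lemma rotations_new_edges:
  assumes "rotations E L U t Q"
  shows "path_edges Q \<subseteq> path_edges L \<union> Pow (rot_ends E L U t \<union> list_nbrs L (rot_ends E L U t))"
  using assms
proof (induction rule: rotations.induct)
  case (step t A w B)
  have r: "rotations E L U (Suc t) (rev A @ w # B)" using step rotations.step by metis
  have "hd A \<in> rot_ends E L U t" using rot_endsI[OF step(1)] step(2) by simp
  then have 1: "hd A \<in> rot_ends E L U (Suc t)" using rot_ends_mono[of E L U t] by blast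
  have "last A \<in> rot_ends E L U (Suc t)" using r step(2) by (force simp: rot_ends_def hd_rev)
  then have 2: "w \<in> list_nbrs L (rot_ends E L U (Suc t))" using step(5) by (auto simp: list_nbrs_def)
  have 3: "Pow (rot_ends E L U t \<union> list_nbrs L (rot_ends E L U t))
      \<subseteq> Pow (rot_ends E L U (Suc t) \<union> list_nbrs L (rot_ends E L U (Suc t)))"
    using rot_ends_mono[of E L U t] by (fastforce simp: list_nbrs_def)
  have e1: "path_edges (A @ w # B) = insert {last A, w} (path_edges A \<union> path_edges (w # B))"
    using step by (simp add: path_edges_append)
  have e2: "path_edges (rev A @ w # B) = insert {hd A, w} (path_edges A \<union> path_edges (w # B))"
    using step by (simp add: path_edges_append last_rev)
  show ?case unfolding e2 using 1 2 3 step.IH unfolding e1 by auto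
qed auto

text \<open>Posa's lemma for a bounded number of rotations.\<close>
lemma rot_ends_neighbours:
  assumes d: "distinct L" "L \<noteq> []" and x: "x \<in> rot_ends E L U t" and w: "w \<in> U" "w \<in> set L" "{x,w} \<in> E" "x \<noteq> w"
  shows "w \<in> rot_ends E L U (Suc t) \<union> list_nbrs L (rot_ends E L U (Suc t))"
proof -
  obtain Q where Q: "rotations E L U t Q" "x = hd Q" using x by (auto simp: rot_ends_def)
  note p = rotations_props[OF Q(1) d(1)]
  have "w \<in> set Q" using p w by simp
  then obtain A B where AB: "Q = A @ w # B" by (meson split_list)
  have A: "A \<noteq> []" using AB Q(2) w(4) by auto
  have hA: "hd A = x" using AB A Q(2) by simp
  show ?thesis
  proof (cases "{last A, w} \<in> path_edges L")
    case True
    then have "rotations E L U (Suc t) (rev A @ w # B)"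
      using Q(1) AB A w hA by (intro rotations.step) auto
    then have "last A \<in> rot_ends E L U (Suc t)" using A by (force simp: rot_ends_def hd_rev)
    then show ?thesis using True by (auto simp: list_nbrs_def)
  next
    \<comment> \<open>The rotation at \<open>w\<close> is not allowed here, but then the edge of
      \<open>Q\<close> in front of \<open>w\<close> is a new one, and both its vertices are already
      ends or neighbours of ends.\<close>
    case False
    have "{last A, w} \<in> path_edges Q" using AB A by (simp add: path_edges_append)
    then have "w \<in> rot_ends E L U t \<union> list_nbrs L (rot_ends E L U t)"
      using rotations_new_edges[OF Q(1)] False by auto
    then show ?thesis using rot_ends_mono[of E L U t] by (auto simp: list_nbrs_def)
  qed
qed

lemma card_rot_nbrs:
  assumes "distinct L" "L \<noteq> []"
  shows "card (rot_ends E L U t \<union> list_nbrs L (rot_ends E L U t)) \<le> 3 * card (rot_ends E L U t)"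
proof -
  have f: "finite (rot_ends E L U t)" by (rule finite_subset[OF rot_ends_subset[OF assms]]) simp
  then show ?thesis
    using card_Un_le[of "rot_ends E L U t" "list_nbrs L (rot_ends E L U t)"] card_list_nbrs[OF assms(1) f]
    by linarith
qed

subsection \<open>Counting partial arc sets\<close>

text \<open>Counts the pairs of a set and an element to be added; adding it keeps the pair
  recoverable. The removal version below gives the opposite inequality.\<close>

lemma double_count_insert:
  assumes fin: "finite A" "finite A'" and ext: "\<And>D. D \<in> A \<Longrightarrow> finite (X D)"
    and up: "\<And>D p. D \<in> A \<Longrightarrow> p \<in> X D \<Longrightarrow> p \<notin> D \<and> insert p D \<in> A'"
    and sz: "\<And>D. D \<in> A' \<Longrightarrow> card D = Suc r"
  shows "(\<Sum>D\<in>A. card (X D)) \<le> Suc r * card A'"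
proof -
  have f': "finite D" if "D \<in> A'" for D using sz[OF that] by (metis card.infinite nat.distinct(1))
  have "(\<Sum>D\<in>A. card (X D)) = card (Sigma A X)" using fin ext by simp
  also have "\<dots> \<le> card (Sigma A' (\<lambda>D. D))"
  proof (rule card_inj_on_le[where f = "\<lambda>(D,p). (insert p D, p)"])
    show "inj_on (\<lambda>(D,p). (insert p D, p)) (Sigma A X)"
      by (rule inj_onI, clarsimp) (use up in \<open>metis insert_ident\<close>)
    show "(\<lambda>(D,p). (insert p D, p)) ` Sigma A X \<subseteq> Sigma A' (\<lambda>D. D)" using up by auto
    show "finite (Sigma A' (\<lambda>D. D))" using fin f' by auto
  qed
  also have "\<dots> = Suc r * card A'" using fin f' sz by simp
  finally show ?thesis .
qed

lemma double_count_remove: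
  assumes fin: "finite A" "finite A'" and ext: "\<And>D. D \<in> A \<Longrightarrow> finite (X D)"
    and down: "\<And>D p. D \<in> A' \<Longrightarrow> p \<in> D \<Longrightarrow> D - {p} \<in> A \<and> p \<in> X (D - {p})"
    and sz: "\<And>D. D \<in> A' \<Longrightarrow> card D = Suc r"
  shows "Suc r * card A' \<le> (\<Sum>D\<in>A. card (X D))"
proof -
  have f': "finite D" if "D \<in> A'" for D using sz[OF that] by (metis card.infinite nat.distinct(1))
  have "Suc r * card A' = card (Sigma A' (\<lambda>D. D))" using fin f' sz by simp
  also have "\<dots> \<le> card (Sigma A X)"
  proof (rule card_inj_on_le[where f = "\<lambda>(D,p). (D - {p}, p)"])
    show "inj_on (\<lambda>(D,p). (D - {p}, p)) (Sigma A' (\<lambda>D. D))"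
      by (rule inj_onI, clarsimp) (metis insert_Diff)
    show "(\<lambda>(D,p). (D - {p}, p)) ` Sigma A' (\<lambda>D. D) \<subseteq> Sigma A X" using down by auto
    show "finite (Sigma A X)" using fin ext by auto
  qed
  also have "\<dots> = (\<Sum>D\<in>A. card (X D))" using fin ext by simp
  finally show ?thesis .
qed

lemma prod_falling: "r \<le> n \<Longrightarrow> (\<Prod>i<r. real (n - i)) = fact n / fact (n - r)"
proof (induction r)
  case (Suc r)
  have "fact (n - r) = real (n - r) * fact (n - Suc r)"
    using Suc.prems by (metis Suc_diff_Suc Suc_le_lessD fact_Suc)
  then show ?case using Suc by (simp add: field_simps del: of_nat_diff)
qed simp

definition graph_arcs :: "'a set set \<Rightarrow> ('a \<times> 'a) set" where
  "graph_arcs E = {(u,v). {u,v} \<in> E}"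

text \<open>The arc sets of partial injections: their components are directed paths and directed
  cycles, 2-cycles included. Allowing cycles makes the family closed under removing arcs and contain
  every oriented Hamilton cycle.\<close>

definition partial_cycles :: "'a set set \<Rightarrow> nat \<Rightarrow> ('a \<times> 'a) set set" where
  "partial_cycles E r = {D. D \<subseteq> graph_arcs E \<and> card D = r \<and> single_valued D \<and> single_valued (D\<inverse>)}"

lemma card_Domain_single_valued: "single_valued D \<Longrightarrow> card (Domain D) = card D"
  unfolding Domain_fst by (rule card_image) (auto simp: single_valued_def inj_on_def)

lemma card_Range_single_valued: "single_valued (D\<inverse>) \<Longrightarrow> card (Range D) = card D"
  unfolding Range_snd by (rule card_image) (auto simp: single_valued_def inj_on_def)

fun list_arcs :: "'a list \<Rightarrow> ('a \<times> 'a) set" where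
  "list_arcs (x # y # xs) = insert (x,y) (list_arcs (y # xs))"
| "list_arcs _ = {}"

lemma list_arcs_Cons: "ys \<noteq> [] \<Longrightarrow> list_arcs (x # ys) = insert (x, hd ys) (list_arcs ys)"
  by (cases ys) auto

lemma list_arcs_append:
  "list_arcs (xs @ ys) = list_arcs xs \<union> list_arcs ys \<union> (if xs = [] \<or> ys = [] then {} else {(last xs, hd ys)})"
  by (induction xs rule: list_arcs.induct) (auto simp: list_arcs_Cons)

lemma list_arcs_subset: "list_arcs xs \<subseteq> set xs \<times> set xs"
  by (induction xs rule: list_arcs.induct) auto

lemma list_arcs_Domain: "distinct xs \<Longrightarrow> xs \<noteq> [] \<Longrightarrow> last xs \<notin> Domain (list_arcs xs)"
proof (induction xs rule: list_arcs.induct)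
  case (1 x y xs)
  then show ?case using list_arcs_subset[of "y # xs"] by (auto split: if_splits)
qed auto

lemma list_arcs_Range: "distinct (x # xs) \<Longrightarrow> x \<notin> Range (list_arcs (x # xs))"
  using list_arcs_subset[of xs] by (cases xs) (auto dest: list_arcs_subset[THEN subsetD])

lemma single_valued_list_arcs: "distinct xs \<Longrightarrow> single_valued (list_arcs xs) \<and> single_valued ((list_arcs xs)\<inverse>)"
proof (induction xs rule: list_arcs.induct)
  case (1 x y xs)
  have "x \<notin> Domain (list_arcs (y # xs))" "y \<notin> Range (list_arcs (y # xs))"
    using 1 list_arcs_subset[of "y # xs"] list_arcs_Range[of y xs] by auto
  then show ?case using 1 by (auto simp: single_valued_def)
qed (auto simp: single_valued_def)

lemma path_edges_list_arcs: "path_edges xs = (\<lambda>(u,v). {u,v}) ` list_arcs xs"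
  by (induction xs rule: path_edges.induct) auto

text \<open>The $D$-path starting at $y$ can be moved so that it follows any $D$-path end $x$ except its own.\<close>
lemma extend_linear_arcs:
  assumes P: "distinct P" and D: "D \<subseteq> list_arcs P" and y: "y \<in> set P" "y \<notin> Range D"
  shows "\<exists>z. \<forall>x. x \<in> set P \<longrightarrow> x \<notin> Domain D \<longrightarrow> x \<noteq> z \<longrightarrow>
    (\<exists>P'. distinct P' \<and> set P' = set P \<and> insert (x,y) D \<subseteq> list_arcs P')"
proof -
  obtain A B where AB: "P = A @ y # B" using y by (meson split_list)
  have "Domain D \<subseteq> Domain (list_arcs P)" using D by auto
  moreover have "last P \<notin> Domain (list_arcs P)" using list_arcs_Domain[OF P] AB by simp
  ultimately have "last P \<notin> Domain D" by blast
  then have "\<exists>z\<in>set (y # B). z \<notin> Domain D" using AB by (intro bexI[of _ "last (y # B)"]) auto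
  then obtain M' z N where MN: "y # B = M' @ z # N" "z \<notin> Domain D" "\<forall>u\<in>set M'. u \<in> Domain D"
    using split_list_first_prop[of "y # B" "\<lambda>z. z \<notin> Domain D"] by blast
  \<comment> \<open>\<open>M\<close> is the \<open>D\<close>-path starting at \<open>y\<close>: it
    runs to the first vertex without outgoing arc of \<open>D\<close>. No arc of \<open>D\<close>
    enters \<open>y\<close>, leaves \<open>z\<close> or leaves the chosen \<open>x\<close>, so
    cutting \<open>M\<close> out and inserting it right after \<open>x\<close> breaks no arc of
    \<open>D\<close>.\<close>
  define M where "M = M' @ [z]"
  have M: "M \<noteq> []" "hd M = y" "last M = z" using MN(1) by (cases M'; auto simp: M_def)+
  have PM: "P = A @ M @ N" using AB MN by (simp add: M_def)
  show ?thesis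
  proof (intro exI[of _ z] allI impI)
    fix x assume x: "x \<in> set P" "x \<notin> Domain D" "x \<noteq> z"
    have "x \<notin> set M" using MN(3) x by (auto simp: M_def)
    then consider "x \<in> set A" | "x \<in> set N" using x(1) PM by auto
    then show "\<exists>P'. distinct P' \<and> set P' = set P \<and> insert (x,y) D \<subseteq> list_arcs P'"
    proof cases
      case 1
      then obtain X A2 where A: "A = X @ A2" "X \<noteq> []" "last X = x"
        by (metis append.assoc append_Cons append_Nil last_snoc snoc_eq_iff_butlast split_list)
      have P': "P = X @ A2 @ M @ N" using PM A by simp
      have "insert (x,y) D \<subseteq> list_arcs (X @ M @ A2 @ N)"
        using D M A x(2) MN(2) y(2) unfolding P' by (auto simp: list_arcs_append split: if_splits)
      then show ?thesis using P P' by (intro exI[of _ "X @ M @ A2 @ N"]) auto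
    next
      case 2
      then obtain X N2 where N: "N = X @ N2" "X \<noteq> []" "last X = x"
        by (metis append.assoc append_Cons append_Nil last_snoc snoc_eq_iff_butlast split_list)
      have P': "P = A @ M @ X @ N2" using PM N by simp
      have "insert (x,y) D \<subseteq> list_arcs (A @ X @ M @ N2)"
        using D M N x(2) MN(2) y(2) unfolding P' by (auto simp: list_arcs_append split: if_splits)
      then show ?thesis using P P' by (intro exI[of _ "A @ X @ M @ N2"]) auto
    qed
  qed
qed

text \<open>Lying on a directed Hamilton path of the complete graph encodes acyclicity. The witness
  \<open>P\<close> is also the arbitrary joining of the components that is repaired later.\<close>

definition linear_forests :: "'a set \<Rightarrow> 'a set set \<Rightarrow> nat \<Rightarrow> ('a \<times> 'a) set set" where
  "linear_forests V E r = {D. D \<subseteq> graph_arcs E \<and> card D = r \<and>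
     (\<exists>P. distinct P \<and> set P = V \<and> D \<subseteq> list_arcs P)}"

context mixing_graph
begin

lemma finite_graph_arcs: "finite (graph_arcs E)"
  by (rule finite_subset[of _ "V \<times> V"]) (use edge_in_V finV in \<open>auto simp: graph_arcs_def\<close>)

lemma finite_partial_cycles: "finite (partial_cycles E r)"
  by (rule finite_subset[of _ "Pow (graph_arcs E)"]) (use finite_graph_arcs in \<open>auto simp: partial_cycles_def\<close>)

lemma linear_forests_partial: "linear_forests V E r \<subseteq> partial_cycles E r"
proof
  fix D assume "D \<in> linear_forests V E r"
  then obtain P where "D \<subseteq> graph_arcs E" "card D = r" "distinct P" "D \<subseteq> list_arcs P"
    by (auto simp: linear_forests_def)
  then show "D \<in> partial_cycles E r"
    using single_valued_list_arcs[of P] single_valued_subset[of D "list_arcs P"]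
      single_valued_subset[of "D\<inverse>" "(list_arcs P)\<inverse>"]
    by (auto simp: partial_cycles_def)
qed

lemma finite_linear_forests: "finite (linear_forests V E r)"
  using finite_subset[OF linear_forests_partial finite_partial_cycles] .

lemma free_ends:
  assumes "D \<in> partial_cycles E r"
  shows "card (V - Domain D) = n - r" "card (V - Range D) = n - r"
proof -
  have D: "D \<subseteq> graph_arcs E" "card D = r" "single_valued D" "single_valued (D\<inverse>)"
    using assms by (auto simp: partial_cycles_def)
  have sub: "Domain D \<subseteq> V" "Range D \<subseteq> V" using D(1) edge_in_V by (auto simp: graph_arcs_def)
  show "card (V - Domain D) = n - r"
    using card_Diff_subset[OF finite_subset[OF sub(1) finV] sub(1)] card_Domain_single_valued[OF D(3)] D(2) by simp
  show "card (V - Range D) = n - r"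
    using card_Diff_subset[OF finite_subset[OF sub(2) finV] sub(2)] card_Range_single_valued[OF D(4)] D(2) by simp
qed

lemma mixing_square:
  assumes "X \<subseteq> V" "Y \<subseteq> V" "card X = s" "card Y = s"
  shows "\<bar>real (card (edge_pairs E X Y)) - d * real s ^ 2 / n\<bar> \<le> \<eta> * d * s"
proof -
  have "sqrt (real s * real s) = s" by simp
  then show ?thesis using mixing[OF assms(1,2)] assms(3,4) by (simp add: power2_eq_square mult_ac)
qed

text \<open>An added arc joins a vertex without outgoing arc to one without incoming arc. Mixing
  counts these pairs well while many free ends remain; afterwards only the degree bound
  \<open>d * (n - r)\<close> is useful, hence the minimum.\<close>

lemma partial_cycles_step:
  "Suc r * card (partial_cycles E (Suc r)) \<le>
    card (partial_cycles E r) * min (d * (n - r)) (d * real (n - r) ^ 2 / n + \<eta> * d * real (n - r))"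
proof -
  define X where "X D = edge_pairs E (V - Domain D) (V - Range D)" for D
  let ?c = "min (real (d * (n - r))) (d * real (n - r) ^ 2 / n + \<eta> * d * real (n - r))"
  have "Suc r * card (partial_cycles E (Suc r)) \<le> (\<Sum>D\<in>partial_cycles E r. card (X D))"
  proof (rule double_count_remove)
    fix D p assume D: "D \<in> partial_cycles E (Suc r)" and p: "p \<in> D"
    have "finite D" using D by (auto simp: partial_cycles_def intro: card_ge_0_finite)
    obtain a b where ab: "p = (a,b)" by force
    have sv: "single_valued D" "single_valued (D\<inverse>)" "D \<subseteq> graph_arcs E" using D by (auto simp: partial_cycles_def)
    have "D - {p} \<in> partial_cycles E r"
      using D p single_valued_subset[of "D - {p}" D] single_valued_subset[of "(D - {p})\<inverse>" "D\<inverse>"]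
      by (auto simp: partial_cycles_def card_Diff_singleton)
    moreover have "a \<notin> Domain (D - {p})" "b \<notin> Range (D - {p})"
      using sv p ab by (auto simp: single_valued_def)
    moreover have "{a,b} \<in> E" using sv p ab by (auto simp: graph_arcs_def)
    ultimately show "D - {p} \<in> partial_cycles E r \<and> p \<in> X (D - {p})"
      using edge_in_V ab by (auto simp: X_def edge_pairs_def)
  next
    fix D assume "D \<in> partial_cycles E (Suc r)" then show "card D = Suc r" by (simp add: partial_cycles_def)
  qed (auto simp: finite_partial_cycles X_def finV intro!: finite_edge_pairs)
  then have "real (Suc r * card (partial_cycles E (Suc r))) \<le> (\<Sum>D\<in>partial_cycles E r. real (card (X D)))"
    by (simp only: of_nat_sum[symmetric] of_nat_le_iff)
  also have "\<dots> \<le> (\<Sum>D\<in>partial_cycles E r. ?c)"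
  proof (rule sum_mono)
    fix D assume D: "D \<in> partial_cycles E r"
    note fe = free_ends[OF D]
    have "card (X D) = (\<Sum>x\<in>V - Domain D. card (nbr E x \<inter> (V - Range D)))"
      unfolding X_def by (rule card_edge_pairs) (simp add: finV)
    also have "\<dots> \<le> (\<Sum>x\<in>V - Domain D. d)"
      by (rule sum_mono) (metis DiffD1 Int_lower1 card_mono finite_nbr regular)
    also have "\<dots> = d * (n - r)" using fe by simp
    finally have 1: "real (card (X D)) \<le> real (d * (n - r))" by (simp only: of_nat_le_iff)
    have "real (card (X D)) \<le> d * real (n - r) ^ 2 / n + \<eta> * d * real (n - r)"
      using mixing_square[OF Diff_subset Diff_subset fe] unfolding X_def by (simp add: abs_le_iff)
    then show "real (card (X D)) \<le> ?c" using 1 by simp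
  qed
  finally show ?thesis by simp
qed

text \<open>For each free start \<open>y\<close> at most one free end closes a cycle, namely that of
  its own path. This excludes at most n - r arcs, and since 1 <= \<open>\<eta> * d\<close> they fit
  into a second copy of the mixing error.\<close>

lemma linear_forests_step:
  assumes r: "r < n"
  shows "card (linear_forests V E r) * (d * real (n - r) ^ 2 / n - 2 * \<eta> * d * real (n - r))
    \<le> Suc r * card (linear_forests V E (Suc r))"
proof -
  define good where "good D p \<longleftrightarrow> insert p D \<in> linear_forests V E (Suc r)" for D p
  define X where "X D = {p \<in> edge_pairs E (V - Domain D) (V - Range D). good D p}" for D
  have finX: "finite (X D)" for D unfolding X_def
    by (rule finite_subset[of _ "edge_pairs E (V - Domain D) (V - Range D)"]) (auto intro!: finite_edge_pairs simp: finV)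
  have "(\<Sum>D\<in>linear_forests V E r. card (X D)) \<le> Suc r * card (linear_forests V E (Suc r))"
  proof (rule double_count_insert)
    fix D p assume "D \<in> linear_forests V E r" "p \<in> X D"
    then show "p \<notin> D \<and> insert p D \<in> linear_forests V E (Suc r)"
      by (auto simp: X_def good_def edge_pairs_def)
  next
    fix D assume "D \<in> linear_forests V E (Suc r)" then show "card D = Suc r" by (simp add: linear_forests_def)
  qed (simp_all add: finite_linear_forests finX)
  then have le: "(\<Sum>D\<in>linear_forests V E r. real (card (X D))) \<le> real (Suc r * card (linear_forests V E (Suc r)))"
    by (simp only: of_nat_sum[symmetric] of_nat_le_iff)
  have "card (linear_forests V E r) * (d * real (n - r) ^ 2 / n - 2 * \<eta> * d * real (n - r))
      = (\<Sum>D\<in>linear_forests V E r. d * real (n - r) ^ 2 / n - 2 * \<eta> * d * real (n - r))"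
    by simp
  also have "\<dots> \<le> (\<Sum>D\<in>linear_forests V E r. real (card (X D)))"
  proof (rule sum_mono)
    fix D assume D: "D \<in> linear_forests V E r"
    then obtain P where P: "D \<subseteq> graph_arcs E" "card D = r" "distinct P" "set P = V" "D \<subseteq> list_arcs P"
      by (auto simp: linear_forests_def)
    have Dp: "D \<in> partial_cycles E r" using D linear_forests_partial by blast
    note fe = free_ends[OF Dp]
    have finD: "finite D" using finite_graph_arcs P(1) finite_subset by blast
    have "\<forall>y\<in>V - Range D. \<exists>z. \<forall>x. x \<in> set P \<longrightarrow> x \<notin> Domain D \<longrightarrow> x \<noteq> z \<longrightarrow>
      (\<exists>P'. distinct P' \<and> set P' = set P \<and> insert (x,y) D \<subseteq> list_arcs P')"
      using extend_linear_arcs[OF P(3,5)] P(4) by blast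
    then obtain z where z: "\<And>x y. y \<in> V - Range D \<Longrightarrow> x \<in> V \<Longrightarrow> x \<notin> Domain D \<Longrightarrow> x \<noteq> z y \<Longrightarrow>
      (\<exists>P'. distinct P' \<and> set P' = V \<and> insert (x,y) D \<subseteq> list_arcs P')"
      unfolding P(4) by metis
    let ?all = "edge_pairs E (V - Domain D) (V - Range D)"
    have "?all - (\<lambda>y. (z y, y)) ` (V - Range D) \<subseteq> X D"
    proof
      fix p assume p: "p \<in> ?all - (\<lambda>y. (z y, y)) ` (V - Range D)"
      obtain x y where xy: "p = (x,y)" by force
      have "x \<in> V" "x \<notin> Domain D" "y \<in> V - Range D" "x \<noteq> z y" "{x,y} \<in> E"
        using p xy by (auto simp: edge_pairs_def)
      moreover from this have "(x,y) \<notin> D" by auto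
      ultimately have "insert (x,y) D \<in> linear_forests V E (Suc r)"
        using z[of y x] P finD by (auto simp: linear_forests_def graph_arcs_def)
      then show "p \<in> X D" using p xy by (auto simp: X_def good_def)
    qed
    then have "card (?all - (\<lambda>y. (z y, y)) ` (V - Range D)) \<le> card (X D)"
      by (rule card_mono[OF finX])
    moreover have "card ((\<lambda>y. (z y, y)) ` (V - Range D)) \<le> n - r"
      using card_image_le[of "V - Range D" "\<lambda>y. (z y, y)"] finV fe by simp
    ultimately have "card ?all \<le> card (X D) + (n - r)"
      using diff_card_le_card_Diff[of "(\<lambda>y. (z y, y)) ` (V - Range D)" ?all] finV by simp
    then have 1: "real (card ?all) \<le> real (card (X D)) + real (n - r)" by linarith
    have "d * real (n - r) ^ 2 / n - \<eta> * d * real (n - r) \<le> real (card ?all)"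
      using mixing_square[OF Diff_subset Diff_subset fe] by (simp add: abs_le_iff)
    moreover have "1 * real (n - r) \<le> (\<eta> * d) * real (n - r)" using eta_d by (intro mult_right_mono) auto
    ultimately show "d * real (n - r) ^ 2 / n - 2 * \<eta> * d * real (n - r) \<le> real (card (X D))"
      using 1 by simp
  qed
  finally show ?thesis using le by simp
qed

end

section \<open>Telescoped counts: Hamilton cycles from above, linear forests from below\<close>

lemma prod_recurrence_upper:
  fixes b c :: "nat \<Rightarrow> real"
  assumes "b 0 \<le> 1" and st: "\<And>r. r < m \<Longrightarrow> Suc r * b (Suc r) \<le> b r * c r" and c: "\<And>r. r < m \<Longrightarrow> c r \<ge> 0"
  shows "r \<le> m \<Longrightarrow> fact r * b r \<le> (\<Prod>i<r. c i)"
proof (induction r)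
  case (Suc r)
  have "fact (Suc r) * b (Suc r) = fact r * (Suc r * b (Suc r))" by (simp add: mult_ac)
  also have "\<dots> \<le> fact r * (b r * c r)" using st[of r] Suc.prems by (intro mult_left_mono) auto
  also have "\<dots> = (fact r * b r) * c r" by simp
  also have "\<dots> \<le> (\<Prod>i<r. c i) * c r" using Suc c[of r] by (intro mult_right_mono) auto
  finally show ?case by simp
qed (use assms in auto)

lemma prod_recurrence_lower:
  fixes b c :: "nat \<Rightarrow> real"
  assumes "1 \<le> b 0" and st: "\<And>r. r < m \<Longrightarrow> b r * c r \<le> Suc r * b (Suc r)" and c: "\<And>r. r < m \<Longrightarrow> c r \<ge> 0"
  shows "r \<le> m \<Longrightarrow> (\<Prod>i<r. c i) \<le> fact r * b r"
proof (induction r)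
  case (Suc r)
  have "(\<Prod>i<Suc r. c i) = (\<Prod>i<r. c i) * c r" by simp
  also have "\<dots> \<le> (fact r * b r) * c r" using Suc c[of r] by (intro mult_right_mono) auto
  also have "\<dots> = fact r * (b r * c r)" by simp
  also have "\<dots> \<le> fact r * (Suc r * b (Suc r))" using st[of r] Suc.prems by (intro mult_left_mono) auto
  also have "\<dots> = fact (Suc r) * b (Suc r)" by (simp add: mult_ac)
  finally show ?case .
qed (use assms in auto)

lemma closed_walk_arcs:
  assumes d: "distinct vs" and l: "length vs \<ge> 1"
  defines "D \<equiv> {(vs ! i, vs ! (Suc i mod length vs)) | i. i < length vs}"
  shows "card D = length vs" "single_valued D" "single_valued (D\<inverse>)"
    "(\<lambda>(u,v). {u,v}) ` D = closed_walk_edges vs"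
proof -
  let ?n = "length vs"
  have D: "D = (\<lambda>i. (vs ! i, vs ! (Suc i mod ?n))) ` {..<?n}" by (auto simp: D_def)
  show "card D = ?n" unfolding D by (subst card_image) (auto simp: inj_on_def d nth_eq_iff_index_eq)
  show "single_valued D" using d by (auto simp: D_def single_valued_def nth_eq_iff_index_eq)
  have inj: "i = j" if "i < ?n" "j < ?n" "Suc i mod ?n = Suc j mod ?n" for i j
    using that by (auto simp: mod_Suc split: if_splits)
  have lt: "Suc i mod ?n < ?n" for i using l by (intro mod_less_divisor) linarith
  show "single_valued (D\<inverse>)"
  proof (rule single_valuedI)
    fix y x x' assume "(y,x) \<in> D\<inverse>" "(y,x') \<in> D\<inverse>"
    then obtain i j where ij: "i < ?n" "j < ?n" "x = vs ! i" "x' = vs ! j"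
      "vs ! (Suc i mod ?n) = vs ! (Suc j mod ?n)" unfolding D_def by blast
    then have "Suc i mod ?n = Suc j mod ?n" using nth_eq_iff_index_eq[OF d lt lt] by blast
    then show "x = x'" using inj[OF ij(1,2)] ij by simp
  qed
  show "(\<lambda>(u,v). {u,v}) ` D = closed_walk_edges vs"
    unfolding D closed_walk_edges_def by auto
qed

context mixing_graph
begin

text \<open>Every Hamilton cycle is the undirected image of one of its orientations, which is a
  partial injection with \<open>n\<close> arcs.\<close>

lemma num_hamilton_cycles_le: "num_hamilton_cycles V E \<le> card (partial_cycles E n)"
proof -
  have "hamilton_cycles V E \<subseteq> (\<lambda>D. (\<lambda>(u,v). {u,v}) ` D) ` partial_cycles E n"
  proof
    fix C assume "C \<in> hamilton_cycles V E"
    then obtain vs where vs: "C \<subseteq> E" "distinct vs" "set vs = V" "length vs \<ge> 3" "C = closed_walk_edges vs"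
      by (auto simp: hamilton_cycles_def)
    define D where "D = {(vs ! i, vs ! (Suc i mod length vs)) | i. i < length vs}"
    have l: "length vs \<ge> 1" using vs by simp
    note p = closed_walk_arcs[OF vs(2) l, folded D_def]
    have "D \<subseteq> graph_arcs E"
    proof
      fix q assume q: "q \<in> D"
      have "(\<lambda>(u,v). {u,v}) q \<in> C" using p(4) vs(5) q by blast
      then show "q \<in> graph_arcs E" using vs(1) by (auto simp: graph_arcs_def)
    qed
    moreover have "card D = n" using p(1) vs distinct_card by metis
    ultimately have "D \<in> partial_cycles E n" using p by (simp add: partial_cycles_def)
    then show "C \<in> (\<lambda>D. (\<lambda>(u,v). {u,v}) ` D) ` partial_cycles E n" using p(4) vs(5) by blast
  qed
  then have "card (hamilton_cycles V E) \<le> card ((\<lambda>D. (\<lambda>(u,v). {u,v}) ` D) ` partial_cycles E n)"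
    by (intro card_mono) (simp_all add: finite_partial_cycles)
  also have "\<dots> \<le> card (partial_cycles E n)" by (rule card_image_le) (simp add: finite_partial_cycles)
  finally show ?thesis by (simp add: num_hamilton_cycles_def)
qed

lemma partial_cycles_upper:
  assumes s: "s \<le> n" and del: "\<delta> \<ge> 0" and eta: "\<eta> * n \<le> \<delta> * s" and n: "n > 0"
  shows "card (partial_cycles E n) \<le> (1 + \<delta>) ^ n * (d / n) ^ n * fact n * real n ^ s"
proof -
  \<comment> \<open>While more than \<open>s\<close> free ends remain, the mixing error is at most a
    fraction \<open>\<delta>\<close> of the main term. The last \<open>s\<close> steps use the
    degree bound, losing up to a factor \<open>n\<close> each; this produces
    \<open>real n ^ s\<close>.\<close>
  define g where "g i = (if i < n - s then (1 + \<delta>) * (d / n) * real (n - i) else d)" for i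
  have "fact n * real (card (partial_cycles E n)) \<le> (\<Prod>i<n. real (n - i) * g i)"
  proof (rule prod_recurrence_upper[where m = n])
    have "partial_cycles E 0 \<subseteq> {{}}"
      using finite_graph_arcs finite_subset by (fastforce simp: partial_cycles_def)
    then show "real (card (partial_cycles E 0)) \<le> 1"
      using card_mono[of "{{}}" "partial_cycles E 0"] by simp
    fix r assume r: "r < n"
    show "real (n - r) * g r \<ge> 0" using del by (simp add: g_def)
    have "d * real (n - r) ^ 2 / n + \<eta> * d * real (n - r) \<le> real (n - r) * ((1 + \<delta>) * (d / n) * real (n - r))"
      if "r < n - s"
    proof -
      have "real s \<le> real (n - r)" using that by linarith
      then have "\<delta> * s \<le> \<delta> * real (n - r)" using del by (intro mult_left_mono) auto
      then have "\<eta> * n \<le> \<delta> * real (n - r)" using eta by linarith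
      then have "\<eta> \<le> \<delta> * real (n - r) / n" using n by (simp add: field_simps)
      then have "\<eta> * (d * real (n - r)) \<le> \<delta> * real (n - r) / n * (d * real (n - r))" by (intro mult_right_mono) auto
      then show ?thesis by (simp add: power2_eq_square algebra_simps add_divide_distrib)
    qed
    then have "min (real (d * (n - r))) (d * real (n - r) ^ 2 / n + \<eta> * d * real (n - r)) \<le> real (n - r) * g r"
      by (auto simp: g_def mult.commute min_def)
    then have "card (partial_cycles E r) * min (real (d * (n - r))) (d * real (n - r) ^ 2 / n + \<eta> * d * real (n - r))
      \<le> card (partial_cycles E r) * (real (n - r) * g r)" by (intro mult_left_mono) auto
    moreover have "real (Suc r) * real (card (partial_cycles E (Suc r))) \<le> card (partial_cycles E r) *
        min (real (d * (n - r))) (d * real (n - r) ^ 2 / n + \<eta> * d * real (n - r))"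
      using partial_cycles_step[of r] by (simp only: of_nat_mult)
    ultimately show "real (Suc r) * real (card (partial_cycles E (Suc r))) \<le> real (card (partial_cycles E r)) * (real (n - r) * g r)"
      by linarith
  qed simp
  also have "\<dots> = fact n * (\<Prod>i<n. g i)"
    using prod_falling[of n n] by (simp add: prod.distrib)
  finally have 1: "real (card (partial_cycles E n)) \<le> (\<Prod>i<n. g i)" by simp
  have "(\<Prod>i<n. g i) = (\<Prod>i<n-s. g i) * (\<Prod>i\<in>{n-s..<n}. g i)"
    by (subst prod.union_disjoint[symmetric]) (auto intro!: prod.cong)
  also have "(\<Prod>i\<in>{n-s..<n}. g i) = real d ^ s" using s by (simp add: g_def)
  also have "(\<Prod>i<n-s. g i) = (\<Prod>i<n-s. ((1 + \<delta>) * (d / n)) * real (n - i))" by (intro prod.cong) (auto simp: g_def)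
  also have "\<dots> = ((1 + \<delta>) * (d / n)) ^ (n - s) * (fact n / fact s)"
    using prod_falling[of "n - s" n] s
    by (simp only: prod.distrib prod_constant power_mult_distrib card_lessThan diff_diff_cancel diff_le_self)
  also have "((1 + \<delta>) * (d / n)) ^ (n - s) * (fact n / fact s) * real d ^ s
      = (1 + \<delta>) ^ (n - s) * ((d / n) ^ (n - s) * real d ^ s) * (fact n / fact s)"
    by (simp only: power_mult_distrib[of "1 + \<delta>"] mult_ac)
  also have "(d / n) ^ (n - s) * real d ^ s = (d / n) ^ n * real n ^ s"
  proof -
    have "(d / n) ^ n = (d / n) ^ (n - s) * (d / n) ^ s" using s by (simp flip: power_add)
    then show ?thesis using n by (simp add: power_divide)
  qed
  also have "(1 + \<delta>) ^ (n - s) * ((d / n) ^ n * real n ^ s) * (fact n / fact s)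
      \<le> (1 + \<delta>) ^ n * ((d / n) ^ n * real n ^ s) * fact n"
  proof -
    have fs: "fact n / fact s \<le> (fact n :: real)" by (simp add: divide_le_eq mult_le_cancel_left1)
    have pw: "(1 + \<delta>) ^ (n - s) \<le> (1 + \<delta>) ^ n" using del by (intro power_increasing) auto
    show ?thesis by (intro mult_mono pw fs order_refl) (use del in auto)
  qed
  finally show ?thesis using 1 by (simp add: mult_ac)
qed

text \<open>Each of the first n - s steps gains at least (1 - \<open>\<delta>\<close>) (d/n) (n -
  r)^2. Dividing the product by (n - s)! turns (n!/s!)^2 into n! binom(n,s) / s!, which is at least
  n! / n^s. The exponent n - s is raised to n because the base is at most 1.\<close>

lemma linear_forests_lower:
  assumes s: "s \<le> n" and del: "\<delta> \<ge> 0" "\<delta> \<le> 1" and eta: "2 * \<eta> * n \<le> \<delta> * s" and n: "n > 0"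
  shows "(1 - \<delta>) ^ n * (d / n) ^ n * fact n \<le> card (linear_forests V E (n - s)) * real n ^ s"
proof -
  let ?c = "(1 - \<delta>) * (d / n)"
  have dn: "real d / n \<le> 1" using d_less_n n by (cases "V = {}") (auto simp: divide_le_eq)
  have "(\<Prod>i<n-s. ?c * (real (n - i))\<^sup>2) \<le> fact (n - s) * real (card (linear_forests V E (n - s)))"
  proof (rule prod_recurrence_lower[where m = "n - s"])
    obtain P where "set P = V" "distinct P" using finite_distinct_list[OF finV] by blast
    then have "{} \<in> linear_forests V E 0" by (auto simp: linear_forests_def)
    then have "card (linear_forests V E 0) > 0" using finite_linear_forests by (auto simp: card_gt_0_iff)
    then show "1 \<le> real (card (linear_forests V E 0))" by simp
    fix r assume r: "r < n - s"
    show "?c * (real (n - r))\<^sup>2 \<ge> 0" using del by simp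
    have "real s \<le> real (n - r)" using r by linarith
    then have "\<delta> * s \<le> \<delta> * real (n - r)" using del by (intro mult_left_mono) auto
    then have "2 * \<eta> \<le> \<delta> * real (n - r) / n" using eta n by (simp add: field_simps)
    then have "2 * \<eta> * (d * real (n - r)) \<le> \<delta> * real (n - r) / n * (d * real (n - r))" by (intro mult_right_mono) auto
    then have "?c * (real (n - r))\<^sup>2 \<le> d * real (n - r) ^ 2 / n - 2 * \<eta> * d * real (n - r)"
      by (simp add: power2_eq_square algebra_simps diff_divide_distrib)
    then have "card (linear_forests V E r) * (?c * (real (n - r))\<^sup>2)
        \<le> card (linear_forests V E r) * (d * real (n - r) ^ 2 / n - 2 * \<eta> * d * real (n - r))" by (intro mult_left_mono) auto
    moreover have "card (linear_forests V E r) * (d * real (n - r) ^ 2 / n - 2 * \<eta> * d * real (n - r))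
        \<le> real (Suc r) * real (card (linear_forests V E (Suc r)))"
      using linear_forests_step[of r] r by (simp only: of_nat_mult)
    ultimately show "real (card (linear_forests V E r)) * (?c * (real (n - r))\<^sup>2) \<le> real (Suc r) * real (card (linear_forests V E (Suc r)))"
      by linarith
  qed simp
  also have "(\<Prod>i<n-s. ?c * (real (n - i))\<^sup>2) = ?c ^ (n - s) * (\<Prod>i<n-s. real (n - i))\<^sup>2"
    by (simp only: prod.distrib prod_constant card_lessThan power_mult_distrib prod_power_distrib)
  also have "\<dots> = ?c ^ (n - s) * (fact n / fact s)\<^sup>2" using prod_falling[of "n - s" n] s by (simp del: of_nat_diff)
  finally have 1: "?c ^ (n - s) * (fact n / fact s)\<^sup>2 \<le> fact (n - s) * real (card (linear_forests V E (n - s)))" .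
  have bin: "fact (n - s) * fact s \<le> (fact n :: real)"
  proof -
    have "real (fact s * fact (n - s) * (n choose s)) = real (fact n)" by (simp only: binomial_fact_lemma[OF s])
    moreover have "real (n choose s) \<ge> 1" using s by (simp add: Suc_le_eq zero_less_binomial_iff)
    ultimately show ?thesis
      using mult_left_mono[of 1 "real (n choose s)" "fact (n - s) * fact s"] by (simp add: mult_ac)
  qed
  have fs: "(fact s :: real) \<le> real n ^ s"
    using fact_le_power[of s, where ?'a = real] power_mono[of "real s" "real n" s] s by simp
  have "(1 - \<delta>) ^ n * (d / n) ^ n * fact n \<le> ?c ^ (n - s) * fact n"
  proof -
    have "?c ^ n \<le> ?c ^ (n - s)"
      using del dn by (intro power_decreasing mult_le_one) auto
    moreover have "(1 - \<delta>) ^ n * (d / n) ^ n = ?c ^ n" by (simp only: power_mult_distrib)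
    ultimately show ?thesis by (metis fact_ge_zero mult_right_mono)
  qed
  also have "\<dots> \<le> ?c ^ (n - s) * (fact n * (fact n / (fact (n - s) * fact s)))"
    using bin del by (intro mult_left_mono) (auto simp: mult_le_cancel_left1 le_divide_eq)
  also have "\<dots> = ?c ^ (n - s) * (fact n / fact s)\<^sup>2 * fact s / fact (n - s)"
    by (simp add: power2_eq_square)
  also have "\<dots> \<le> fact (n - s) * real (card (linear_forests V E (n - s))) * fact s / fact (n - s)"
    using 1 by (intro divide_right_mono mult_right_mono) auto
  also have "\<dots> = real (card (linear_forests V E (n - s))) * fact s" by simp
  also have "\<dots> \<le> real (card (linear_forests V E (n - s))) * real n ^ s" using fs by (intro mult_left_mono) auto
  finally show ?thesis .
qed

end

subsection \<open>Growth of rotation sets and robust cores\<close>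

context mixing_graph
begin

text \<open>If the set of ends fails to double, then its neighbourhood in \<open>U\<close>, being
  covered by the new ends and their list neighbours, has fewer than 6 times as many elements as the
  old ends. With degrees \<open>\<gamma> * d\<close> into \<open>U\<close>, mixing then forces
  \<gamma> <= 6 |S|/n + 3 \<eta>, so the set is already of linear size.\<close>

lemma rot_ends_growth:
  fixes \<gamma> :: real
  assumes L: "distinct L" "L \<noteq> []" "set L \<subseteq> V" and U: "U \<subseteq> set L"
    and g: "\<gamma> > 3 * \<eta>"
    and deg: "\<And>x. x \<in> insert (hd L) (list_nbrs L U) \<Longrightarrow> \<gamma> * d \<le> card (nbr E x \<inter> U)"
  shows "(2::real) ^ t \<le> real (card (rot_ends E L U t)) \<or> n * (\<gamma> - 3 * \<eta>) / 6 \<le> card (rot_ends E L U t)"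
proof (induction t)
  case 0
  have "hd L \<in> rot_ends E L U 0" by (auto simp: rot_ends_def intro: rotations.start)
  then have "card (rot_ends E L U 0) > 0"
    using finite_subset[OF rot_ends_subset[OF L(1,2)]] by (auto simp: card_gt_0_iff)
  then show ?case by simp
next
  case (Suc t)
  let ?S = "rot_ends E L U t" and ?S' = "rot_ends E L U (Suc t)"
  have fin: "finite (rot_ends E L U k)" for k using finite_subset[OF rot_ends_subset[OF L(1,2)]] by simp
  have mono: "card ?S \<le> card ?S'" by (rule card_mono[OF fin rot_ends_mono])
  show ?case
  proof (cases "2 * card ?S \<le> card ?S'")
    case True
    then have two: "2 * real (card ?S) \<le> card ?S'" by linarith
    from Suc show ?thesis
    proof
      assume "(2::real) ^ t \<le> real (card ?S)"
      then have "(2::real) ^ Suc t \<le> real (card ?S')" using two unfolding power_Suc by linarith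
      then show ?thesis ..
    next
      assume "n * (\<gamma> - 3 * \<eta>) / 6 \<le> card ?S"
      then have "n * (\<gamma> - 3 * \<eta>) / 6 \<le> card ?S'" using two by linarith
      then show ?thesis ..
    qed
  next
    case False
    \<comment> \<open>Restricting to the joint neighbourhood changes no degree of a vertex of
      \<open>?S\<close> into \<open>U\<close>, and \<open>W\<close> is small by Posa's lemma. The
      factor 3 in the error is a rounding up of the square root of 6.\<close>
    define W where "W = (\<Union>x\<in>?S. nbr E x) \<inter> U"
    have SV: "?S \<subseteq> V" using rot_ends_subset[OF L(1,2)] L(3) by blast
    have WV: "W \<subseteq> V" using U L(3) by (auto simp: W_def)
    have "W \<subseteq> ?S' \<union> list_nbrs L ?S'"
    proof
      fix w assume "w \<in> W"
      then obtain x where x: "x \<in> ?S" "{x,w} \<in> E" "w \<in> U" by (auto simp: W_def nbr_def)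
      moreover have "x \<noteq> w" using x(2) no_loop by auto
      ultimately show "w \<in> ?S' \<union> list_nbrs L ?S'"
        using rot_ends_neighbours[OF L(1,2)] U by blast
    qed
    then have "card W \<le> card (?S' \<union> list_nbrs L ?S')" by (rule card_mono[rotated]) (simp add: fin)
    also have "\<dots> \<le> 3 * card ?S'" by (rule card_rot_nbrs[OF L(1,2)])
    finally have W6: "card W \<le> 6 * card ?S" using False by linarith
    have pos: "card ?S > 0" using False by simp
    have "\<gamma> * d \<le> card (nbr E x \<inter> W)" if x: "x \<in> ?S" for x
    proof -
      have "x \<in> insert (hd L) (list_nbrs L U)" using x rot_ends_in_nbrs by (fastforce simp: rot_ends_def)
      moreover have "nbr E x \<inter> W = nbr E x \<inter> U" using x by (auto simp: W_def)
      ultimately show ?thesis using deg by simp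
    qed
    then have "\<gamma> * d * card ?S \<le> d * card ?S * card W / n + \<eta> * d * sqrt (card ?S * card W)"
      by (rule expansion[OF SV WV])
    also have "\<dots> \<le> d * card ?S * (6 * card ?S) / n + \<eta> * d * (3 * card ?S)"
    proof (rule add_mono)
      have "d * card ?S * card W \<le> d * card ?S * (6 * card ?S)" using W6 by (intro mult_left_mono) auto
      then show "d * card ?S * card W / real n \<le> d * card ?S * (6 * card ?S) / real n"
        by (intro divide_right_mono) (simp_all only: of_nat_le_iff of_nat_0_le_iff)
      have "real (card ?S * card W) \<le> (3 * real (card ?S))\<^sup>2"
      proof -
        have "card ?S * card W \<le> card ?S * (6 * card ?S)" using W6 by (intro mult_left_mono) auto
        also have "\<dots> \<le> 9 * (card ?S * card ?S)" by simp
        finally have "real (card ?S * card W) \<le> real (9 * (card ?S * card ?S))" by (simp only: of_nat_le_iff)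
        then show ?thesis by (simp add: power2_eq_square)
      qed
      then have "sqrt (real (card ?S * card W)) \<le> 3 * card ?S" by (intro real_le_lsqrt) auto
      then show "\<eta> * d * sqrt (card ?S * card W) \<le> \<eta> * d * (3 * card ?S)"
        using eta_pos by (intro mult_left_mono) auto
    qed
    finally have "(d * real (card ?S)) * \<gamma> \<le> (d * real (card ?S)) * (6 * card ?S / n + 3 * \<eta>)"
      by (simp add: algebra_simps)
    then have "\<gamma> \<le> 6 * card ?S / n + 3 * \<eta>"
      by (rule mult_left_le_imp_le) (use pos d_pos in simp)
    moreover have "n > 0" using SV pos finV by (metis card_0_eq card_gt_0_iff subset_empty card.empty gr0I)
    ultimately have "n * (\<gamma> - 3 * \<eta>) / 6 \<le> card ?S" by (simp add: field_simps)
    then show ?thesis using mono by linarith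
  qed
qed

text \<open>Vertices with too few neighbours in the current core are peeled off; if
  \<open>m div 16\<close> of them were ever collected, they would contradict
  \<open>few_deficient\<close>. At that size the core still has 3/4 of the block, because 2 + 2
  (m/16) <= m/4.\<close>

lemma block_core:
  assumes I: "distinct I" "set I \<subseteq> V" and m: "m = length I" and m16: "m \<ge> 32"
    and big: "12 * (\<eta> * n)\<^sup>2 < real (m div 16) * real m"
  obtains U where "U \<subseteq> set I - {hd I, last I}"
    "\<And>x. x \<in> list_nbrs I U \<Longrightarrow> d * real m / (2 * n) \<le> card (nbr E x \<inter> U)"
    "real (card {x \<in> V. real (card (nbr E x \<inter> U)) < d * real m / (2 * n)}) * m \<le> 12 * (\<eta> * n)\<^sup>2"
proof -
  define q where "q = m div 16"
  \<comment> \<open>The list neighbours of \<open>W\<close> are removed, not \<open>W\<close>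
    itself: pivots may have small degree, but the ends they create are their list neighbours and
    must not lie in \<open>W\<close>. Omitting both ends of the block keeps the neighbours of a
    pivot inside it.\<close>
  define U where "U W = set I - {hd I, last I} - list_nbrs I W" for W
  define low where "low W = {x \<in> V. real (card (nbr E x \<inter> U W)) < d * real m / (2 * n)}" for W
  have UV: "U W \<subseteq> V" for W using I by (auto simp: U_def)
  have Usub: "U W \<subseteq> set I - {hd I, last I}" for W by (auto simp: U_def)
  have Ucard: "3 * real m \<le> 4 * card (U W)" if "card W \<le> q" "finite W" for W
  proof -
    have "card (list_nbrs I W) \<le> 2 * q" using card_list_nbrs[OF I(1) that(2)] that(1) by linarith
    moreover have "card {hd I, last I} \<le> 2" by (simp add: card_insert_if)
    moreover have "card (set I) \<le> card (U W \<union> {hd I, last I} \<union> list_nbrs I W)"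
      by (intro card_mono) (auto simp: U_def)
    moreover have "\<dots> \<le> card (U W) + card {hd I, last I} + card (list_nbrs I W)"
      by (meson card_Un_le add_le_mono1 le_trans)
    ultimately have "m \<le> card (U W) + 2 + 2 * q" using distinct_card[OF I(1)] m by linarith
    moreover have "16 * q \<le> m" by (simp add: q_def)
    ultimately show ?thesis using m16 by linarith
  qed
  have lowcard: "real (card Y) * m \<le> 12 * (\<eta> * n)\<^sup>2" if "card W \<le> q" "finite W" "Y \<subseteq> low W" for W Y
    by (rule few_deficient[OF _ UV[of W] Ucard[OF that(1,2)]]) (use that(3) in \<open>auto simp: low_def\<close>)
  have lowmono: "low W \<subseteq> low W'" if "W \<subseteq> W'" for W W'
  proof -
    have "U W' \<subseteq> U W" using that by (auto simp: U_def list_nbrs_def)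
    then have "card (nbr E x \<inter> U W') \<le> card (nbr E x \<inter> U W)" for x
      by (intro card_mono) (auto simp: finite_nbr)
    then have "real (card (nbr E x \<inter> U W')) \<le> card (nbr E x \<inter> U W)" for x by (simp only: of_nat_le_iff)
    then show ?thesis unfolding low_def by (blast intro: le_less_trans)
  qed
  text \<open>A maximal set of successively removed low-degree vertices; it never reaches size \<open>q\<close>.\<close>
  define ok where "ok W \<longleftrightarrow> W \<subseteq> set I \<and> card W \<le> q \<and> W \<subseteq> low W" for W
  have ok0: "ok {}" by (simp add: ok_def)
  have bdd: "ok W \<Longrightarrow> card W \<le> q" for W by (simp add: ok_def)
  obtain W where W: "ok W" "\<And>W'. ok W' \<Longrightarrow> card W' \<le> card W"
    using ex_has_greatest_nat[of ok "{}" card "Suc q"] ok0 bdd by (metis le_imp_less_Suc)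
  have finW: "finite W" using W(1) finite_subset by (auto simp: ok_def)
  have "card W < q"
  proof (rule ccontr)
    assume "\<not> card W < q"
    then have cq: "card W = q" using bdd[OF W(1)] by simp
    have "real q * m \<le> 12 * (\<eta> * n)\<^sup>2"
      using lowcard[of W W] W(1) cq finW by (simp add: ok_def)
    then show False using big unfolding q_def by linarith
  qed
  then have closed: "low W \<inter> set I \<subseteq> W"
  proof (intro subsetI)
    fix x assume x: "x \<in> low W \<inter> set I" 
    show "x \<in> W"
    proof (rule ccontr)
      assume "x \<notin> W"
      have "ok (insert x W)"
        using x W(1) lowmono[of W "insert x W"] \<open>card W < q\<close> finW by (auto simp: ok_def card_insert_if)
      then have "card (insert x W) \<le> card W" by (rule W(2))
      then show False using \<open>x \<notin> W\<close> finW by simp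
    qed
  qed
  show thesis
  proof (rule that[of "U W"])
    show "U W \<subseteq> set I - {hd I, last I}" by (rule Usub)
    show "real (card {x \<in> V. real (card (nbr E x \<inter> U W)) < d * real m / (2 * n)}) * m \<le> 12 * (\<eta> * n)\<^sup>2"
      using lowcard[of W "low W"] bdd[OF W(1)] finW by (simp add: low_def)
    fix x assume x: "x \<in> list_nbrs I (U W)"
    then obtain u where u: "u \<in> U W" "{u,x} \<in> path_edges I" by (auto simp: list_nbrs_def)
    have "x \<in> set I" using x list_nbrs_subset by fastforce
    moreover have "x \<notin> W" using u by (auto simp: U_def list_nbrs_def insert_commute)
    ultimately show "d * real m / (2 * n) \<le> card (nbr E x \<inter> U W)"
      using closed I(2) by (fastforce simp: low_def)
  qed
qed

end

section \<open>Unbroken blocks inside a rotated path\<close>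

lemma path_edge_at:
  assumes "distinct (X @ y # Z)" "{x,y} \<in> path_edges (X @ y # Z)"
  shows "(X \<noteq> [] \<and> x = last X) \<or> (Z \<noteq> [] \<and> x = hd Z)"
proof -
  have "{x,y} \<in> path_edges X \<or> {x,y} \<in> path_edges Z \<or> (X \<noteq> [] \<and> {x,y} = {last X, y}) \<or> (Z \<noteq> [] \<and> {x,y} = {y, hd Z})"
    using assms(2) by (cases "X = []"; cases "Z = []") (auto simp: path_edges_append path_edges_Cons)
  then show ?thesis
    using assms(1) path_edges_subset_set[of "{x,y}" X] path_edges_subset_set[of "{x,y}" Z]
    by (auto simp: doubleton_eq_iff)
qed

lemma path_edges_sublist:
  assumes "distinct Q" "distinct I" "I \<noteq> []" "set I \<subseteq> set Q" "path_edges I \<subseteq> path_edges Q"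
  shows "\<exists>X Y. Q = X @ I @ Y \<or> Q = X @ rev I @ Y"
  using assms(2-)
proof (induction I rule: path_edges.induct)
  case (1 x y I)
  then have xy: "{x,y} \<in> path_edges Q" and xI: "x \<notin> set (y # I)" by auto
  obtain X Y where "Q = X @ (y # I) @ Y \<or> Q = X @ rev (y # I) @ Y" using 1 by auto
  then show ?case
  proof
    assume Q: "Q = X @ (y # I) @ Y"
    then consider "X \<noteq> []" "x = last X" | "I @ Y \<noteq> []" "x = hd (I @ Y)"
      using path_edge_at[of X y "I @ Y" x] xy assms(1) by auto
    then show ?case
    proof cases
      case 1
      then have "Q = butlast X @ (x # y # I) @ Y" using Q by (metis append.assoc append_Cons append_Nil append_butlast_last_id)
      then show ?thesis by blast
    next
      case 2
      then have "I = []" using xI by (cases I) auto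
      then have "Q = X @ rev (x # y # I) @ tl Y" using Q 2 by (cases Y) auto
      then show ?thesis by blast
    qed
  next
    assume Q: "Q = X @ rev (y # I) @ Y"
    then consider "X @ rev I \<noteq> []" "x = last (X @ rev I)" | "Y \<noteq> []" "x = hd Y"
      using path_edge_at[of "X @ rev I" y Y x] xy assms(1) by auto
    then show ?case
    proof cases
      case 1
      then have I: "I = []" using xI by (cases I) auto
      then have "Q = butlast X @ (x # y # I) @ Y" using Q 1 append_butlast_last_id[of X] by (metis append.assoc append_Cons append_Nil append_Nil2 rev.simps)
      then show ?thesis by blast
    next
      case 2
      then have "Q = X @ rev (x # y # I) @ tl Y" using Q by (cases Y) auto
      then show ?thesis by blast
    qed
  qed
next
  case ("2_2" v)
  then obtain X Y where "Q = X @ v # Y" by (meson list.set_intros(1) split_list subsetD)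
  then have "Q = X @ [v] @ Y" by simp
  then show ?case by blast
qed auto

lemma disjoint_blocks_order:
  assumes eq: "X @ I @ Y = X2 @ J @ Y2" and dis: "set I \<inter> set J = {}" and ne: "I \<noteq> []" "J \<noteq> []"
  shows "(\<exists>B. X2 = X @ I @ B \<and> Y = B @ J @ Y2) \<or> (\<exists>B. X = X2 @ J @ B \<and> Y2 = B @ I @ Y)"
proof -
  have nohd: "False" if "vs \<noteq> []" "vs @ U = I @ W" "set vs \<subseteq> set J" for vs U W
    using that ne dis by (cases vs; cases I) auto
  have nohd': "False" if "vs \<noteq> []" "vs @ U = J @ W" "set vs \<subseteq> set I" for vs U W
    using that ne dis by (cases vs; cases J) auto
  from eq obtain us where "(X = X2 @ us \<and> us @ I @ Y = J @ Y2) \<or> (X @ us = X2 \<and> I @ Y = us @ J @ Y2)"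
    unfolding append_eq_append_conv2 by blast
  then show ?thesis
  proof (elim disjE conjE)
    assume a: "X = X2 @ us" "us @ I @ Y = J @ Y2"
    then obtain vs where "(us = J @ vs \<and> vs @ I @ Y = Y2) \<or> (us @ vs = J \<and> I @ Y = vs @ Y2)"
      unfolding append_eq_append_conv2[of us "I @ Y"] by blast
    then show ?thesis
    proof (elim disjE conjE)
      assume "us @ vs = J" "I @ Y = vs @ Y2"
      moreover from this have "vs = []" using nohd[of vs Y2 Y] by (metis Un_upper2 set_append)
      ultimately show ?thesis using a by auto
    qed (use a in auto)
  next
    assume a: "X @ us = X2" "I @ Y = us @ J @ Y2"
    then obtain vs where "(I = us @ vs \<and> vs @ Y = J @ Y2) \<or> (I @ vs = us \<and> Y = vs @ J @ Y2)"
      unfolding append_eq_append_conv2[of I Y] by blast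
    then show ?thesis
    proof (elim disjE conjE)
      assume "I = us @ vs" "vs @ Y = J @ Y2"
      moreover from this have "vs = []" using nohd'[of vs Y Y2] by auto
      ultimately show ?thesis using a by auto
    qed (use a in auto)
  qed
qed

text \<open>The last set depends on \<open>L\<close> and \<open>R\<close> only through their inner
  end vertices. Rotations of the outer ends preserve these, so the middle part of the path stays the
  same.\<close>

lemma path_edges_three:
  assumes "L \<noteq> []" "R \<noteq> []"
  shows "path_edges (L @ B @ R) = path_edges L \<union> path_edges R \<union> path_edges (last L # B @ [hd R])"
proof (cases "B = []")
  case True
  then show ?thesis using assms by (auto simp: path_edges_append)
next
  case False
  then show ?thesis using assms by (auto simp: path_edges_append path_edges_Cons)
qed

lemma list_nbrs_append_interior:
  assumes d: "distinct (X @ I)" and U: "U \<subseteq> set I - {hd I, last I}"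
  shows "list_nbrs (X @ I) U \<subseteq> list_nbrs I U"
proof
  fix v assume "v \<in> list_nbrs (X @ I) U"
  then obtain u where u: "u \<in> U" "{u,v} \<in> path_edges (X @ I)" by (auto simp: list_nbrs_def)
  have uI: "u \<in> set I" "u \<noteq> hd I" "u \<notin> set X" using u U d by auto
  have "{u,v} \<in> path_edges I"
  proof (cases "X = []")
    case False
    have "I \<noteq> []" using uI by auto
    then have "{u,v} = {last X, hd I} \<or> {u,v} \<in> path_edges X \<or> {u,v} \<in> path_edges I"
      using u(2) False by (simp add: path_edges_append)
    moreover have "u \<noteq> last X" using uI False by auto
    ultimately show ?thesis using uI path_edges_subset_set[of "{u,v}" X] by (auto simp: doubleton_eq_iff)
  qed (use u in auto)
  then show "v \<in> list_nbrs I U" using u by (auto simp: list_nbrs_def)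
qed

lemma list_nbrs_rev [simp]: "list_nbrs (rev I) U = list_nbrs I U"
  by (simp add: list_nbrs_def)

definition block :: "nat \<Rightarrow> 'a list \<Rightarrow> nat \<Rightarrow> 'a list" where
  "block m P i = take m (drop (i * m) P)"

lemma block_props:
  assumes d: "distinct P" and le: "K * m \<le> length P" and i: "i < K"
  shows "distinct (block m P i)" "length (block m P i) = m" "set (block m P i) \<subseteq> set P"
    "path_edges (block m P i) \<subseteq> path_edges P"
proof -
  have "i * m + m \<le> K * m" using i by (metis add.commute mult_Suc mult_le_mono1 Suc_leI)
  then show "length (block m P i) = m" using le by (simp add: block_def)
  show "distinct (block m P i)" using d by (simp add: block_def)
  show "set (block m P i) \<subseteq> set P" unfolding block_def by (meson order_trans set_drop_subset set_take_subset)
  have "path_edges (take m (drop (i * m) P)) \<subseteq> path_edges (drop (i * m) P)"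
    using path_edges_append_subset(1)[of "take m (drop (i * m) P)" "drop m (drop (i * m) P)"]
    by (simp only: append_take_drop_id)
  also have "\<dots> \<subseteq> path_edges P"
    using path_edges_append_subset(2)[of "drop (i * m) P" "take (i * m) P"] by (simp only: append_take_drop_id)
  finally show "path_edges (block m P i) \<subseteq> path_edges P" by (simp add: block_def)
qed

lemma blocks_disjoint:
  assumes d: "distinct P" and "i \<noteq> j"
  shows "set (block m P i) \<inter> set (block m P j) = {}"
proof -
  have pos: "\<exists>k. k < length P \<and> P ! k = x \<and> i * m \<le> k \<and> k < i * m + m" if "x \<in> set (block m P i)" for x i
  proof -
    from that obtain l where "l < length (block m P i)" "block m P i ! l = x" by (auto simp: in_set_conv_nth)
    then show ?thesis by (intro exI[of _ "i * m + l"]) (auto simp: block_def)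
  qed
  have "i = j" if xi: "x \<in> set (block m P i)" and xj: "x \<in> set (block m P j)" for x
  proof -
    obtain k where k: "k < length P" "P ! k = x" "i * m \<le> k" "k < i * m + m" using pos[OF xi] by blast
    obtain l where l: "l < length P" "P ! l = x" "j * m \<le> l" "l < j * m + m" using pos[OF xj] by blast
    have "k = l" using k l d nth_eq_iff_index_eq by metis
    moreover have "k div m = i" using k by (intro div_nat_eqI) (auto simp: mult.commute)
    moreover have "l div m = j" using l by (intro div_nat_eqI) (auto simp: mult.commute)
    ultimately show ?thesis by simp
  qed
  then show ?thesis using assms by blast
qed

text \<open>Blocks are disjoint, so each broken block can be charged to a missing edge of its
  own.\<close>

lemma card_broken_blocks:
  assumes d: "distinct P" and le: "K * m \<le> length P"
  shows "card {i. i < K \<and> \<not> path_edges (block m P i) \<subseteq> F} \<le> card (path_edges P - F)"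
proof -
  let ?B = "{i. i < K \<and> \<not> path_edges (block m P i) \<subseteq> F}"
  have "\<forall>i\<in>?B. \<exists>e. e \<in> path_edges (block m P i) \<and> e \<notin> F" by blast
  then obtain f where f: "\<And>i. i \<in> ?B \<Longrightarrow> f i \<in> path_edges (block m P i) \<and> f i \<notin> F" by metis
  show ?thesis
  proof (rule card_inj_on_le[of f])
    show "inj_on f ?B"
    proof (rule inj_onI)
      fix i j assume ij: "i \<in> ?B" "j \<in> ?B" "f i = f j"
      have "f i \<subseteq> set (block m P i)" "f i \<subseteq> set (block m P j)"
        using f[OF ij(1)] f[OF ij(2)] ij(3) path_edges_subset_set by fastforce+
      moreover have "f i \<noteq> {}" using f[OF ij(1)] by (auto simp: path_edges_conv_nth)
      ultimately show "i = j" using blocks_disjoint[OF d, of i j m] by blast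
    qed
    show "f ` ?B \<subseteq> path_edges P - F"
    proof
      fix e assume "e \<in> f ` ?B"
      then obtain i where i: "i \<in> ?B" "e = f i" by blast
      then show "e \<in> path_edges P - F" using f[OF i(1)] block_props(4)[OF d le, of i] by blast
    qed
  qed simp
qed

lemma few_memberships:
  fixes K T :: nat
  assumes A: "finite A" and s: "(\<Sum>i<K. card (low i)) < T * card A" and fl: "\<And>i. finite (low i)"
  shows "\<exists>a\<in>A. card {i. i < K \<and> a \<in> low i} \<le> T"
proof (rule ccontr)
  assume "\<not> ?thesis"
  then have gt: "T \<le> card {i. i < K \<and> a \<in> low i}" if "a \<in> A" for a using that by force
  have "T * card A \<le> (\<Sum>a\<in>A. card {i. i < K \<and> a \<in> low i})"
    using sum_mono[of A "\<lambda>_. T"] gt by (simp add: mult.commute)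
  also have "\<dots> = (\<Sum>a\<in>A. \<Sum>i<K. of_bool (a \<in> low i))"
    by (intro sum.cong refl) (simp add: sum.If_cases of_bool_def Int_def)
  also have "\<dots> = (\<Sum>i<K. \<Sum>a\<in>A. of_bool (a \<in> low i))" by (rule sum.swap)
  also have "\<dots> = (\<Sum>i<K. card (A \<inter> low i))"
    by (intro sum.cong refl) (simp add: sum.If_cases of_bool_def A Int_def)
  also have "\<dots> \<le> (\<Sum>i<K. card (low i))" by (intro sum_mono card_mono fl) auto
  finally show False using s by simp
qed

subsection \<open>Closing a Hamilton path of the complete graph\<close>

context mixing_graph
begin

text \<open>With all vertices as pivots every degree is \<open>d\<close>, so the growth bound holds
  with \<gamma> = 1, and \<open>T\<close> doublings would exceed \<open>n\<close>. The 7 in place of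
  6 absorbs 3 \<eta>. A positive proportion of ends is what the averaging over blocks needs.\<close>

lemma full_rotation_ends:
  assumes P: "distinct P" "set P = V" and n: "n > 0" and T: "real n \<le> 2 ^ T" and e: "\<eta> \<le> 1/40"
  shows "n \<le> 7 * card (rot_ends E P V T)"
proof -
  have P0: "P \<noteq> []" using P n by auto
  have "(2::real) ^ T \<le> real (card (rot_ends E P V T)) \<or> n * (1 - 3 * \<eta>) / 6 \<le> card (rot_ends E P V T)"
  proof (rule rot_ends_growth[OF P(1) P0])
    fix x assume "x \<in> insert (hd P) (list_nbrs P V)"
    then have "x \<in> V" using P P0 list_nbrs_subset[of P V] by auto
    then show "1 * real d \<le> real (card (nbr E x \<inter> V))"
      using regular nbr_subset by (simp add: Int_absorb2)
  qed (use P e in auto)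
  moreover have "real n / 7 \<le> n * (1 - 3 * \<eta>) / 6"
    using e mult_left_mono[of "6/7" "1 - 3 * \<eta>" "real n"] by simp
  ultimately have "real n \<le> 7 * real (card (rot_ends E P V T))" using T by linarith
  then show ?thesis by linarith
qed

lemma block_rotation_ends:
  assumes L: "distinct (X @ I')" "set (X @ I') \<subseteq> V" and I': "I' = I \<or> I' = rev I"
    and m: "m = length I" "m > 0" "24 * \<eta> * n < m" and T: "real n \<le> 2 ^ T"
    and U: "U \<subseteq> set I - {hd I, last I}"
    and degU: "\<And>x. x \<in> list_nbrs I U \<Longrightarrow> d * real m / (2 * n) \<le> card (nbr E x \<inter> U)"
    and deg0: "d * real m / (2 * n) \<le> card (nbr E (hd (X @ I')) \<inter> U)"
  shows "m \<le> 16 * card (rot_ends E (X @ I') U T)"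
proof -
  have I: "I \<noteq> []" "distinct I" "set I \<subseteq> V" using m I' L by auto
  have mn: "m \<le> n" using I finV distinct_card[OF I(2)] card_mono m by metis
  have n: "n > 0" using mn m(2) by linarith
  have U': "U \<subseteq> set I' - {hd I', last I'}" using U I' I by (auto simp: hd_rev last_rev)
  have nb: "list_nbrs (X @ I') U \<subseteq> list_nbrs I U"
    using list_nbrs_append_interior[OF L(1) U'] I' by auto
  let ?g = "real m / (2 * n)"
  \<comment> \<open>n (m/(2n) - 3 \<eta>)/6 = m/12 - \<eta> n/2, and \<eta> n < m/24, so at least
    m/12 - m/48 = m/16 remains.\<close>
  have g: "n * (?g - 3 * \<eta>) / 6 \<ge> real m / 16" using n m by (simp add: field_simps)
  have g0: "?g > 3 * \<eta>"
  proof -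
    have "0 < \<eta> * n" using eta_pos n by simp
    then have "6 * \<eta> * n < m" using m by linarith
    then show ?thesis using n by (simp add: field_simps)
  qed
  have "(2::real) ^ T \<le> real (card (rot_ends E (X @ I') U T)) \<or> n * (?g - 3 * \<eta>) / 6 \<le> card (rot_ends E (X @ I') U T)"
  proof (rule rot_ends_growth[OF L(1) _ L(2) _ g0])
    show "X @ I' \<noteq> []" using I I' by auto
    show "U \<subseteq> set (X @ I')" using U I' by auto
    fix x assume "x \<in> insert (hd (X @ I')) (list_nbrs (X @ I') U)"
    then show "?g * d \<le> card (nbr E x \<inter> U)" using deg0 degU nb by (auto simp: mult.commute)
  qed
  then have "real m \<le> 16 * real (card (rot_ends E (X @ I') U T))"
    using g T mn by linarith
  then show ?thesis by linarith
qed

text \<open>Rotations of the whole path reach many left ends, but the right ends then reachable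
  depend on which left end was chosen, so the two sets cannot be compared by mixing. Confining the
  final rotations to two disjoint segments makes the choices independent. The budget 4 T is T
  rotations to fix each of the ends \<open>a\<close> and \<open>b\<close>, then T more on each
  side.\<close>

lemma close_path:
  assumes P: "distinct P" "set P = V" and T: "real n \<le> 2 ^ T" "T \<ge> 1" and e: "\<eta> \<le> 1/40"
    and m: "m = n div (10 * T)" "m \<ge> 32" "24 * \<eta> * n < m"
  shows "\<exists>P'. distinct P' \<and> set P' = V \<and> {last P', hd P'} \<in> E \<and> path_edges P' - path_edges P \<subseteq> E
    \<and> card (path_edges P - path_edges P') \<le> 4 * T"
proof -
  define K where "K = 10 * T"
  have Km: "K * m \<le> length P" using m distinct_card[OF P(1)] P(2) by (simp add: K_def)
  have n: "n > 0" using m by (cases n) auto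
  have big: "12 * (\<eta> * n)\<^sup>2 < real (m div 16) * real m"
  proof -
    have "(24 * \<eta> * n)\<^sup>2 < (real m)\<^sup>2" using m eta_pos by (intro power_strict_mono) auto
    then have "576 * (\<eta> * n)\<^sup>2 < (real m)\<^sup>2" by (simp add: power_mult_distrib)
    moreover have "real m \<le> 32 * real (m div 16)" using m(2) by linarith
    then have "real m * real m \<le> 32 * real (m div 16) * real m" by (intro mult_right_mono) auto
    moreover have "(\<eta> * n)\<^sup>2 \<ge> 0" by simp
    ultimately show ?thesis unfolding power2_eq_square by linarith
  qed
  note bp = block_props[OF P(1) Km]
  define core where "core i U \<longleftrightarrow> U \<subseteq> set (block m P i) - {hd (block m P i), last (block m P i)} \<and>
      (\<forall>x\<in>list_nbrs (block m P i) U. d * real m / (2 * n) \<le> card (nbr E x \<inter> U)) \<and>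
      real (card {x \<in> V. real (card (nbr E x \<inter> U)) < d * real m / (2 * n)}) * m \<le> 12 * (\<eta> * n)\<^sup>2" for i U
  have "\<exists>U. core i U" if i: "i < K" for i
  proof -
    have sub: "set (block m P i) \<subseteq> V" and len: "m = length (block m P i)" using bp(2,3)[OF i] P(2) by auto
    show ?thesis
    proof (rule block_core[OF bp(1)[OF i] sub len m(2) big])
      fix W assume "W \<subseteq> set (block m P i) - {hd (block m P i), last (block m P i)}"
        "\<And>x. x \<in> list_nbrs (block m P i) W \<Longrightarrow> d * real m / (2 * n) \<le> card (nbr E x \<inter> W)"
        "real (card {x \<in> V. real (card (nbr E x \<inter> W)) < d * real m / (2 * n)}) * m \<le> 12 * (\<eta> * n)\<^sup>2"
      then have "core i W" unfolding core_def by simp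
      then show ?thesis ..
    qed
  qed
  then obtain U where U: "\<And>i. i < K \<Longrightarrow> core i (U i)" by metis
  define low where "low i = {x \<in> V. real (card (nbr E x \<inter> U i)) < d * real m / (2 * n)}" for i
  have finlow: "finite (low i)" for i using finV by (simp add: low_def)
  \<comment> \<open>There are 10 T blocks, each with at most 12 (\<eta> n)^2 / m exceptional
    vertices. As 24 \<eta> n < m, the total is below 5 \<eta> n T, and 5 \<eta> <= 1/8 < 1/7. So
    some vertex among n/7 candidates is exceptional for at most T blocks.\<close>
  have few: "(\<Sum>i<K. card (low i)) < T * card A" if "n \<le> 7 * card A" for A
  proof -
    have "real (\<Sum>i<K. card (low i)) * m = (\<Sum>i<K. card (low i) * real m)" by (simp add: sum_distrib_right)
    also have "\<dots> \<le> (\<Sum>i<K. 12 * (\<eta> * n)\<^sup>2)" by (rule sum_mono) (use U in \<open>auto simp: core_def low_def\<close>)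
    also have "\<dots> = 120 * T * (\<eta> * n)\<^sup>2" by (simp add: K_def)
    also have "\<dots> = T * (5 * \<eta> * n * (24 * \<eta> * n))" by (simp add: power2_eq_square)
    also have "\<dots> < T * (5 * \<eta> * n * real m)"
      using m(3) T eta_pos n by (intro mult_strict_left_mono) auto
    also have "\<dots> \<le> T * ((real n / 7) * real m)"
      using e n by (intro mult_left_mono mult_right_mono) auto
    also have "\<dots> \<le> T * (real (card A) * real m)"
      using that by (intro mult_left_mono mult_right_mono) auto
    finally have "real (\<Sum>i<K. card (low i)) * m < real (T * card A) * m" by (simp add: mult_ac)
    then have "real (\<Sum>i<K. card (low i)) < real (T * card A)" by (rule mult_right_less_imp_less) simp
    then show ?thesis by (simp only: of_nat_less_iff)
  qed
  have P0: "P \<noteq> []" using P n by auto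
  define A where "A = rot_ends E P V T"
  have "finite A" using finite_subset[OF rot_ends_subset[OF P(1) P0]] by (simp add: A_def)
  then obtain a where a: "a \<in> A" "card {i. i < K \<and> a \<in> low i} \<le> T"
    using few_memberships[OF _ few finlow] full_rotation_ends[OF P n T(1) e] unfolding A_def by blast
  obtain Pa where Pa: "rotations E P V T Pa" "a = hd Pa" using a(1) by (auto simp: A_def rot_ends_def)
  note pa = rotations_props[OF Pa(1) P(1)]
  have Pa0: "Pa \<noteq> []" using pa P0 by auto
  have R: "distinct (rev Pa)" "set (rev Pa) = V" "rev Pa \<noteq> []" using pa P Pa0 by auto
  define B where "B = rot_ends E (rev Pa) V T"
  have "finite B" using finite_subset[OF rot_ends_subset[OF R(1,3)]] by (simp add: B_def)
  then obtain b where b: "b \<in> B" "card {i. i < K \<and> b \<in> low i} \<le> T"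
    using few_memberships[OF _ few finlow] full_rotation_ends[OF R(1,2) n T(1) e] unfolding B_def by blast
  obtain Q where Q: "rotations E (rev Pa) V T Q" "b = hd Q" using b(1) by (auto simp: B_def rot_ends_def)
  note qq = rotations_props[OF Q(1) R(1)]
  have Q0: "Q \<noteq> []" using qq R by auto
  have Qd: "distinct Q" "set Q = V" "last Q = a" using qq R Pa(2) Pa0 by (auto simp: last_rev)
  have QE: "path_edges Q - path_edges P \<subseteq> E" using qq pa by auto
  have Qc: "card (path_edges P - path_edges Q) \<le> 2 * T"
  proof -
    have "card (path_edges P - path_edges Q) \<le> card ((path_edges P - path_edges Pa) \<union> (path_edges Pa - path_edges Q))"
      by (intro card_mono) auto
    also have "\<dots> \<le> card (path_edges P - path_edges Pa) + card (path_edges Pa - path_edges Q)" by (rule card_Un_le)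
    finally show ?thesis using pa qq by simp
  qed
  define br where "br = {i. i < K \<and> \<not> path_edges (block m P i) \<subseteq> path_edges Q}"
  \<comment> \<open>Of the 10 T blocks, at most 2 T were broken by the rotations and at most T are
    lost for each of \<open>a\<close> and \<open>b\<close>, so at least two remain.\<close>
  define good where "good = {..<K} - br - {i. i < K \<and> a \<in> low i} - {i. i < K \<and> b \<in> low i}"
  have brc: "card br \<le> 2 * T" using card_broken_blocks[OF P(1) Km, of "path_edges Q"] Qc by (simp add: br_def)
  have "K \<le> card (good \<union> br \<union> {i. i < K \<and> a \<in> low i} \<union> {i. i < K \<and> b \<in> low i})"
    using card_mono[of "good \<union> br \<union> {i. i < K \<and> a \<in> low i} \<union> {i. i < K \<and> b \<in> low i}" "{..<K}"]
    by (auto simp: good_def br_def)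
  also have "\<dots> \<le> card good + card br + card {i. i < K \<and> a \<in> low i} + card {i. i < K \<and> b \<in> low i}"
    by (meson card_Un_le add_le_mono1 le_trans)
  finally have "2 \<le> card good" using brc a(2) b(2) T(2) by (simp add: K_def)
  then obtain i j where ij: "i \<in> good" "j \<in> good" "i \<noteq> j"
    by (metis One_nat_def card_le_Suc0_iff_eq finite_Diff finite_lessThan good_def not_less_eq_eq numeral_2_eq_2)
  have goodD: "i < K" "path_edges (block m P i) \<subseteq> path_edges Q" "a \<notin> low i" "b \<notin> low i" if "i \<in> good" for i
    using that by (auto simp: good_def br_def)
  have split: "\<exists>X I' Y. Q = X @ I' @ Y \<and> (I' = block m P i \<or> I' = rev (block m P i))" if "i \<in> good" for i
  proof -
    note g = goodD[OF that]
    have "block m P i \<noteq> []" using bp(2)[OF g(1)] m by auto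
    then show ?thesis
      using path_edges_sublist[OF Qd(1) bp(1)[OF g(1)] _ _ g(2)] bp(3)[OF g(1)] P Qd by blast
  qed
  have "\<exists>i j X I' B J' Y. i \<in> good \<and> j \<in> good \<and> Q = X @ I' @ B @ J' @ Y \<and>
      (I' = block m P i \<or> I' = rev (block m P i)) \<and> (J' = block m P j \<or> J' = rev (block m P j))"
  proof -
    obtain X I' Y where 1: "Q = X @ I' @ Y" "I' = block m P i \<or> I' = rev (block m P i)" using split[OF ij(1)] by blast
    obtain X2 J' Y2 where 2: "Q = X2 @ J' @ Y2" "J' = block m P j \<or> J' = rev (block m P j)" using split[OF ij(2)] by blast
    have dis: "set I' \<inter> set J' = {}" using blocks_disjoint[OF P(1) ij(3), of m] 1 2 by auto
    have ne: "I' \<noteq> []" "J' \<noteq> []" using 1 2 bp(2)[OF goodD(1)[OF ij(1)]] bp(2)[OF goodD(1)[OF ij(2)]] m by auto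
    have "X @ I' @ Y = X2 @ J' @ Y2" using 1 2 by simp
    from disjoint_blocks_order[OF this dis ne] show ?thesis
    proof (elim disjE exE conjE)
      fix C assume "X2 = X @ I' @ C" "Y = C @ J' @ Y2"
      then have "Q = X @ I' @ C @ J' @ Y2" using 1 by simp
      then show ?thesis using ij 1(2) 2(2) by blast
    next
      fix C assume "X = X2 @ J' @ C" "Y2 = C @ I' @ Y"
      then have "Q = X2 @ J' @ C @ I' @ Y" using 1 by simp
      then show ?thesis using ij 1(2) 2(2) by blast
    qed
  qed
  then obtain i j X I' C J' Y where S: "i \<in> good" "j \<in> good" "Q = X @ I' @ C @ J' @ Y"
    "I' = block m P i \<or> I' = rev (block m P i)" "J' = block m P j \<or> J' = rev (block m P j)" by blast
  note gi = goodD[OF S(1)] and gj = goodD[OF S(2)]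
  \<comment> \<open>\<open>Q\<close> is cut behind the first good block and before the second.
    \<open>L\<close> starts at \<open>b\<close>, and \<open>M\<close>, read backwards, starts at
    \<open>a\<close>; both are rotated at these outer ends with their inner ends fixed, so the
    middle \<open>C\<close> still joins them.\<close>
  define L where "L = X @ I'"
  define M where "M = rev Y @ rev J'"
  have ne: "I' \<noteq> []" "J' \<noteq> []" using S bp(2)[OF gi(1)] bp(2)[OF gj(1)] m by auto
  have QL: "Q = L @ C @ rev M" using S(3) by (simp add: L_def M_def)
  have LM0: "L \<noteq> []" "M \<noteq> []" using ne by (auto simp: L_def M_def)
  have dL: "distinct L" "set L \<subseteq> V" "distinct M" "set M \<subseteq> V" using Qd QL by auto
  have hL: "hd L = b" using Q(2) QL LM0 by simp
  have hM: "hd M = a" using Qd(3) QL LM0 by (simp add: last_rev)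
  note Ui = U[OF gi(1), unfolded core_def] and Uj = U[OF gj(1), unfolded core_def]
  have aV: "a \<in> V" "b \<in> V" using Qd Q0 Q(2) by auto
  have SL: "m \<le> 16 * card (rot_ends E L (U i) T)"
    unfolding L_def
  proof (rule block_rotation_ends[where I = "block m P i"])
    show "d * real m / (2 * n) \<le> card (nbr E (hd (X @ I')) \<inter> U i)"
      using hL gi(4) aV unfolding L_def by (simp add: low_def)
  qed (use dL S Ui bp(2)[OF gi(1)] m T in \<open>auto simp: L_def\<close>)
  have SM: "m \<le> 16 * card (rot_ends E M (U j) T)"
    unfolding M_def
  proof (rule block_rotation_ends[where I = "block m P j"])
    show "d * real m / (2 * n) \<le> card (nbr E (hd (rev Y @ rev J')) \<inter> U j)"
      using hM gj(3) aV unfolding M_def by (simp add: low_def)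
    show "rev J' = block m P j \<or> rev J' = rev (block m P j)" using S(5) by auto
  qed (use dL Uj bp(2)[OF gj(1)] m T in \<open>auto simp: M_def\<close>)
  have "(\<eta> * n)\<^sup>2 < real (card (rot_ends E L (U i) T)) * real (card (rot_ends E M (U j) T))"
  proof -
    have "\<eta> * n < real (card (rot_ends E L (U i) T))" "\<eta> * n < real (card (rot_ends E M (U j) T))"
      using SL SM m(3) eta_pos n mult_pos_pos[of \<eta> "real n"] by linarith+
    then show ?thesis unfolding power2_eq_square using eta_pos by (intro mult_strict_mono') auto
  qed
  then obtain x y where xy: "x \<in> rot_ends E L (U i) T" "y \<in> rot_ends E M (U j) T" "{x,y} \<in> E"
    using edge_between[of "rot_ends E L (U i) T" "rot_ends E M (U j) T"]
      rot_ends_subset[OF dL(1) LM0(1)] rot_ends_subset[OF dL(3) LM0(2)] dL by (metis order_trans)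
  obtain L' where L': "rotations E L (U i) T L'" "x = hd L'" using xy by (auto simp: rot_ends_def)
  obtain M' where M': "rotations E M (U j) T M'" "y = hd M'" using xy by (auto simp: rot_ends_def)
  note pl = rotations_props[OF L'(1) dL(1)] and pm = rotations_props[OF M'(1) dL(3)]
  have LM0': "L' \<noteq> []" "M' \<noteq> []" using pl pm LM0 by auto
  define P' where "P' = L' @ C @ rev M'"
  define J where "J = path_edges (last L # C @ [last M])"
  have eQ: "path_edges Q = path_edges L \<union> path_edges M \<union> J"
    unfolding QL J_def using path_edges_three[of L "rev M" C] LM0 by (simp add: hd_rev)
  have eP': "path_edges P' = path_edges L' \<union> path_edges M' \<union> J"
    unfolding P'_def J_def using path_edges_three[of L' "rev M'" C] LM0' LM0 pl pm by (simp add: hd_rev)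
  have "path_edges P - path_edges P' \<subseteq> (path_edges P - path_edges Q) \<union> ((path_edges L - path_edges L') \<union> (path_edges M - path_edges M'))"
    unfolding eQ eP' by auto
  then have "card (path_edges P - path_edges P') \<le> card ((path_edges P - path_edges Q) \<union> ((path_edges L - path_edges L') \<union> (path_edges M - path_edges M')))"
    by (intro card_mono) auto
  also have "\<dots> \<le> card (path_edges P - path_edges Q) + (card (path_edges L - path_edges L') + card (path_edges M - path_edges M'))"
    by (meson card_Un_le add_le_mono le_refl le_trans)
  also have "\<dots> \<le> 4 * T" using Qc pl pm by linarith
  finally have c: "card (path_edges P - path_edges P') \<le> 4 * T" .
  have "path_edges P' - path_edges Q \<subseteq> E" using pl pm unfolding eQ eP' by auto
  then have "path_edges P' - path_edges P \<subseteq> E" using QE by blast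
  moreover have "distinct P'" "set P' = V" using Qd pl pm unfolding QL P'_def by auto
  moreover have "last P' = y" "hd P' = x" using LM0' L' M' by (simp_all add: P'_def last_rev)
  ultimately show ?thesis using c xy(3) by (intro exI[of _ P']) (simp add: insert_commute)
qed

end

section \<open>Edges of closed walks, and swaps of adjacent blocks\<close>

lemma closed_walk_edges_path:
  assumes "H \<noteq> []"
  shows "closed_walk_edges H = insert {last H, hd H} (path_edges H)"
proof -
  let ?n = "length H"
  have n: "?n > 0" using assms by simp
  have "closed_walk_edges H = {{H ! i, H ! (Suc i mod ?n)} | i. Suc i < ?n} \<union> {{H ! (?n - 1), H ! (Suc (?n - 1) mod ?n)}}"
    (is "_ = ?A \<union> ?B")
  proof (intro equalityI subsetI)
    fix e assume "e \<in> closed_walk_edges H"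
    then obtain i where "i < ?n" "e = {H ! i, H ! (Suc i mod ?n)}" by (auto simp: closed_walk_edges_def)
    moreover from this have "Suc i < ?n \<or> i = ?n - 1" by auto
    ultimately show "e \<in> ?A \<union> ?B" by blast
  next
    fix e assume "e \<in> ?A \<union> ?B"
    then consider i where "Suc i < ?n" "e = {H ! i, H ! (Suc i mod ?n)}"
      | "e = {H ! (?n - 1), H ! (Suc (?n - 1) mod ?n)}" by blast
    then have "\<exists>i<?n. e = {H ! i, H ! (Suc i mod ?n)}"
    proof cases
      case 2
      then show ?thesis using n by (intro exI[of _ "?n - 1"]) simp
    qed (use Suc_lessD in blast)
    then show "e \<in> closed_walk_edges H" by (auto simp: closed_walk_edges_def)
  qed
  also have "?A = path_edges H" unfolding path_edges_conv_nth by (rule Collect_cong) (metis mod_less)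
  also have "?B = {{last H, hd H}}" using n by (simp add: last_conv_nth hd_conv_nth)
  finally show ?thesis by simp
qed

text \<open>The swap replaces three joints. Two of the removed ones are non-edges, and of the new
  ones only the joint from \<open>A\<close> to \<open>N\<close> may be a non-edge, so their number
  drops.\<close>

lemma swap_blocks:
  assumes d: "distinct (A @ M @ N @ B)" and ne: "A \<noteq> []" "M \<noteq> []" "N \<noteq> []" "B \<noteq> []"
    and bad: "{last A, hd M} \<notin> E" "{last M, hd N} \<notin> E"
    and good: "{last N, hd M} \<in> E" "{last M, hd B} \<in> E"
  shows "card (path_edges (A @ N @ M @ B) - E) < card (path_edges (A @ M @ N @ B) - E)"
    "card (path_edges (A @ M @ N @ B) - path_edges (A @ N @ M @ B)) \<le> 3"
proof -
  define R where "R = path_edges A \<union> path_edges M \<union> path_edges N \<union> path_edges B"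
  have e1: "path_edges (A @ M @ N @ B) = R \<union> {{last A, hd M}, {last M, hd N}, {last N, hd B}}"
    using ne by (auto simp: path_edges_append R_def)
  have e2: "path_edges (A @ N @ M @ B) = R \<union> {{last A, hd N}, {last N, hd M}, {last M, hd B}}"
    using ne by (auto simp: path_edges_append R_def)
  have mem: "last A \<in> set A" "hd M \<in> set M" "last M \<in> set M" "hd N \<in> set N" using ne by auto
  have n1: "{last A, hd M} \<notin> R" "{last M, hd N} \<notin> R"
    unfolding R_def using d mem by (auto dest!: path_edges_subset_set)
  have n2: "{last A, hd M} \<noteq> {last M, hd N}" using d mem by (auto simp: doubleton_eq_iff)
  have fR: "finite R" by (simp add: R_def)
  have "path_edges (A @ N @ M @ B) - E \<subseteq> insert {last A, hd N} (R - E)" unfolding e2 using good by auto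
  then have "card (path_edges (A @ N @ M @ B) - E) \<le> card (insert {last A, hd N} (R - E))"
    by (intro card_mono) (auto simp: fR)
  also have "\<dots> \<le> Suc (card (R - E))" using fR by (simp add: card_insert_if)
  also have "\<dots> < card (insert {last A, hd M} (insert {last M, hd N} (R - E)))"
    using fR n1 n2 by simp
  also have "\<dots> \<le> card (path_edges (A @ M @ N @ B) - E)"
  proof (rule card_mono)
    show "insert {last A, hd M} (insert {last M, hd N} (R - E)) \<subseteq> path_edges (A @ M @ N @ B) - E"
      using bad e1 by auto
  qed simp
  finally show "card (path_edges (A @ N @ M @ B) - E) < card (path_edges (A @ M @ N @ B) - E)" .
  have "path_edges (A @ M @ N @ B) - path_edges (A @ N @ M @ B) \<subseteq> set [{last A, hd M}, {last M, hd N}, {last N, hd B}]"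
    unfolding e1 e2 by auto
  then have "card (path_edges (A @ M @ N @ B) - path_edges (A @ N @ M @ B)) \<le> card (set [{last A, hd M}, {last M, hd N}, {last N, hd B}])"
    by (intro card_mono) auto
  also have "\<dots> \<le> 3" using card_length[of "[{last A, hd M}, {last M, hd N}, {last N, hd B}]"] by simp
  finally show "card (path_edges (A @ M @ N @ B) - path_edges (A @ N @ M @ B)) \<le> 3" .
qed

lemma split_at_nth:
  assumes "Suc i < length P"
  shows "P = take (Suc i) P @ drop (Suc i) P" "take (Suc i) P \<noteq> []" "drop (Suc i) P \<noteq> []"
    "last (take (Suc i) P) = P ! i" "hd (drop (Suc i) P) = P ! Suc i"
proof -
  show "last (take (Suc i) P) = P ! i" using assms by (simp add: take_Suc_conv_app_nth)
qed (use assms in \<open>auto simp: hd_drop_conv_nth\<close>)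

lemma split_card:
  fixes J :: "nat set"
  assumes "finite J" "p + q \<le> card J"
  obtains I1 I2 where "I1 \<subseteq> J" "I2 \<subseteq> J" "card I1 = p" "q \<le> card I2" "\<And>i j. i \<in> I1 \<Longrightarrow> j \<in> I2 \<Longrightarrow> i < j"
proof -
  let ?ys = "sorted_list_of_set J"
  have len: "length ?ys = card J" by simp
  have st: "sorted_wrt (<) ?ys" by simp
  show thesis
  proof (rule that[of "set (take p ?ys)" "set (drop p ?ys)"])
    show "set (take p ?ys) \<subseteq> J" "set (drop p ?ys) \<subseteq> J"
      using assms(1) set_take_subset[of p ?ys] set_drop_subset[of p ?ys] by auto
    show "card (set (take p ?ys)) = p" using assms len by (simp add: distinct_card)
    show "q \<le> card (set (drop p ?ys))" using assms len by (simp add: distinct_card)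
    fix i j assume "i \<in> set (take p ?ys)" "j \<in> set (drop p ?ys)"
    then show "i < j" using st sorted_wrt_append[of "(<)" "take p ?ys" "drop p ?ys"] by simp
  qed
qed

subsection \<open>Turning a linear forest into a Hamilton cycle\<close>

context mixing_graph
begin

text \<open>After closing the path by an edge of \<open>E\<close>, the cycle is cut at a remaining
  non-edge instead. Each round thus removes one non-edge and costs at most \<open>c\<close> edges
  plus the cut one; when no non-edge is left, the closed path is the required cycle.\<close>

lemma iterate_close:
  assumes close: "\<And>P. distinct P \<Longrightarrow> set P = V \<Longrightarrow> \<exists>P'. distinct P' \<and> set P' = V \<and> {last P', hd P'} \<in> E
      \<and> path_edges P' - path_edges P \<subseteq> E \<and> card (path_edges P - path_edges P') \<le> c"
    and n: "n > 0"
  shows "distinct P \<Longrightarrow> set P = V \<Longrightarrow> card (path_edges P - E) \<le> b \<Longrightarrow>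
    \<exists>H. distinct H \<and> set H = V \<and> closed_walk_edges H \<subseteq> E \<and> card (path_edges P - closed_walk_edges H) \<le> Suc b * Suc c"
proof (induction b arbitrary: P)
  case (0 P)
  then have PE: "path_edges P \<subseteq> E" by auto
  obtain P' where P': "distinct P'" "set P' = V" "{last P', hd P'} \<in> E"
    "path_edges P' - path_edges P \<subseteq> E" "card (path_edges P - path_edges P') \<le> c" using close[OF 0(1,2)] by blast
  have ne: "P' \<noteq> []" using P' n by auto
  have "closed_walk_edges P' \<subseteq> E" using P' PE by (auto simp: closed_walk_edges_path[OF ne])
  moreover have "card (path_edges P - closed_walk_edges P') \<le> card (path_edges P - path_edges P')"
    by (intro card_mono) (auto simp: closed_walk_edges_path[OF ne])
  ultimately show ?case using P' by (intro exI[of _ P']) auto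
next
  case (Suc b P)
  obtain P' where P': "distinct P'" "set P' = V" "{last P', hd P'} \<in> E"
    "path_edges P' - path_edges P \<subseteq> E" "card (path_edges P - path_edges P') \<le> c" using close[OF Suc(2,3)] by blast
  have ne: "P' \<noteq> []" using P' n by auto
  show ?case
  proof (cases "path_edges P' \<subseteq> E")
    case True
    then have "closed_walk_edges P' \<subseteq> E" using P' by (auto simp: closed_walk_edges_path[OF ne])
    moreover have "card (path_edges P - closed_walk_edges P') \<le> card (path_edges P - path_edges P')"
      by (intro card_mono) (auto simp: closed_walk_edges_path[OF ne])
    ultimately show ?thesis using P' by (intro exI[of _ P']) auto
  next
    case False
    then obtain e where e: "e \<in> path_edges P'" "e \<notin> E" by blast
    then obtain A B where AB: "P' = A @ B" "A \<noteq> []" "B \<noteq> []" "e = {last A, hd B}"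
      unfolding path_edges_iff_split by blast
    have eAB: "e \<notin> path_edges A" "e \<notin> path_edges B"
    proof -
      have "last A \<in> set A" "hd B \<in> set B" "set A \<inter> set B = {}" using AB P'(1) by auto
      then show "e \<notin> path_edges A" "e \<notin> path_edges B"
        unfolding AB(4) using path_edges_subset_set by blast+
    qed
    have pB: "path_edges (B @ A) = insert {last P', hd P'} (path_edges A \<union> path_edges B)"
      using AB by (auto simp: path_edges_append)
    have pP': "path_edges P' = insert e (path_edges A \<union> path_edges B)"
      using AB by (simp add: path_edges_append)
    have "path_edges (B @ A) - E \<subseteq> (path_edges P - E) - {e}"
      unfolding pB using P'(3,4) pP' eAB by auto
    then have "card (path_edges (B @ A) - E) \<le> card ((path_edges P - E) - {e})" by (intro card_mono) auto
    also have "\<dots> \<le> b" using Suc(4) e P'(4) by (subst card_Diff_singleton) auto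
    finally have bb: "card (path_edges (B @ A) - E) \<le> b" .
    have "distinct (B @ A)" "set (B @ A) = V" using P' AB by auto
    from Suc(1)[OF this bb] obtain H where H: "distinct H" "set H = V" "closed_walk_edges H \<subseteq> E"
      "card (path_edges (B @ A) - closed_walk_edges H) \<le> Suc b * Suc c" by blast
    have "path_edges P - closed_walk_edges H \<subseteq> (path_edges P - path_edges P') \<union> ({e} \<union> (path_edges (B @ A) - closed_walk_edges H))"
      unfolding pB pP' by auto
    then have "card (path_edges P - closed_walk_edges H) \<le> card ((path_edges P - path_edges P') \<union> ({e} \<union> (path_edges (B @ A) - closed_walk_edges H)))"
      by (intro card_mono) auto
    also have "\<dots> \<le> card (path_edges P - path_edges P') + (card {e} + card (path_edges (B @ A) - closed_walk_edges H))"
      by (meson card_Un_le add_le_mono le_refl le_trans)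
    also have "\<dots> \<le> Suc (Suc b) * Suc c" using P'(5) H(4) by simp
    finally show ?thesis using H by blast
  qed
qed

text \<open>\<open>M\<close> is the part of \<open>P1\<close> between two non-edges, and
  \<open>N\<close> reaches from the second non-edge to a cut in \<open>P2\<close>. The cut must be
  between a neighbour of the first vertex of \<open>M\<close> and a neighbour of the last one; with
  many non-edges to choose from, mixing leaves few cuts for which this fails.\<close>

lemma reduce_bad_split:
  fixes q :: nat
  assumes P: "distinct (P1 @ P2)" "set (P1 @ P2) = V" and q: "8 * \<eta>\<^sup>2 * n < q"
    and b: "2 * q \<le> card (path_edges P1 - E)" and P2: "n < 4 * (length P2 - 1)"
  shows "\<exists>P'. distinct P' \<and> set P' = V \<and> card (path_edges P' - E) < card (path_edges (P1 @ P2) - E)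
    \<and> card (path_edges (P1 @ P2) - path_edges P') \<le> 3"
proof -
  define J where "J = {i. Suc i < length P1 \<and> {P1 ! i, P1 ! Suc i} \<notin> E}"
  have finJ: "finite J" by (rule finite_subset[of _ "{..<length P1}"]) (auto simp: J_def)
  have "path_edges P1 - E = (\<lambda>i. {P1 ! i, P1 ! Suc i}) ` J" by (auto simp: path_edges_conv_nth J_def)
  then have "card (path_edges P1 - E) \<le> card J" using card_image_le[OF finJ] by simp
  then have "q + q \<le> card J" using b by simp
  \<comment> \<open>The left end of \<open>M\<close> is chosen among the earlier non-edges and its
    right end among the later ones, so that any two choices come in the right order.\<close>
  from split_card[OF finJ this] obtain I1 I2 where I: "I1 \<subseteq> J" "I2 \<subseteq> J" "card I1 = q" "q \<le> card I2"
    "\<And>i j. i \<in> I1 \<Longrightarrow> j \<in> I2 \<Longrightarrow> i < j" by blast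
  have lt: "Suc i < length P1" "i < length P1" if "i \<in> I1 \<or> i \<in> I2" for i using that I(1,2) by (auto simp: J_def)
  define X1 where "X1 = (\<lambda>i. P1 ! Suc i) ` I1"
  define X2 where "X2 = (\<lambda>j. P1 ! j) ` I2"
  have d1: "distinct P1" "distinct P2" using P by auto
  have q0: "q > 0" using q by (cases q) (auto simp: mult_less_0_iff not_less)
  have X1: "card X1 = q" unfolding X1_def using I(3) d1
    by (subst card_image) (auto simp: inj_on_def nth_eq_iff_index_eq lt)
  have X2: "q \<le> card X2" unfolding X2_def using I(4) d1
    by (subst card_image) (auto simp: inj_on_def nth_eq_iff_index_eq lt)
  have XV: "X1 \<subseteq> V" "X2 \<subseteq> V" using I P(2) by (auto simp: X1_def X2_def J_def dest!: subsetD)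
  define miss where "miss X = {v \<in> V. \<forall>x\<in>X. {x,v} \<notin> E}" for X
  have small: "8 * card (miss X) < n" if "X \<subseteq> V" "q \<le> card X" for X
  proof (rule ccontr)
    assume "\<not> ?thesis"
    then have "real n / 8 \<le> card (miss X)" by linarith
    have Xn: "X \<noteq> {}" using that q0 by auto
    then have n: "n > 0" using that finV by (auto simp: card_gt_0_iff)
    have "real q * (real n / 8) \<le> card X * card (miss X)"
      using \<open>real n / 8 \<le> card (miss X)\<close> that(2) by (simp only: of_nat_mult) (intro mult_mono, auto)
    also have "\<dots> \<le> (\<eta> * n)\<^sup>2" using missed_neighbours[OF that(1) Xn] by (simp add: miss_def)
    finally have "real q * real n \<le> (8 * \<eta>\<^sup>2 * n) * n" by (simp add: power2_eq_square mult_ac)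
    then have "real q \<le> 8 * \<eta>\<^sup>2 * n" by (rule mult_right_le_imp_le) (use n in simp)
    then show False using q by simp
  qed
  have finm: "finite (miss X)" for X using finV by (simp add: miss_def)
  \<comment> \<open>The unusable cut positions. A set of at least \<open>q\<close> vertices misses
    fewer than n/8 vertices because \<eta>^2 n^2 / q < n/8, so fewer than n/4 positions are excluded
    in total, and \<open>P2\<close> has more than that many.\<close>
  define b1 where "b1 = {k. Suc k < length P2 \<and> P2 ! k \<in> miss X1}"
  define b2 where "b2 = {k. Suc k < length P2 \<and> P2 ! Suc k \<in> miss X2}"
  have "card b1 \<le> card (miss X1)"
    by (rule card_inj_on_le[of "\<lambda>k. P2 ! k", OF _ _ finm]) (use d1 in \<open>auto simp: b1_def inj_on_def nth_eq_iff_index_eq\<close>)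
  moreover have "card b2 \<le> card (miss X2)"
    by (rule card_inj_on_le[of "\<lambda>k. P2 ! Suc k", OF _ _ finm]) (use d1 in \<open>auto simp: b2_def inj_on_def nth_eq_iff_index_eq\<close>)
  ultimately have "4 * (card b1 + card b2) < n" using small[OF XV(1)] small[OF XV(2)] X1 X2 by simp
  then have "4 * card (b1 \<union> b2) < n" by (rule le_less_trans[OF mult_le_mono2[OF card_Un_le]])
  then have "4 * card (b1 \<union> b2) < 4 * (length P2 - 1)" using P2 by (rule less_trans)
  then have "card (b1 \<union> b2) < length P2 - 1" by simp
  moreover have "{k. Suc k < length P2} = {..<length P2 - 1}" by auto
  ultimately have "card (b1 \<union> b2) < card {k. Suc k < length P2}" by simp
  moreover have "finite (b1 \<union> b2)" by (rule finite_subset[of _ "{..<length P2}"]) (auto simp: b1_def b2_def)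
  ultimately obtain k where k: "Suc k < length P2" "k \<notin> b1" "k \<notin> b2"
    by (metis (mono_tags, lifting) UnCI card_mono linorder_not_less mem_Collect_eq subsetI)
  have kV: "P2 ! k \<in> V" "P2 ! Suc k \<in> V" using k P(2) by auto
  obtain i where i: "i \<in> I1" "{P1 ! Suc i, P2 ! k} \<in> E" using k kV by (auto simp: b1_def miss_def X1_def)
  obtain j where j: "j \<in> I2" "{P1 ! j, P2 ! Suc k} \<in> E" using k kV by (auto simp: b2_def miss_def X2_def)
  have ij: "i < j" using I(5) i j by blast
  have iJ: "Suc i < length P1" "{P1 ! i, P1 ! Suc i} \<notin> E" and jJ: "Suc j < length P1" "{P1 ! j, P1 ! Suc j} \<notin> E"
    using i j I by (auto simp: J_def)
  note sj = split_at_nth[OF jJ(1)] and sk = split_at_nth[OF k(1)]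
  define Q where "Q = take (Suc j) P1"
  have Qi: "Suc i < length Q" "Q ! i = P1 ! i" "Q ! Suc i = P1 ! Suc i" using ij jJ by (auto simp: Q_def)
  note si = split_at_nth[OF Qi(1)]
  define A M N B where "A = take (Suc i) Q" and "M = drop (Suc i) Q"
    and "N = drop (Suc j) P1 @ take (Suc k) P2" and "B = drop (Suc k) P2"
  have eqP: "P1 @ P2 = A @ M @ N @ B"
  proof -
    have "Q = A @ M" using si(1) by (simp only: A_def M_def)
    moreover have "P1 = Q @ drop (Suc j) P1" using sj(1) by (simp only: Q_def)
    moreover have "P2 = take (Suc k) P2 @ B" using sk(1) by (simp only: B_def)
    ultimately show ?thesis unfolding N_def by (metis append.assoc)
  qed
  have nonempty: "A \<noteq> []" "M \<noteq> []" "N \<noteq> []" "B \<noteq> []" using si sj sk by (auto simp: A_def M_def N_def B_def)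
  have ends: "last A = P1 ! i" "hd M = P1 ! Suc i" "last M = P1 ! j" "hd N = P1 ! Suc j" "last N = P2 ! k" "hd B = P2 ! Suc k"
    using si sj sk Qi by (auto simp: A_def M_def N_def B_def Q_def last_drop)
  have dd: "distinct (A @ M @ N @ B)" using P(1) eqP by simp
  note sw = swap_blocks[OF dd nonempty, of E, unfolded ends, OF iJ(2) jJ(2)]
  have g: "{P2 ! k, P1 ! Suc i} \<in> E" using i(2) by (simp add: insert_commute)
  show ?thesis unfolding eqP
    using sw[OF g j(2)] dd P(2) eqP by (intro exI[of _ "A @ N @ M @ B"]) auto
qed

text \<open>Apart from the joint in the middle, one half of the path contains at least
  \<open>2 * q\<close> of the non-edges; reversing the path makes it the first half.\<close>

lemma reduce_bad:
  fixes q :: nat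
  assumes P: "distinct P" "set P = V" and q: "8 * \<eta>\<^sup>2 * n < q" and n: "n \<ge> 8"
    and b: "4 * q < card (path_edges P - E)"
  shows "\<exists>P'. distinct P' \<and> set P' = V \<and> card (path_edges P' - E) < card (path_edges P - E)
    \<and> card (path_edges P - path_edges P') \<le> 3"
proof -
  define P1 P2 where "P1 = take (n div 2) P" and "P2 = drop (n div 2) P"
  have PP: "P = P1 @ P2" by (simp add: P1_def P2_def)
  have len: "length P = n" using P distinct_card by metis
  have l: "length P1 = n div 2" "length P2 = n - n div 2" using len by (simp_all add: P1_def P2_def)
  have ne: "P1 \<noteq> []" "P2 \<noteq> []" using l n by auto
  have "path_edges P - E \<subseteq> insert {last P1, hd P2} ((path_edges P1 - E) \<union> (path_edges P2 - E))"
    unfolding PP path_edges_append[OF ne] by auto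
  then have "card (path_edges P - E) \<le> card (insert {last P1, hd P2} ((path_edges P1 - E) \<union> (path_edges P2 - E)))"
    by (intro card_mono) auto
  also have "\<dots> \<le> Suc (card ((path_edges P1 - E) \<union> (path_edges P2 - E)))" by (simp add: card_insert_if)
  also have "\<dots> \<le> Suc (card (path_edges P1 - E) + card (path_edges P2 - E))" using card_Un_le by simp
  finally have "4 * q \<le> card (path_edges P1 - E) + card (path_edges P2 - E)" using b by simp
  then consider "2 * q \<le> card (path_edges P1 - E)" | "2 * q \<le> card (path_edges (rev P2) - E)" by force
  then show ?thesis
  proof cases
    case 1
    then show ?thesis using reduce_bad_split[of P1 P2 q] P q n l unfolding PP by simp
  next
    case 2
    have "path_edges (rev P2 @ rev P1) = path_edges P" unfolding PP by (metis path_edges_rev rev_append)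
    then show ?thesis using reduce_bad_split[of "rev P2" "rev P1" q] P q n l 2 unfolding PP by (simp add: Un_commute Int_commute)
  qed
qed

lemma reduce_bad_iterate:
  fixes q :: nat
  assumes q: "8 * \<eta>\<^sup>2 * n < q" and n: "n \<ge> 8"
  shows "distinct P \<Longrightarrow> set P = V \<Longrightarrow> card (path_edges P - E) \<le> b \<Longrightarrow>
    \<exists>P'. distinct P' \<and> set P' = V \<and> card (path_edges P' - E) \<le> 4 * q \<and> card (path_edges P - path_edges P') \<le> 3 * b"
proof (induction b arbitrary: P)
  case 0
  then have "card (path_edges P - E) \<le> 4 * q" by linarith
  then show ?case using 0(1,2) by (intro exI[of _ P]) simp
next
  case (Suc b)
  show ?case
  proof (cases "4 * q < card (path_edges P - E)")
    case True
    obtain P' where P': "distinct P'" "set P' = V" "card (path_edges P' - E) < card (path_edges P - E)"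
      "card (path_edges P - path_edges P') \<le> 3"
      using reduce_bad[OF Suc(2,3) q n True] by (elim exE conjE) (rule that; assumption)
    have "card (path_edges P' - E) \<le> b" using P'(3) Suc(4) by linarith
    from Suc(1)[OF P'(1,2) this] obtain P'' where P'': "distinct P''" "set P'' = V" "card (path_edges P'' - E) \<le> 4 * q"
      "card (path_edges P' - path_edges P'') \<le> 3 * b"
      by (elim exE conjE) (rule that; assumption)
    have "card (path_edges P - path_edges P'') \<le> card ((path_edges P - path_edges P') \<union> (path_edges P' - path_edges P''))"
      by (intro card_mono) auto
    also have "\<dots> \<le> card (path_edges P - path_edges P') + card (path_edges P' - path_edges P'')" by (rule card_Un_le)
    finally show ?thesis using P'' P'(4) by (intro exI[of _ P'']) auto
  next
    case False
    then show ?thesis using Suc(2,3) by (intro exI[of _ P]) auto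
  qed
qed

lemma path_to_hamilton_cycle:
  fixes q :: nat
  assumes P: "distinct P" "set P = V" and T: "real n \<le> 2 ^ T" "T \<ge> 1" and e: "\<eta> \<le> 1/40"
    and m: "m = n div (10 * T)" "m \<ge> 32" "24 * \<eta> * n < m" and q: "8 * \<eta>\<^sup>2 * n < q"
    and b: "card (path_edges P - E) \<le> b"
  obtains H where "distinct H" "set H = V" "closed_walk_edges H \<subseteq> E"
    "card (path_edges P - closed_walk_edges H) \<le> 3 * b + (4 * q + 1) * (4 * T + 1)"
proof -
  have "m \<le> n" using m(1) by simp
  then have n: "n \<ge> 8" using m(2) by linarith
  obtain P' where P': "distinct P'" "set P' = V" "card (path_edges P' - E) \<le> 4 * q"
    "card (path_edges P - path_edges P') \<le> 3 * b" using reduce_bad_iterate[OF q n P b] by blast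
  have "n > 0" using n by simp
  from iterate_close[of "4 * T", OF close_path[OF _ _ T e m] this P'(1-3)]
  obtain H where H: "distinct H" "set H = V" "closed_walk_edges H \<subseteq> E"
    "card (path_edges P' - closed_walk_edges H) \<le> Suc (4 * q) * Suc (4 * T)" by blast
  have "card (path_edges P - closed_walk_edges H) \<le> card ((path_edges P - path_edges P') \<union> (path_edges P' - closed_walk_edges H))"
    by (intro card_mono) auto
  also have "\<dots> \<le> card (path_edges P - path_edges P') + card (path_edges P' - closed_walk_edges H)" by (rule card_Un_le)
  finally show thesis using that H P'(4) by simp
qed

end

section \<open>How many linear forests lead to the same Hamilton cycle\<close>

lemma list_arcs_conv_nth: "list_arcs xs = {(xs ! i, xs ! Suc i) | i. Suc i < length xs}"
proof (induction xs rule: list_arcs.induct)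
  case (1 x y xs)
  show ?case unfolding list_arcs.simps 1
  proof (intro equalityI subsetI)
    fix e assume "e \<in> insert (x,y) {((y # xs) ! i, (y # xs) ! Suc i) | i. Suc i < length (y # xs)}"
    then consider "e = (x,y)" | i where "e = ((y # xs) ! i, (y # xs) ! Suc i)" "Suc i < length (y # xs)" by auto
    then show "e \<in> {((x # y # xs) ! i, (x # y # xs) ! Suc i) | i. Suc i < length (x # y # xs)}"
    proof cases
      case 1
      then show ?thesis by (intro CollectI exI[of _ 0]) auto
    next
      case 2
      then show ?thesis by (intro CollectI exI[of _ "Suc i"]) auto
    qed
  next
    fix e assume "e \<in> {((x # y # xs) ! i, (x # y # xs) ! Suc i) | i. Suc i < length (x # y # xs)}"
    then obtain i where "e = ((x # y # xs) ! i, (x # y # xs) ! Suc i)" "Suc i < length (x # y # xs)" by auto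
    then show "e \<in> insert (x,y) {((y # xs) ! i, (y # xs) ! Suc i) | i. Suc i < length (y # xs)}"
      by (cases i) auto
  qed
qed auto

definition undirected :: "('a \<times> 'a) set \<Rightarrow> 'a set set" where
  "undirected D = (\<lambda>(u,v). {u,v}) ` D"

lemma undirectedI: "(x,y) \<in> D \<Longrightarrow> {x,y} \<in> undirected D"
  by (force simp: undirected_def)

lemma undirectedD: "{x,y} \<in> undirected D \<Longrightarrow> (x,y) \<in> D \<or> (y,x) \<in> D"
  by (auto simp: undirected_def doubleton_eq_iff)

text \<open>A linear forest is oriented uniquely by specifying which end of each path is terminal.\<close>
lemma orientation_subset:
  assumes P: "distinct P" "D \<subseteq> list_arcs P" and sv: "single_valued D'"
    and und: "undirected D = undirected D'" and dom: "Domain D = Domain D'"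
  shows "D \<subseteq> D'"
proof
  \<comment> \<open>A reversed arc would propagate along \<open>P\<close>: its head lies in
    \<open>Domain D'\<close>, hence in \<open>Domain D\<close>, so \<open>D\<close> has a next arc
    there, and single-valuedness of \<open>D'\<close> forces that arc to be reversed as well. At the
    end of \<open>P\<close> there is no next arc.\<close>
  have no: "(P ! Suc i, P ! i) \<notin> D'" if "Suc i < length P" "(P ! i, P ! Suc i) \<in> D" for i
    using that
  proof (induction "length P - i" arbitrary: i rule: less_induct)
    case less
    show ?case
    proof
      assume rev: "(P ! Suc i, P ! i) \<in> D'"
      then obtain z where z: "(P ! Suc i, z) \<in> D" using dom by blast
      then obtain j where j: "Suc j < length P" "P ! Suc i = P ! j" "z = P ! Suc j"
        using P(2) unfolding list_arcs_conv_nth by blast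
      then have ji: "j = Suc i" using P(1) less.prems by (simp add: nth_eq_iff_index_eq)
      have "z \<noteq> P ! i" using j ji P(1) by (simp add: nth_eq_iff_index_eq)
      then have "(P ! Suc i, z) \<notin> D'" using rev sv by (auto simp: single_valued_def)
      then have "(z, P ! Suc i) \<in> D'" using undirectedD[of "P ! Suc i" z D'] undirectedI[OF z] und by auto
      moreover have "(P ! Suc j, P ! j) \<notin> D'"
      proof (rule less.hyps)
        show "length P - j < length P - i" using ji less.prems(1) by linarith
        show "Suc j < length P" by (rule j(1))
        show "(P ! j, P ! Suc j) \<in> D" using z by (simp only: j(2,3))
      qed
      then have "(z, P ! Suc i) \<notin> D'" by (simp only: j(2,3) not_False_eq_True)
      ultimately show False by blast
    qed
  qed
  fix p assume "p \<in> D"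
  then obtain i where i: "Suc i < length P" "p = (P ! i, P ! Suc i)" using P(2) unfolding list_arcs_conv_nth by blast
  then show "p \<in> D'"
    using no[OF i(1)] undirectedD[of "P ! i" "P ! Suc i" D'] undirectedI[of "P ! i" "P ! Suc i" D] und \<open>p \<in> D\<close> by auto
qed

lemma card_small_subsets:
  assumes S: "finite S"
  shows "card {A. A \<subseteq> S \<and> card A \<le> j} \<le> (card S + 1) ^ j"
proof (induction j)
  case 0
  have "A = {}" if "A \<subseteq> S" "card A \<le> 0" for A using that finite_subset[OF that(1) S] by simp
  then have "{A. A \<subseteq> S \<and> card A \<le> 0} = {{}}" by auto
  then show ?case by simp
next
  case (Suc j)
  let ?F = "\<lambda>j. {A. A \<subseteq> S \<and> card A \<le> j}"
  let ?g = "\<lambda>(x, A). case x of None \<Rightarrow> A | Some a \<Rightarrow> insert a A"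
  have fF: "finite (?F i)" for i by (rule finite_subset[of _ "Pow S"]) (use S in auto)
  have "?F (Suc j) \<subseteq> ?g ` (insert None (Some ` S) \<times> ?F j)"
  proof
    fix A assume A: "A \<in> ?F (Suc j)"
    show "A \<in> ?g ` (insert None (Some ` S) \<times> ?F j)"
    proof (cases "A = {}")
      case True
      then show ?thesis by (intro image_eqI[of _ _ "(None, {})"]) auto
    next
      case False
      then obtain a where a: "a \<in> A" by blast
      have "finite A" using A S finite_subset by auto
      moreover have "card A \<le> Suc j" using A by simp
      ultimately have "card (A - {a}) \<le> j" using card_Diff_singleton[OF a] by simp
      then show ?thesis using A a by (intro image_eqI[of _ _ "(Some a, A - {a})"]) auto
    qed
  qed
  then have "card (?F (Suc j)) \<le> card (?g ` (insert None (Some ` S) \<times> ?F j))"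
    by (rule card_mono[rotated]) (use S fF in auto)
  also have "\<dots> \<le> card (insert None (Some ` S) \<times> ?F j)" by (rule card_image_le) (use S fF in auto)
  also have "\<dots> = (card S + 1) * card (?F j)"
    using S by (simp add: card_cartesian_product card_image)
  also have "\<dots> \<le> (card S + 1) * (card S + 1) ^ j" by (rule mult_left_mono[OF Suc]) simp
  finally show ?case by simp
qed

lemma card_small_subsets_le:
  assumes "finite S" "card S \<le> N"
  shows "card {A. A \<subseteq> S \<and> card A \<le> j} \<le> (N + 1) ^ j"
  using card_small_subsets[OF assms(1), of j] power_mono[of "card S + 1" "N + 1" j] assms(2) by simp

context mixing_graph
begin

lemma finite_E: "finite E"
  by (rule finite_subset[of _ "Pow V"]) (use simple finV in \<open>auto simp: simple_graph_on_def\<close>)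

lemma card_E: "card E \<le> n\<^sup>2"
proof -
  have "E \<subseteq> (\<lambda>(u,v). {u,v}) ` (V \<times> V)"
  proof
    fix e assume e: "e \<in> E"
    then have "card e = 2" "e \<subseteq> V" using simple by (auto simp: simple_graph_on_def)
    then show "e \<in> (\<lambda>(u,v). {u,v}) ` (V \<times> V)" by (auto simp: card_2_iff)
  qed
  then have "card E \<le> card ((\<lambda>(u,v). {u,v}) ` (V \<times> V))" by (rule card_mono[rotated]) (use finV in auto)
  also have "\<dots> \<le> card (V \<times> V)" by (rule card_image_le) (use finV in auto)
  finally show ?thesis by (simp add: card_cartesian_product power2_eq_square)
qed

lemma finite_hamilton_cycles: "finite (hamilton_cycles V E)"
  by (rule finite_subset[of _ "Pow E"]) (use finite_E in \<open>auto simp: hamilton_cycles_def\<close>)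

text \<open>A forest differs little from its cycle: at most \<open>k\<close> of its edges are lost
  and at most \<open>s + k\<close> are added. Together with at most \<open>s\<close> terminal
  vertices this encodes it by small subsets of sets with at most \<open>n\<^sup>2\<close> elements,
  which explains the exponent \<open>2 * (s + k)\<close>.\<close>

lemma linear_forests_le_hamilton_cycles:
  assumes H: "\<And>P. distinct P \<Longrightarrow> set P = V \<Longrightarrow> card (path_edges P - E) \<le> s \<Longrightarrow>
      \<exists>H. distinct H \<and> set H = V \<and> closed_walk_edges H \<subseteq> E \<and> card (path_edges P - closed_walk_edges H) \<le> k"
    and n: "n \<ge> 3" and s: "s \<le> n"
  shows "card (linear_forests V E (n - s)) \<le> num_hamilton_cycles V E * (n\<^sup>2 + 1) ^ (2 * (s + k))"
proof -
  let ?LF = "linear_forests V E (n - s)"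
  have "\<exists>C. C \<in> hamilton_cycles V E \<and> card C \<le> n \<and> card (undirected D - C) \<le> k \<and> card (C - undirected D) \<le> s + k"
    if D: "D \<in> ?LF" for D
  proof -
    obtain P where P: "D \<subseteq> graph_arcs E" "card D = n - s" "distinct P" "set P = V" "D \<subseteq> list_arcs P"
      using D by (auto simp: linear_forests_def)
    have UE: "undirected D \<subseteq> E" using P(1) by (auto simp: undirected_def graph_arcs_def)
    have UP: "undirected D \<subseteq> path_edges P" using P(5) by (auto simp: undirected_def path_edges_list_arcs)
    have inj: "inj_on (\<lambda>(u,v). {u,v}) D"
    proof (rule inj_onI, clarify)
      fix a b a' b' assume q: "(a,b) \<in> D" "(a',b') \<in> D" "{a,b} = {a',b'}"
      obtain i where i: "Suc i < length P" "a = P ! i" "b = P ! Suc i" using q(1) P(5) unfolding list_arcs_conv_nth by blast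
      obtain j where j: "Suc j < length P" "a' = P ! j" "b' = P ! Suc j" using q(2) P(5) unfolding list_arcs_conv_nth by blast
      have "\<not> (P ! i = P ! Suc j \<and> P ! Suc i = P ! j)"
        using i(1) j(1) P(3) by (simp add: nth_eq_iff_index_eq)
      then show "a = a' \<and> b = b'" using q(3) i j by (auto simp: doubleton_eq_iff)
    qed
    have cU: "card (undirected D) = n - s" unfolding undirected_def using card_image[OF inj] P(2) by simp
    have fU: "finite (undirected D)" using UE finite_E finite_subset by blast
    have cP: "card (path_edges P) = n - 1" using card_path_edges[OF P(3)] P(3,4) distinct_card by metis
    have "path_edges P - E \<subseteq> path_edges P - undirected D" using UE by blast
    then have "card (path_edges P - E) \<le> card (path_edges P - undirected D)" by (intro card_mono) auto
    also have "\<dots> = (n - 1) - (n - s)" using card_Diff_subset[OF fU UP] cU cP by simp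
    also have "\<dots> \<le> s" by simp
    finally obtain Q where Q: "distinct Q" "set Q = V" "closed_walk_edges Q \<subseteq> E" "card (path_edges P - closed_walk_edges Q) \<le> k"
      using H[OF P(3,4)] by blast
    let ?C = "closed_walk_edges Q"
    have lQ: "length Q = n" using Q distinct_card by metis
    have "?C = (\<lambda>i. {Q ! i, Q ! (Suc i mod length Q)}) ` {..<length Q}" by (auto simp: closed_walk_edges_def)
    then have cC: "card ?C \<le> n" and fC: "finite ?C" using card_image_le[of "{..<length Q}"] lQ by auto
    have "card (undirected D - ?C) \<le> card (path_edges P - ?C)" using UP by (intro card_mono) auto
    then have 1: "card (undirected D - ?C) \<le> k" using Q by simp
    have "card (undirected D) \<le> card (undirected D - ?C) + card (undirected D \<inter> ?C)"
      by (metis Un_Diff_Int card_Un_le)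
    moreover have "card (?C - undirected D) = card ?C - card (undirected D \<inter> ?C)"
      by (metis Int_commute card_Diff_subset_Int fC finite_Int)
    ultimately have 2: "card (?C - undirected D) \<le> s + k" using 1 cU cC by linarith
    have "?C \<in> hamilton_cycles V E" unfolding hamilton_cycles_def using Q lQ n by auto
    then show ?thesis using 1 2 cC by blast
  qed
  then obtain C where C: "\<And>D. D \<in> ?LF \<Longrightarrow> C D \<in> hamilton_cycles V E \<and> card (C D) \<le> n \<and>
      card (undirected D - C D) \<le> k \<and> card (C D - undirected D) \<le> s + k" by metis
  define HC where "HC = {C \<in> hamilton_cycles V E. card C \<le> n}"
  let ?T = "Sigma HC (\<lambda>C. {A. A \<subseteq> C \<and> card A \<le> s + k} \<times> ({A. A \<subseteq> E \<and> card A \<le> k} \<times> {A. A \<subseteq> V \<and> card A \<le> s}))"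
  \<comment> \<open>The cycle and the two differences determine the undirected edge set of
    \<open>D\<close>; the vertices without outgoing arc determine its orientation by
    \<open>orientation_subset\<close>.\<close>
  let ?f = "\<lambda>D. (C D, C D - undirected D, undirected D - C D, V - Domain D)"
  have finHC: "finite HC" using finite_hamilton_cycles by (simp add: HC_def)
  have finC: "finite C" if "C \<in> HC" for C using that finite_E finite_subset by (auto simp: HC_def hamilton_cycles_def)
  have finT: "finite ?T" using finHC finC finite_E finV by (auto intro!: finite_SigmaI)
  have "card ?LF \<le> card ?T"
  proof (rule card_inj_on_le[OF _ _ finT, of ?f])
    show "inj_on ?f ?LF"
    proof (rule inj_onI)
      fix D D' assume D: "D \<in> ?LF" "D' \<in> ?LF" and eq: "?f D = ?f D'"
      obtain P where P: "distinct P" "set P = V" "D \<subseteq> list_arcs P" using D(1) by (auto simp: linear_forests_def)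
      obtain P' where P': "distinct P'" "set P' = V" "D' \<subseteq> list_arcs P'" using D(2) by (auto simp: linear_forests_def)
      have "undirected D = (C D - (C D - undirected D)) \<union> (undirected D - C D)" by blast
      also have "\<dots> = (C D' - (C D' - undirected D')) \<union> (undirected D' - C D')"
      proof -
        note e = eq[unfolded prod.inject]
        show ?thesis
          unfolding e[THEN conjunct2, THEN conjunct1] e[THEN conjunct2, THEN conjunct2, THEN conjunct1]
          unfolding e[THEN conjunct1] ..
      qed
      also have "\<dots> = undirected D'" by blast
      finally have und: "undirected D = undirected D'" .
      have "Domain D \<subseteq> V" "Domain D' \<subseteq> V"
        using P P' list_arcs_subset[of P] list_arcs_subset[of P'] by auto
      then have dom: "Domain D = Domain D'" using eq by (metis Pair_inject double_diff order_refl)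
      have "single_valued D" "single_valued D'"
        using D linear_forests_partial by (auto simp: partial_cycles_def)
      then show "D = D'"
        using orientation_subset[OF P(1,3) _ und dom] orientation_subset[OF P'(1,3) _ und[symmetric] dom[symmetric]] by blast
    qed
    show "?f ` ?LF \<subseteq> ?T"
    proof (rule image_subsetI)
      fix D assume D: "D \<in> ?LF"
      have "undirected D \<subseteq> E" using D by (auto simp: linear_forests_def undirected_def graph_arcs_def)
      moreover have "card (V - Domain D) \<le> s"
        using free_ends(1)[of D "n - s"] D linear_forests_partial s by auto
      ultimately show "?f D \<in> ?T" using C[OF D] by (auto simp: HC_def)
    qed
  qed
  also have "card ?T = (\<Sum>C\<in>HC. card {A. A \<subseteq> C \<and> card A \<le> s + k} * (card {A. A \<subseteq> E \<and> card A \<le> k} * card {A. A \<subseteq> V \<and> card A \<le> s}))"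
    using finHC finC finite_E finV by (subst card_SigmaI) (auto simp: card_cartesian_product)
  also have "\<dots> \<le> (\<Sum>C\<in>HC. (n\<^sup>2 + 1) ^ (s + k) * ((n\<^sup>2 + 1) ^ k * (n\<^sup>2 + 1) ^ s))"
  proof (intro sum_mono mult_mono)
    have nn: "n \<le> n\<^sup>2" by (simp add: power2_eq_square)
    show "card {A. A \<subseteq> C \<and> card A \<le> s + k} \<le> (n\<^sup>2 + 1) ^ (s + k)" if "C \<in> HC" for C
    proof (rule card_small_subsets_le[OF finC[OF that]])
      show "card C \<le> n\<^sup>2" using that nn by (simp add: HC_def)
    qed
    show "card {A. A \<subseteq> E \<and> card A \<le> k} \<le> (n\<^sup>2 + 1) ^ k" by (rule card_small_subsets_le[OF finite_E card_E])
    show "card {A. A \<subseteq> V \<and> card A \<le> s} \<le> (n\<^sup>2 + 1) ^ s" by (rule card_small_subsets_le[OF finV nn])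
  qed auto
  also have "\<dots> = card HC * (n\<^sup>2 + 1) ^ (2 * (s + k))"
    by (simp add: mult_2 add_ac flip: power_add)
  also have "\<dots> \<le> num_hamilton_cycles V E * (n\<^sup>2 + 1) ^ (2 * (s + k))"
    unfolding num_hamilton_cycles_def HC_def
    by (intro mult_right_mono card_mono finite_hamilton_cycles) auto
  finally show ?thesis .
qed

end

section \<open>Two-sided bounds on the number of Hamilton cycles with free parameters\<close>

context mixing_graph
begin

lemma num_hamilton_cycles_lower:
  assumes s: "s \<le> n" and del: "\<delta> \<ge> 0" "\<delta> \<le> 1" and eta: "2 * \<eta> * n \<le> \<delta> * s"
    and T: "real n \<le> 2 ^ T" "T \<ge> 1" and e: "\<eta> \<le> 1/40"
    and m: "m = n div (10 * T)" "m \<ge> 32" "24 * \<eta> * n < m" and q: "8 * \<eta>\<^sup>2 * n < real q"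
    and k: "k = 3 * s + (4 * q + 1) * (4 * T + 1)"
  shows "(1 - \<delta>) ^ n * (d / n) ^ n * fact n \<le> num_hamilton_cycles V E * (real n ^ 2 + 1) ^ (3 * (s + k))"
proof -
  have "m \<le> n" using m(1) by simp
  then have n: "n \<ge> 3" "n > 0" using m(2) by linarith+
  have ham: "\<exists>H. distinct H \<and> set H = V \<and> closed_walk_edges H \<subseteq> E \<and> card (path_edges P - closed_walk_edges H) \<le> k"
    if "distinct P" "set P = V" "card (path_edges P - E) \<le> s" for P
    using path_to_hamilton_cycle[OF that(1,2) T e m q that(3)] unfolding k by metis
  let ?N = "real n ^ 2 + 1"
  have N1: "1 \<le> ?N" by simp
  have "real (card (linear_forests V E (n - s))) \<le> real (num_hamilton_cycles V E * (n\<^sup>2 + 1) ^ (2 * (s + k)))"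
    using linear_forests_le_hamilton_cycles[OF ham n(1) s] by (simp only: of_nat_le_iff)
  then have 1: "real (card (linear_forests V E (n - s))) \<le> num_hamilton_cycles V E * ?N ^ (2 * (s + k))" by (simp add: add.commute)
  have "real n \<le> ?N" using n by (simp add: power2_eq_square) (metis le_add_same_cancel1 le_square mult_of_nat_commute of_nat_0_le_iff of_nat_le_iff of_nat_mult order_trans zero_le_one add_increasing)
  then have "real n ^ s \<le> ?N ^ s" by (intro power_mono) auto
  also have "\<dots> \<le> ?N ^ (s + k)" using N1 by (intro power_increasing) auto
  finally have 2: "real n ^ s \<le> ?N ^ (s + k)" .
  have "(1 - \<delta>) ^ n * (d / n) ^ n * fact n \<le> card (linear_forests V E (n - s)) * real n ^ s"
    by (rule linear_forests_lower[OF s del eta n(2)])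
  also have "\<dots> \<le> (num_hamilton_cycles V E * ?N ^ (2 * (s + k))) * ?N ^ (s + k)"
    using 1 2 by (intro mult_mono) auto
  also have "\<dots> = num_hamilton_cycles V E * ?N ^ (3 * (s + k))"
  proof -
    have "3 * (s + k) = 2 * (s + k) + (s + k)" by simp
    then show ?thesis by (simp only: power_add mult.assoc)
  qed
  finally show ?thesis .
qed

lemma num_hamilton_cycles_upper:
  assumes s: "s \<le> n" and del: "\<delta> \<ge> 0" and eta: "\<eta> * n \<le> \<delta> * s" and n: "n > 0"
  shows "num_hamilton_cycles V E \<le> (1 + \<delta>) ^ n * (d / n) ^ n * fact n * real n ^ s"
proof -
  have "real (num_hamilton_cycles V E) \<le> real (card (partial_cycles E n))"
    using num_hamilton_cycles_le by (simp only: of_nat_le_iff)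
  also have "\<dots> \<le> (1 + \<delta>) ^ n * (d / n) ^ n * fact n * real n ^ s" by (rule partial_cycles_upper[OF assms])
  finally show ?thesis .
qed

end

section \<open>From the spectral hypothesis to mixing, and the choice of parameters\<close>

lemma ndl_card_nbr:
  assumes G: "ndl_graph n d lam E" and i: "i < n"
  shows "card (nbr E i) = d"
proof -
  have "nbr E i \<subseteq> {..<n}" using G by (auto simp: ndl_graph_def simple_graph_on_def nbr_def)
  then have "nbr E i = {j \<in> {..<n}. {i,j} \<in> E}" by (auto simp: nbr_def)
  moreover have "(\<Sum>j<n. adjacency_mat n E $$ (i,j)) = real (card {j\<in>{..<n}. {i,j} \<in> E})"
    using i by (simp add: adjacency_mat_def sum.If_cases Int_def)
  ultimately show ?thesis using ndl_row_sum[OF G i] by simp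
qed

text \<open>Applying the mixing bound to a vertex and its neighbourhood bounds $\lambda$ from below,
  so a small $\lambda/d$ forces $d$ to be large.\<close>
lemma ndl_mixing_graph:
  assumes G: "ndl_graph n d lam E" and n: "n > 0" and d: "d > 0" and lam: "0 \<le> lam" "lam \<le> \<eta> * d"
    and eta: "0 < \<eta>" "\<eta> \<le> 1/4" "2 \<le> \<eta> * n"
  shows "mixing_graph {..<n} E d \<eta>"
proof
  show "simple_graph_on {..<n} E" using G by (simp add: ndl_graph_def)
  show "card (nbr E v) = d" if "v \<in> {..<n}" for v using ndl_card_nbr[OF G] that by simp
  show "\<bar>real (card (edge_pairs E S T)) - d * card S * card T / card {..<n}\<bar> \<le> \<eta> * d * sqrt (card S * card T)"
    if "S \<subseteq> {..<n}" "T \<subseteq> {..<n}" for S T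
  proof -
    have "lam * sqrt (card S * card T) \<le> \<eta> * d * sqrt (card S * card T)" using lam by (intro mult_right_mono) auto
    then show ?thesis using ndl_mixing[OF G n lam(1) that] by simp
  qed
  show "0 < \<eta>" by (rule eta)
  show "1 \<le> \<eta> * d"
  \<comment> \<open>In the sparse case mixing for a vertex and its neighbourhood gives d/2 <= \<eta>
    d sqrt d, so \<eta>^2 d >= 1/4, and \<eta> <= 1/4 yields \<eta> d >= 1. If d > n/2, then \<eta>
    n >= 2 suffices.\<close>
  proof (cases "2 * d \<le> n")
    case True
    have sub: "nbr E 0 \<subseteq> {..<n}" using G by (auto simp: ndl_graph_def simple_graph_on_def nbr_def)
    have "edge_pairs E {0} (nbr E 0) = Pair 0 ` nbr E 0" by (auto simp: edge_pairs_def nbr_def)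
    then have c: "card (edge_pairs E {0} (nbr E 0)) = d"
      using ndl_card_nbr[OF G n] by (simp add: card_image inj_on_def)
    have "\<bar>real d - d * 1 * d / n\<bar> \<le> lam * sqrt (1 * d)"
      using ndl_mixing[OF G n lam(1) _ sub, of "{0}"] c ndl_card_nbr[OF G n] n by simp
    then have 1: "real d - real d * d / n \<le> lam * sqrt d" by simp
    have "real d * (2 * d) \<le> real d * n" using True by (intro mult_left_mono) auto
    then have "real d * d / n \<le> real d / 2" using n by (simp add: field_simps)
    then have "real d / 2 \<le> lam * sqrt d" using 1 by linarith
    also have "\<dots> \<le> \<eta> * d * sqrt d" using lam by (intro mult_right_mono) auto
    finally have "d * (1/2) \<le> d * (\<eta> * sqrt d)" by (simp add: mult_ac)
    then have h: "1/2 \<le> \<eta> * sqrt d" by (rule mult_left_le_imp_le) (use d in simp)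
    have "(1/2)\<^sup>2 \<le> (\<eta> * sqrt d)\<^sup>2" using h by (intro power_mono) auto
    then have "1/4 \<le> \<eta> * (\<eta> * d)" by (simp add: power2_eq_square mult_ac)
    also have "\<dots> \<le> (1/4) * (\<eta> * d)" using eta by (intro mult_right_mono) auto
    finally show ?thesis by simp
  next
    case False
    then have "real n \<le> 2 * real d" by linarith
    then have "\<eta> * n \<le> \<eta> * (2 * real d)" using eta by (intro mult_left_mono) auto
    then show ?thesis using eta(3) by linarith
  qed
qed

lemma root_sandwich:
  fixes c l u :: real
  assumes n: "n > 0" and "0 \<le> l" "0 \<le> u" "l ^ n \<le> c" "c \<le> u ^ n"
  shows "l \<le> root n c" "root n c \<le> u"
proof -
  have "root n (l ^ n) \<le> root n c" "root n c \<le> root n (u ^ n)" using assms by simp_all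
  then show "l \<le> root n c" "root n c \<le> u" using assms by (simp_all add: real_root_power_cancel)
qed

lemma exp_neg_ln_power: "N > 0 \<Longrightarrow> exp (- (real k * ln N)) = 1 / N ^ k"
  by (simp add: exp_minus exp_of_nat_mult inverse_eq_divide)

text \<open>In order: \<eta> and \<delta> vanish; \<eta> n grows; blocks are longer than 24 \<eta> n
  and arbitrarily long; s <= n eventually; n^s and the entropy of the exchanges are exp(o(n)). The
  last two are of orders (log n)^(-e/2) and at most (log n)^(-e/2) + (log n)^(-2e).\<close>

lemma parameter_limits:
  fixes e :: real
  assumes "e > 0"
  shows "(\<lambda>n::nat. ln n powr -(1 + e)) \<longlonglongrightarrow> 0"
    "(\<lambda>n::nat. ln n powr -(e/2)) \<longlonglongrightarrow> 0"
    "filterlim (\<lambda>n::nat. ln n powr -(1 + e) * n) at_top at_top"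
    "filterlim (\<lambda>n::nat. n / (10 * (2 * ln n + 1)) - 24 * (ln n powr -(1 + e)) * n) at_top at_top"
    "filterlim (\<lambda>n::nat. n - (2 * real n * (ln n powr -(1 + e/2)) + 1)) at_top at_top"
    "(\<lambda>n::nat. (2 * real n * (ln n powr -(1 + e/2)) + 1) * ln n / n) \<longlonglongrightarrow> 0"
    "(\<lambda>n::nat. 3 * (4 * (2 * real n * (ln n powr -(1 + e/2)) + 1) +
      (4 * (8 * (ln n powr -(2 + 2 * e)) * n + 1) + 1) * (4 * (2 * ln n + 1) + 1)) * ln (real n ^ 2 + 1) / n) \<longlonglongrightarrow> 0"
  using assms by real_asymp+

text \<open>Taking the n-th root turns the lost factors, powers of n and of n^2 + 1 with exponents
  \<open>s\<close> and \<open>3 * (s + k)\<close>, into exponentials of quantities tending to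
  0.\<close>

lemma ndl_root_bounds:
  fixes e :: real
  assumes e: "e > 0" and G: "ndl_graph n d lam E" and ratio: "d / lam \<ge> ln n powr (1 + e)"
    and n: "n \<ge> 3" and small: "ln n powr -(1 + e) \<le> 1/40" "ln n powr -(e/2) \<le> 1"
    and big: "ln n powr -(1 + e) * n \<ge> 2" "n / (10 * (2 * ln n + 1)) - 24 * (ln n powr -(1 + e)) * n \<ge> 40"
      "n - (2 * real n * (ln n powr -(1 + e/2)) + 1) \<ge> 0"
  defines "c \<equiv> num_hamilton_cycles {..<n} E / (fact n * (d / n) ^ n)"
  shows "d > 0" "(1 - ln n powr -(e/2)) * exp (- (3 * (4 * (2 * real n * (ln n powr -(1 + e/2)) + 1) +
      (4 * (8 * (ln n powr -(2 + 2 * e)) * n + 1) + 1) * (4 * (2 * ln n + 1) + 1)) * ln (real n ^ 2 + 1) / n)) \<le> root n c"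
    "root n c \<le> (1 + ln n powr -(e/2)) * exp ((2 * real n * (ln n powr -(1 + e/2)) + 1) * ln n / n)"
proof -
  have L: "ln (real n) > 0" using n by simp
  \<comment> \<open>The target is \<open>2 * \<eta> * n\<close> <= \<open>\<delta> * s\<close> with
    \<delta> and s log n / n both tending to 0. Splitting the exponent 1 + e as e/2 + (1 + e/2)
    between \<delta> and s/n achieves it.\<close>
  define \<eta> where "\<eta> = ln n powr -(1 + e)"
  define \<delta> where "\<delta> = ln n powr -(e/2)"
  define s where "s = nat \<lceil>2 * real n * (ln n powr -(1 + e/2))\<rceil>"
  define T where "T = nat \<lceil>2 * ln n\<rceil>"
  define m where "m = n div (10 * T)"
  define q where "q = nat \<lfloor>8 * (ln n powr -(2 + 2 * e)) * n\<rfloor> + 1"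
  define k where "k = 3 * s + (4 * q + 1) * (4 * T + 1)"
  \<comment> \<open>Division by 0 gives 0, so positivity of the ratio rules out \<open>d = 0\<close>
    as well as \<open>lam\<close> being zero or negative.\<close>
  have ratio0: "d / lam > 0" using ratio L by (smt (verit) powr_gt_zero)
  then show d: "d > 0" by (cases d) auto
  have lam: "lam > 0" using ratio0 d by (simp add: zero_less_divide_iff)
  have eta0: "\<eta> > 0" using L by (simp add: \<eta>_def)
  have "\<eta> * (ln n powr (1 + e)) = 1" unfolding \<eta>_def powr_minus using L by simp
  moreover have "\<eta> * (ln n powr (1 + e)) * lam \<le> \<eta> * (d / lam) * lam"
    using ratio eta0 lam by (intro mult_right_mono mult_left_mono) auto
  ultimately have lam_le: "lam \<le> \<eta> * d" using lam by simp
  interpret mixing_graph "{..<n}" E d \<eta>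
    by (rule ndl_mixing_graph[OF G _ d _ lam_le]) (use n lam eta0 small big in \<open>auto simp: \<eta>_def\<close>)
  have sle: "real s \<le> 2 * real n * (ln n powr -(1 + e/2)) + 1" unfolding s_def by (simp add: of_nat_nat)
  have sge: "2 * real n * (ln n powr -(1 + e/2)) \<le> s" unfolding s_def by linarith
  have sn: "s \<le> n" using sle big(3) by linarith
  have Tle: "real T \<le> 2 * ln n + 1" and Tge: "2 * ln n \<le> T" unfolding T_def using L by linarith+
  have T1: "T \<ge> 1" using Tge L by linarith
  have T2: "real n \<le> 2 ^ T"
  proof -
    have "1/2 \<le> ln (2::real)" using ln_le_minus_one[of "1/2::real"] by (simp add: ln_div)
    then have "1 * ln (real n) \<le> (2 * ln 2) * ln n" using L by (intro mult_right_mono) auto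
    also have "\<dots> \<le> T * ln 2" using mult_right_mono[OF Tge, of "ln 2"] by (simp add: mult_ac)
    finally have "exp (ln (real n)) \<le> exp (T * ln 2)" by simp
    then show ?thesis using n by (simp add: exp_of_nat_mult)
  qed
  have m_ge: "real m \<ge> n / (10 * (2 * ln n + 1)) - 1"
  proof -
    have "real n / (10 * (2 * ln n + 1)) \<le> n / (10 * T)" using Tle T1 L by (intro divide_left_mono mult_pos_pos) auto
    moreover have "real n / (10 * T) \<le> real m + 1"
    proof -
      have "n < (m + 1) * (10 * T)" unfolding m_def using T1 by (simp add: dividend_less_div_times)
      then have "real n < real ((m + 1) * (10 * T))" by (simp only: of_nat_less_iff)
      then show ?thesis using T1 by (simp add: field_simps)
    qed
    ultimately show ?thesis by linarith
  qed
  have etan: "0 < \<eta> * n" using eta0 n by simp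
  have m24: "24 * \<eta> * n < m" using m_ge big(2) unfolding \<eta>_def by linarith
  have m32: "m \<ge> 32"
  proof -
    have "real m \<ge> 39" using m_ge big(2) etan unfolding \<eta>_def by linarith
    then show ?thesis by linarith
  qed
  have eta_sq: "\<eta>\<^sup>2 = ln n powr -(2 + 2 * e)"
    by (simp add: \<eta>_def power2_eq_square flip: powr_add)
  have q0: "0 \<le> 8 * (ln n powr -(2 + 2 * e)) * n" by simp
  have qgt: "8 * \<eta>\<^sup>2 * n < real q" unfolding eta_sq q_def using q0 by linarith
  have qle: "real q \<le> 8 * (ln n powr -(2 + 2 * e)) * n + 1" unfolding q_def using q0 by linarith
  have del: "\<delta> \<ge> 0" "\<delta> \<le> 1" using small by (auto simp: \<delta>_def)
  have eds: "2 * \<eta> * n \<le> \<delta> * s"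
  proof -
    have "-(1 + e) = -(e/2) + -(1 + e/2)" by simp
    then have "\<eta> = \<delta> * (ln n powr -(1 + e/2))" unfolding \<eta>_def \<delta>_def by (simp only: powr_add)
    then have "2 * \<eta> * n = \<delta> * (2 * real n * (ln n powr -(1 + e/2)))" by simp
    also have "\<dots> \<le> \<delta> * s" using sge del by (intro mult_left_mono) auto
    finally show ?thesis .
  qed
  have eds': "\<eta> * n \<le> \<delta> * s" using eds etan by linarith
  have n0: "n > 0" using n by simp
  define F where "F = fact n * (d / n) ^ n"
  have F: "F > 0" using d n0 by (simp add: F_def)
  define N where "N = real n ^ 2 + 1"
  have N: "N \<ge> 1" by (simp add: N_def)
  have lower: "(1 - \<delta>) ^ n * (d / n) ^ n * fact n \<le> num_hamilton_cycles {..<n} E * N ^ (3 * (s + k))"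
    using num_hamilton_cycles_lower[of s \<delta> T m q k] sn del eds T2 T1 small(1) m24 m32 qgt
    unfolding N_def by (simp add: m_def k_def \<eta>_def)
  have upper: "num_hamilton_cycles {..<n} E \<le> (1 + \<delta>) ^ n * (d / n) ^ n * fact n * real n ^ s"
    using num_hamilton_cycles_upper[of s \<delta>] sn del eds' n0 by simp
  have "real (s + k) \<le> 4 * (2 * real n * (ln n powr -(1 + e/2)) + 1) +
      (4 * (8 * (ln n powr -(2 + 2 * e)) * n + 1) + 1) * (4 * (2 * ln n + 1) + 1)"
  proof -
    have "real ((4 * q + 1) * (4 * T + 1)) = (4 * real q + 1) * (4 * real T + 1)" by (simp add: algebra_simps)
    also have "\<dots> \<le> (4 * (8 * (ln n powr -(2 + 2 * e)) * n + 1) + 1) * (4 * (2 * ln n + 1) + 1)"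
      using qle Tle by (intro mult_mono) auto
    finally show ?thesis using sle unfolding k_def by simp
  qed
  then have "3 * real (s + k) * ln N / n \<le> 3 * (4 * (2 * real n * (ln n powr -(1 + e/2)) + 1) +
      (4 * (8 * (ln n powr -(2 + 2 * e)) * n + 1) + 1) * (4 * (2 * ln n + 1) + 1)) * ln N / n" (is "_ \<le> ?B")
    using N by (intro divide_right_mono mult_right_mono mult_left_mono) auto
  then have B: "exp (- ?B) \<le> exp (- (3 * real (s + k) * ln N / n))" by simp
  have A: "exp (s * ln n / n) \<le> exp ((2 * real n * (ln n powr -(1 + e/2)) + 1) * ln n / n)"
    using sle L by (intro exp_le_cancel_iff[THEN iffD2] divide_right_mono mult_right_mono) auto
  have cross_le: "a / M \<le> h / F" if "F > 0" "a * F \<le> h * M" "M > 0" for a h M :: real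
    using that by (simp add: field_simps)
  have expn: "exp (x / n) ^ n = exp x" for x using n0 by (simp flip: exp_of_nat_mult)
  have "(1 - \<delta>) * exp (- (3 * real (s + k) * ln N / n)) \<le> root n c"
    and "root n c \<le> (1 + \<delta>) * exp (s * ln n / n)"
  proof (rule root_sandwich(1)[OF n0, where u = "root n c"])
    have "((1 - \<delta>) * exp (- (3 * real (s + k) * ln N / n))) ^ n = (1 - \<delta>) ^ n * exp (- (real (3 * (s + k)) * ln N))"
      using expn[of "- (3 * real (s + k) * ln N)"] by (simp add: power_mult_distrib)
    also have "\<dots> = (1 - \<delta>) ^ n / N ^ (3 * (s + k))" using exp_neg_ln_power[of N "3 * (s + k)"] N by simp
    also have "\<dots> \<le> c"
    proof -
      have "(1 - \<delta>) ^ n * F \<le> num_hamilton_cycles {..<n} E * N ^ (3 * (s + k))"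
        using lower by (simp add: F_def mult_ac)
      moreover have "N ^ (3 * (s + k)) > 0" using N by simp
      ultimately show ?thesis unfolding c_def F_def[symmetric] by (rule cross_le[OF F])
    qed
    finally show "((1 - \<delta>) * exp (- (3 * real (s + k) * ln N / n))) ^ n \<le> c" .
    show "c \<le> root n c ^ n" "0 \<le> root n c" using n0 F by (simp_all add: c_def)
  next
    have c0: "c \<ge> 0" by (simp add: c_def)
    have "((1 + \<delta>) * exp (s * ln n / n)) ^ n = (1 + \<delta>) ^ n * real n ^ s"
      using expn[of "s * ln n"] n0 by (simp add: power_mult_distrib exp_of_nat_mult)
    moreover have "c \<le> (1 + \<delta>) ^ n * real n ^ s"
      unfolding c_def F_def[symmetric] pos_divide_le_eq[OF F] using upper by (simp add: F_def mult_ac)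
    ultimately have "c \<le> ((1 + \<delta>) * exp (s * ln n / n)) ^ n" by simp
    then show "root n c \<le> (1 + \<delta>) * exp (s * ln n / n)"
      using root_sandwich(2)[OF n0, of 0 "(1 + \<delta>) * exp (s * ln n / n)" c] c0 del n0 by (simp add: zero_power)
  qed (use del in auto)
  then show "(1 - ln n powr -(e/2)) * exp (- (3 * (4 * (2 * real n * (ln n powr -(1 + e/2)) + 1) +
      (4 * (8 * (ln n powr -(2 + 2 * e)) * n + 1) + 1) * (4 * (2 * ln n + 1) + 1)) * ln (real n ^ 2 + 1) / n)) \<le> root n c"
    "root n c \<le> (1 + ln n powr -(e/2)) * exp ((2 * real n * (ln n powr -(1 + e/2)) + 1) * ln n / n)"
    using mult_left_mono[OF B, of "1 - \<delta>"] mult_left_mono[OF A, of "1 + \<delta>"] del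
    unfolding \<delta>_def N_def by linarith+
qed

theorem theorem1:
  fixes \<epsilon> :: real
    and d :: "nat \<Rightarrow> nat"
    and lam :: "nat \<Rightarrow> real"
    and G :: "nat \<Rightarrow> nat set set"
  assumes "\<epsilon> > 0"
    and "\<And>n. ndl_graph n (d n) (lam n) (G n)"
    and "\<forall>\<^sub>F n in sequentially. real (d n) / lam n \<ge> ln (real n) powr (1 + \<epsilon>)"
    and "filterlim (\<lambda>n. ln (real (d n)) * ln (real (d n) / lam n) / ln (real n)) at_top sequentially"
  shows "\<exists>\<delta> :: nat \<Rightarrow> real. \<delta> \<longlonglongrightarrow> 0 \<and>
           (\<forall>\<^sub>F n in sequentially.
              real (num_hamilton_cycles {..<n} (G n)) =
                fact n * (real (d n) / real n) ^ n * (1 + \<delta> n) ^ n)"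
proof -
  note lims = parameter_limits[OF assms(1)]
  \<comment> \<open>With the error term chosen as the n-th root of \<open>c n\<close> minus 1, the
    stated equation holds by definition wherever \<open>d n > 0\<close>, and only the limit of the
    root needs proof.\<close>
  define c where "c n = num_hamilton_cycles {..<n} (G n) / (fact n * (d n / n) ^ n)" for n
  let ?lo = "\<lambda>n. (1 - ln n powr -(\<epsilon>/2)) * exp (- (3 * (4 * (2 * real n * (ln n powr -(1 + \<epsilon>/2)) + 1) +
      (4 * (8 * (ln n powr -(2 + 2 * \<epsilon>)) * n + 1) + 1) * (4 * (2 * ln n + 1) + 1)) * ln (real n ^ 2 + 1) / n))"
  let ?hi = "\<lambda>n. (1 + ln n powr -(\<epsilon>/2)) * exp ((2 * real n * (ln n powr -(1 + \<epsilon>/2)) + 1) * ln n / n)"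
  have ev: "\<forall>\<^sub>F n in sequentially. n \<ge> 3 \<and> d n > 0 \<and> ?lo n \<le> root n (c n) \<and> root n (c n) \<le> ?hi n"
  proof -
    have "\<forall>\<^sub>F n in sequentially. ln (real n) powr -(1 + \<epsilon>) < 1/40" by (rule order_tendstoD(2)[OF lims(1)]) simp
    moreover have "\<forall>\<^sub>F n in sequentially. ln (real n) powr -(\<epsilon>/2) < 1" by (rule order_tendstoD(2)[OF lims(2)]) simp
    moreover have "\<forall>\<^sub>F n in sequentially. 2 \<le> ln (real n) powr -(1 + \<epsilon>) * n"
      using lims(3) unfolding filterlim_at_top by blast
    moreover have "\<forall>\<^sub>F n in sequentially. 40 \<le> n / (10 * (2 * ln (real n) + 1)) - 24 * (ln (real n) powr -(1 + \<epsilon>)) * n"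
      using lims(4) unfolding filterlim_at_top by blast
    moreover have "\<forall>\<^sub>F n in sequentially. 0 \<le> n - (2 * real n * (ln (real n) powr -(1 + \<epsilon>/2)) + 1)"
      using lims(5) unfolding filterlim_at_top by blast
    ultimately show ?thesis using assms(3) eventually_ge_at_top[of "3::nat"]
    proof eventually_elim
      case (elim n)
      show ?case
        using ndl_root_bounds[OF assms(1,2) elim(6,7) less_imp_le[OF elim(1)] less_imp_le[OF elim(2)] elim(3-5)] elim(7)
        unfolding c_def by simp
    qed
  qed
  have "?lo \<longlonglongrightarrow> (1 - 0) * exp (- 0)"
    by (intro tendsto_mult tendsto_diff tendsto_const tendsto_exp tendsto_minus lims)
  then have lo: "?lo \<longlonglongrightarrow> 1" by simp
  have "?hi \<longlonglongrightarrow> (1 + 0) * exp 0"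
    by (intro tendsto_mult tendsto_add tendsto_const tendsto_exp lims)
  then have hi: "?hi \<longlonglongrightarrow> 1" by simp
  have "(\<lambda>n. root n (c n)) \<longlonglongrightarrow> 1"
    by (rule tendsto_sandwich[OF _ _ lo hi]; rule eventually_mono[OF ev]) auto
  then have "(\<lambda>n. root n (c n) - 1) \<longlonglongrightarrow> 0" by (simp add: LIM_zero)
  moreover have "\<forall>\<^sub>F n in sequentially. real (num_hamilton_cycles {..<n} (G n)) =
      fact n * (real (d n) / real n) ^ n * (1 + (root n (c n) - 1)) ^ n"
    using ev
  proof eventually_elim
    case (elim n)
    then have "root n (c n) ^ n = c n" by (simp add: c_def)
    then show ?case using elim by (simp add: c_def)
  qed
  ultimately show ?thesis by (intro exI[of _ "\<lambda>n. root n (c n) - 1"]) simp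
qed

end
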